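(* There exists an absolute constant $c_0>0$ for which the following holds. Let $F$ be a class of functions, with associated loss class $\ell_F=\{\ell_f: f\in F\}$, and assume that there exists $B_n\ge 0$ such that for every $f\in F$, $P\ell_f^2\le B_nP\ell_f+B_n^2/n$. Let $0<\epsilon<1/2$, let $\lambda_\epsilon^*>0$ be such that $$\mathbb{E}\|P_n-P\|_{V(\ell_F)_{\lambda_\epsilon^*}}\le(\epsilon/4)\lambda_\epsilon^*,$$ and let $\rho_n$ be an increasing function such that for every $x>0$, $$\rho_n(x)\ge\max\Big(\lambda_\epsilon^*,\ c_0\frac{(b_n(\ell_F)+B_n/\epsilon)\,x}{n\epsilon}\Big).$$ Then, for every $x>0$, with probability greater than $1-8\exp(-x)$, $$R(\hat f_n^{\mathrm{ERM}})\le(1+3\epsilon)\inf_{f\in F}R(f)+\rho_n(x).$$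
   Context: Let $\mathcal{Z}$ be a space endowed with a probability measure $P$, and let $Z,Z_1,\dots,Z_n$ be independent random variables with values in $\mathcal{Z}$ distributed according to $P$; $\mathcal{D}=(Z_1,\dots,Z_n)$ is the data. A loss function $\ell$ associates a real number $\ell(f,z)$ to any real-valued measurable function $f$ on $\mathcal{Z}$ and any $z\in\mathcal{Z}$; write $\ell_f=\ell(f,\cdot)$. The risk is $R(f)=\mathbb{E}\,\ell_f(Z)$ and the empirical risk is $R_n(f)=\frac1n\sum_{i=1}^n\ell_f(Z_i)$. For a data-dependent function $\hat f_n$, $R(\hat f_n)=\mathbb{E}[\ell_{\hat f_n}(Z)\mid\mathcal{D}]$. The class $F$ consists of real-valued measurable functions on $\mathcal{Z}$; it is assumed that $\inf_{f\in F}R(f)$ is attained by some element of $F$. The empirical risk minimization procedure is $\hat f_n^{\mathrm{ERM}}\in\mathrm{Arg\,min}_{f\in F}R_n(f)$; when $R_n$ does not achieve its infimum over $F$, or if the minimizer is not unique, $\hat f_n^{\mathrm{ERM}}$ is defined to be an element of $F$ for which $R_n(\hat f_n^{\mathrm{ERM}})\le\inf_{f\in F}R_n(f)+1/n$. For a function $g$ on $\mathcal{Z}$, $Pg=\mathbb{E}g(Z)$ and $P_ng=\frac1n\sum_{i=1}^ng(Z_i)$. For a class $G$ of real-valued functions on $\mathcal{Z}$: - $\|P-P_n\|_G=\sup_{g\in G}|(P-P_n)(g)|$; - the $\psi_1$ norm of a random variable $U$ is $\|U\|_{\psi_1}=\inf\{c>0:\mathbb{E}\exp(|U|/c)\le2\}$;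 - $b_n(G)=\big\|\max_{1\le i\le n}\sup_{g\in G}|g(Z_i)|\big\|_{\psi_1}$; - $V(G)=\{\theta g:0\le\theta\le1,\ g\in G\}$, and for $\lambda\ge0$, $V(G)_\lambda=\{h\in V(G):Ph\le\lambda\}$. Separability (standing assumption): each indexing class $G=V(\ell_F)_\lambda$, $\lambda>0$, contains a countable subset $G_0$ such that every $g\in G$ is the pointwise limit on $\mathcal{Z}$ of a sequence of elements of $G_0$.
   Formalization: Since the 1/n tolerance makes the printed claim false for tiny losses, it is also assumed that the ERM is a.s. an exact minimizer of R_n, or that ρ_n(x) ≥ c_0 min(1,x)/n for all x>0 (automatic if ε ≤ b_n+B_n/ε); c_0 is stated per choice of underlying types. *)

theory Defs
  imports "HOL-Probability.Probability"
begin

text \<open>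
  The random variables \<open>Z, Z\<^sub>1, \<dots>, Z\<^sub>n\<close> are \<open>X 0, X 1, \<dots>, X n\<close>, where
  \<open>M\<close> is the underlying probability space and \<open>P\<close> the common law.
\<close>

definition iid_sample :: "'w measure \<Rightarrow> 'z measure \<Rightarrow> nat \<Rightarrow> (nat \<Rightarrow> 'w \<Rightarrow> 'z) \<Rightarrow> bool" where
  "iid_sample M P n X \<longleftrightarrow>
     prob_space M \<and> prob_space P \<and>
     prob_space.indep_vars M (\<lambda>_. P) X {0..n} \<and>
     (\<forall>i\<in>{0..n}. distr M P (X i) = P)"

definition data :: "nat \<Rightarrow> (nat \<Rightarrow> 'w \<Rightarrow> 'z) \<Rightarrow> 'w \<Rightarrow> (nat \<Rightarrow> 'z)" where
  "data n X \<omega> = (\<lambda>i\<in>{1..n}. X i \<omega>)"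

abbreviation data_space :: "'z measure \<Rightarrow> nat \<Rightarrow> (nat \<Rightarrow> 'z) measure" where
  "data_space P n \<equiv> Pi\<^sub>M {1..n} (\<lambda>_. P)"

definition mean :: "'z measure \<Rightarrow> ('z \<Rightarrow> real) \<Rightarrow> real" where
  "mean P g = (\<integral>z. g z \<partial>P)"

definition emp_mean :: "nat \<Rightarrow> (nat \<Rightarrow> 'z) \<Rightarrow> ('z \<Rightarrow> real) \<Rightarrow> real" where
  "emp_mean n d g = (\<Sum>i=1..n. g (d i)) / real n"

definition risk :: "'z measure \<Rightarrow> (('z \<Rightarrow> real) \<Rightarrow> 'z \<Rightarrow> real) \<Rightarrow> ('z \<Rightarrow> real) \<Rightarrow> real" where
  "risk P loss f = mean P (loss f)"

definition emp_risk :: "nat \<Rightarrow> (nat \<Rightarrow> 'z) \<Rightarrow> (('z \<Rightarrow> real) \<Rightarrow> 'z \<Rightarrow> real) \<Rightarrow> ('z \<Rightarrow> real) \<Rightarrow> real" where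
  "emp_risk n d loss f = emp_mean n d (loss f)"

text \<open>The conditional expectation of \<open>loss (fhat \<D>) Z\<close> given the data \<open>\<D>\<close>.\<close>

definition cond_risk ::
  "'w measure \<Rightarrow> 'z measure \<Rightarrow> nat \<Rightarrow> (nat \<Rightarrow> 'w \<Rightarrow> 'z) \<Rightarrow> (('z \<Rightarrow> real) \<Rightarrow> 'z \<Rightarrow> real) \<Rightarrow>
   ((nat \<Rightarrow> 'z) \<Rightarrow> 'z \<Rightarrow> real) \<Rightarrow> 'w \<Rightarrow> real" where
  "cond_risk M P n X loss fhat =
     real_cond_exp M (vimage_algebra (space M) (data n X) (data_space P n))
       (\<lambda>\<omega>. loss (fhat (data n X \<omega>)) (X 0 \<omega>))"

text \<open>
  Suprema over function classes may be infinite, so they are taken in \<^typ>\<open>ennreal\<close>,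
  and so are the expectations and the \<open>\<psi>\<^sub>1\<close> norm built from them; in \<open>psi1_norm\<close>, \<open>U\<close>
  stands for the absolute value of the random variable. An empty infimum is \<open>\<infinity>\<close>.
\<close>

definition emp_dev :: "'z measure \<Rightarrow> nat \<Rightarrow> (nat \<Rightarrow> 'z) \<Rightarrow> ('z \<Rightarrow> real) set \<Rightarrow> ennreal" where
  "emp_dev P n d G = (SUP g\<in>G. ennreal \<bar>mean P g - emp_mean n d g\<bar>)"

definition exp_ennreal :: "ennreal \<Rightarrow> ennreal" where
  "exp_ennreal u = (if u = \<infinity> then \<infinity> else ennreal (exp (enn2real u)))"

definition psi1_norm :: "'w measure \<Rightarrow> ('w \<Rightarrow> ennreal) \<Rightarrow> ennreal" where
  "psi1_norm M U =
     (INF c\<in>{c::real. 0 < c \<and> (\<integral>\<^sup>+\<omega>. exp_ennreal (U \<omega> / ennreal c) \<partial>M) \<le> 2}. ennreal c)"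

definition envelope_norm ::
  "'w measure \<Rightarrow> nat \<Rightarrow> (nat \<Rightarrow> 'w \<Rightarrow> 'z) \<Rightarrow> ('z \<Rightarrow> real) set \<Rightarrow> ennreal" where
  "envelope_norm M n X G =
     psi1_norm M (\<lambda>\<omega>. MAX i\<in>{1..n}. SUP g\<in>G. ennreal \<bar>g (X i \<omega>)\<bar>)"

definition star_hull :: "('z \<Rightarrow> real) set \<Rightarrow> ('z \<Rightarrow> real) set" where
  "star_hull G = {h. \<exists>\<theta> g. 0 \<le> \<theta> \<and> \<theta> \<le> 1 \<and> g \<in> G \<and> h = (\<lambda>z. \<theta> * g z)}"

definition star_hull_level :: "'z measure \<Rightarrow> ('z \<Rightarrow> real) set \<Rightarrow> real \<Rightarrow> ('z \<Rightarrow> real) set" where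
  "star_hull_level P G lam = {h \<in> star_hull G. mean P h \<le> lam}"

definition separable_class :: "'z measure \<Rightarrow> ('z \<Rightarrow> real) set \<Rightarrow> bool" where
  "separable_class P G \<longleftrightarrow>
     (\<exists>G0\<subseteq>G. countable G0 \<and>
        (\<forall>g\<in>G. \<exists>s. (\<forall>k. s k \<in> G0) \<and> (\<forall>z\<in>space P. (\<lambda>k. s k z) \<longlonglongrightarrow> g z)))"

definition emp_minimizer ::
  "(('z \<Rightarrow> real) \<Rightarrow> 'z \<Rightarrow> real) \<Rightarrow> ('z \<Rightarrow> real) set \<Rightarrow> nat \<Rightarrow> (nat \<Rightarrow> 'z) \<Rightarrow> ('z \<Rightarrow> real) \<Rightarrow> bool" where
  "emp_minimizer loss F n d f \<longleftrightarrow> f \<in> F \<and> (\<forall>g\<in>F. emp_risk n d loss f \<le> emp_risk n d loss g)"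

definition is_ERM ::
  "(('z \<Rightarrow> real) \<Rightarrow> 'z \<Rightarrow> real) \<Rightarrow> ('z \<Rightarrow> real) set \<Rightarrow> nat \<Rightarrow> (nat \<Rightarrow> 'z) \<Rightarrow> ('z \<Rightarrow> real) \<Rightarrow> bool" where
  "is_ERM loss F n d f \<longleftrightarrow>
     (if \<exists>!g. emp_minimizer loss F n d g then emp_minimizer loss F n d f
      else f \<in> F \<and>
        ereal (emp_risk n d loss f) \<le> (INF g\<in>F. ereal (emp_risk n d loss g)) + ereal (1 / real n))"

text \<open>
  The tolerance \<open>1 / n\<close> in \<open>is_ERM\<close> is not invariant under rescaling of the loss, whereas the
  other quantities are: if the losses are all at most \<open>1 / n\<close> and two elements of \<open>F\<close> minimize the
  empirical risk, every element of \<open>F\<close> is an ERM. An oracle inequality with residual \<open>\<rho>\<close> can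
  therefore hold only for exact minimizers, or for \<open>\<rho>\<close> not negligible compared to \<open>1 / n\<close>.
  If \<open>\<epsilon> \<le> b\<^sub>n + B\<^sub>n / \<epsilon>\<close>, the second alternative below follows from
  \<open>\<rho> x \<ge> c0 * (b\<^sub>n + B\<^sub>n / \<epsilon>) * x / (n * \<epsilon>)\<close>.
\<close>

definition tolerance_ok ::
  "'w measure \<Rightarrow> nat \<Rightarrow> (nat \<Rightarrow> 'w \<Rightarrow> 'z) \<Rightarrow> (('z \<Rightarrow> real) \<Rightarrow> 'z \<Rightarrow> real) \<Rightarrow> ('z \<Rightarrow> real) set \<Rightarrow>
   ((nat \<Rightarrow> 'z) \<Rightarrow> 'z \<Rightarrow> real) \<Rightarrow> real \<Rightarrow> (real \<Rightarrow> real) \<Rightarrow> bool" where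
  "tolerance_ok M n X loss F fhat c0 \<rho> \<longleftrightarrow>
     (AE \<omega> in M. emp_minimizer loss F n (data n X \<omega>) (fhat (data n X \<omega>))) \<or>
     (\<forall>x>0. c0 * min 1 x / real n \<le> \<rho> x)"

end

theory Submission
  imports Defs
begin

text \<open>
  Everything rests on a deviation inequality for the supremum of the empirical process over the
  localized star hull at level \<open>\<lambda> = \<rho> x\<close>: outside an event of probability \<open>2 * exp (- x)\<close> it is at
  most \<open>(3 / 4) * \<epsilon> * \<lambda>\<close>. Star-shapedness turns the hypothesis at \<open>lam\<close> into the bound
  \<open>(\<epsilon> / 4) * \<lambda>\<close> for the expected supremum at level \<open>\<lambda> \<ge> lam\<close>, so a concentration inequality that
  loses a factor 2 in front of the expectation is good enough.

  Such an inequality is obtained by truncating at twice the exponential norm \<open>b\<close> of the envelope.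
  The truncated part is handled by the entropy method, in Bousquet's form: the entropy of
  \<open>exp (l * Z)\<close> is compared coordinate by coordinate with the leave-one-out supremum, whose
  maximizer gives a centred lower bound for the increment. The large values have sum \<open>O(b * x)\<close>,
  because they are so rare that their sum behaves like the maximum.

  Finally \<open>(1 - (3 / 4) * \<epsilon>) * (1 + 3 * \<epsilon>) \<ge> 1 + (3 / 4) * \<epsilon>\<close> for \<open>\<epsilon> < 1 / 2\<close>, so comparing the
  empirical risks of the ERM and of a risk minimizer yields the oracle inequality.
\<close>

section \<open>Subadditivity of entropy\<close>

text \<open>Measurability shapes the route. Neither the supremum over the class nor its envelope
  need be measurable, so concentration is proved for maxima over finite classes only. The bounds do
  not depend on the finite class; they pass to a countable class by a monotone limit and from there
  to the whole level set by separability. Possibly non-measurable suprema occur only as upper bounds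
  of integrands.

  Truncation is needed because the entropy method wants increments bounded by a constant. The usual
  square-root variance term is replaced by a free parameter \<open>\<tau>\<close>: a variance term
  divided by \<open>\<tau>\<close> plus a linear term proportional to \<open>\<tau>\<close>. With
  \<open>\<tau> = 4 * (b + B / \<epsilon>)\<close>, the allowance of 3/4 (in units of
  \<open>n * \<epsilon> * \<lambda>\<close>) splits into 1/2 for twice the expectation, 1/8 for the
  variance and 1/8 for everything else, which fixes all numerical constants.

  Risks may be negative: the variance hypothesis only forces them above \<open>- B / n\<close>,
  which has to be shown negligible against \<open>\<rho> x\<close>.\<close>

definition kl :: "real \<Rightarrow> real \<Rightarrow> real" where
  "kl a b = a * ln (a / b) - a + b"

text \<open>\<open>kl\<close> is the Bregman divergence of t ln t. Its nonnegativity, in this form,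
  is what both facts about integrals of \<open>kl\<close> reduce to.\<close>

lemma mult_ln_div_ge:
  assumes "0 < a" "0 < (b::real)"
  shows "a - b \<le> a * ln (a / b)"
proof -
  have "ln (b / a) \<le> b / a - 1" using assms by (intro ln_le_minus_one) simp
  hence "a * ln (b / a) \<le> a * (b / a - 1)" using assms by (intro mult_left_mono) auto
  also have "\<dots> = b - a" using assms by (simp add: field_simps)
  finally have "a * ln (b / a) \<le> b - a" .
  moreover have "ln (a / b) = - ln (b / a)" using assms by (simp add: ln_div)
  ultimately show ?thesis by simp
qed

lemma (in prob_space) integrable_bounded:
  fixes f :: "'a \<Rightarrow> real"
  assumes "f \<in> borel_measurable M" "\<And>x. x \<in> space M \<Longrightarrow> \<bar>f x\<bar> \<le> K"
  shows "integrable M f"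
  using assms by (intro integrable_const_bound[where B=K]) auto

lemma abs_ln_le:
  assumes "0 < m" "m \<le> a" "a \<le> (K::real)"
  shows "\<bar>ln a\<bar> \<le> \<bar>ln m\<bar> + \<bar>ln K\<bar>"
proof -
  have "ln m \<le> ln a" "ln a \<le> ln K" using assms by auto
  thus ?thesis by linarith
qed

lemma (in prob_space) integrable_mult_ln:
  fixes f u :: "'a \<Rightarrow> real"
  assumes [measurable]: "f \<in> borel_measurable M" "u \<in> borel_measurable M"
    and "0 < m" and f: "\<And>x. x \<in> space M \<Longrightarrow> m \<le> f x \<and> f x \<le> K"
    and u: "\<And>x. x \<in> space M \<Longrightarrow> m \<le> u x \<and> u x \<le> K"
  shows "integrable M (\<lambda>x. f x * ln (u x))"
proof (rule integrable_bounded)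
  fix x assume x: "x \<in> space M"
  have "\<bar>ln (u x)\<bar> \<le> \<bar>ln m\<bar> + \<bar>ln K\<bar>" using abs_ln_le[of m "u x" K] u[OF x] \<open>0 < m\<close> by auto
  moreover have "\<bar>f x\<bar> \<le> K" using f[OF x] \<open>0 < m\<close> by auto
  ultimately show "\<bar>f x * ln (u x)\<bar> \<le> K * (\<bar>ln m\<bar> + \<bar>ln K\<bar>)"
    unfolding abs_mult by (intro mult_mono) auto
qed auto

lemma (in prob_space) integrable_in_interval:
  fixes f :: "'a \<Rightarrow> real"
  assumes "f \<in> borel_measurable M" "0 < m" "\<And>x. x \<in> space M \<Longrightarrow> m \<le> f x \<and> f x \<le> K"
  shows "integrable M f"
proof (rule integrable_bounded[where K=K])
  fix x assume "x \<in> space M"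
  thus "\<bar>f x\<bar> \<le> K" using assms(2) assms(3)[of x] by linarith
qed fact

lemma (in prob_space) integral_in_interval:
  fixes f :: "'a \<Rightarrow> real"
  assumes "f \<in> borel_measurable M" "0 < m" "\<And>x. x \<in> space M \<Longrightarrow> m \<le> f x \<and> f x \<le> K"
  shows "m \<le> (\<integral>x. f x \<partial>M) \<and> (\<integral>x. f x \<partial>M) \<le> K"
  using assms integrable_in_interval[OF assms] by (auto intro!: integral_ge_const integral_le_const AE_I2)

lemma (in prob_space) integrable_kl:
  fixes f u :: "'a \<Rightarrow> real"
  assumes [measurable]: "f \<in> borel_measurable M" "u \<in> borel_measurable M"
    and "0 < m" and f: "\<And>x. x \<in> space M \<Longrightarrow> m \<le> f x \<and> f x \<le> K"
    and u: "\<And>x. x \<in> space M \<Longrightarrow> m \<le> u x \<and> u x \<le> K"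
  shows "integrable M (\<lambda>x. kl (f x) (u x))"
proof -
  have "integrable M (\<lambda>x. f x * ln (f x) - f x * ln (u x) - f x + u x)"
    by (intro Bochner_Integration.integrable_add Bochner_Integration.integrable_diff
        integrable_mult_ln[where m=m and K=K] integrable_in_interval[where m=m and K=K]) fact+
  moreover have "kl (f x) (u x) = f x * ln (f x) - f x * ln (u x) - f x + u x" if "x \<in> space M" for x
    using f[OF that] u[OF that] \<open>0 < m\<close> by (simp add: kl_def ln_div algebra_simps)
  ultimately show ?thesis by (subst Bochner_Integration.integrable_cong[OF refl]) auto
qed

text \<open>Jensen for the jointly convex \<open>kl\<close>. As \<open>kl\<close> is homogeneous of
  degree one, its tangent plane at \<open>(F, V)\<close> passes through the origin;
  \<open>mult_ln_div_ge\<close> with \<open>u x\<close> scaled by \<open>F / V\<close> puts the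
  plane below \<open>kl\<close>, and its integral is \<open>kl F V\<close>.\<close>

lemma (in prob_space) kl_integral_le:
  fixes f u :: "'a \<Rightarrow> real"
  assumes [measurable]: "f \<in> borel_measurable M" "u \<in> borel_measurable M"
    and m: "0 < m" and f: "\<And>x. x \<in> space M \<Longrightarrow> m \<le> f x \<and> f x \<le> K"
    and u: "\<And>x. x \<in> space M \<Longrightarrow> m \<le> u x \<and> u x \<le> K"
  shows "kl (\<integral>x. f x \<partial>M) (\<integral>x. u x \<partial>M) \<le> (\<integral>x. kl (f x) (u x) \<partial>M)"
proof -
  define F where "F = (\<integral>x. f x \<partial>M)"
  define V where "V = (\<integral>x. u x \<partial>M)"
  have F: "0 < F" and V: "0 < V"
    using integral_in_interval[of f m K, OF _ m f] integral_in_interval[of u m K, OF _ m u] m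
    by (auto simp: F_def V_def)
  note int = integrable_in_interval[of f m K, OF _ m f] integrable_in_interval[of u m K, OF _ m u]
  have le: "f x * ln (F / V) - u x * (F / V) + u x \<le> kl (f x) (u x)" if x: "x \<in> space M" for x
  proof -
    have fx: "0 < f x" and ux: "0 < u x" using f[OF x] u[OF x] m by auto
    have "f x - u x * (F / V) \<le> f x * ln (f x / (u x * (F / V)))"
      by (rule mult_ln_div_ge) (use fx ux F V in auto)
    also have "\<dots> = f x * ln (f x / u x) - f x * ln (F / V)"
      using fx ux F V by (simp add: ln_div ln_mult algebra_simps)
    finally show ?thesis by (simp add: kl_def)
  qed
  have "kl F V = F * ln (F / V) - V * (F / V) + V" using V by (simp add: kl_def)
  also have "\<dots> = (\<integral>x. f x * ln (F / V) - u x * (F / V) + u x \<partial>M)"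
    using int by (simp add: F_def V_def)
  also have "\<dots> \<le> (\<integral>x. kl (f x) (u x) \<partial>M)"
    using int integrable_kl[OF assms] le by (intro integral_mono) auto
  finally show ?thesis by (simp add: F_def V_def)
qed

text \<open>Half of the variational formula for entropy: the right-hand side exceeds the left by
  \<open>kl\<close> of the mean of \<open>f\<close> and \<open>c\<close>. The constant comes as a
  function \<open>u\<close> because the induction supplies one that happens to be constant in the
  coordinate at hand.\<close>

lemma (in prob_space) entropy_le_kl:
  fixes f :: "'a \<Rightarrow> real"
  assumes [measurable]: "f \<in> borel_measurable M"
    and m: "0 < m" and f: "\<And>x. x \<in> space M \<Longrightarrow> m \<le> f x \<and> f x \<le> K"
    and u: "\<And>x. x \<in> space M \<Longrightarrow> u x = c" and c: "m \<le> c" "c \<le> K"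
  shows "(\<integral>x. f x * ln (f x) \<partial>M) - (\<integral>x. f x \<partial>M) * ln (\<integral>x. f x \<partial>M) \<le> (\<integral>x. kl (f x) (u x) \<partial>M)"
proof -
  define F where "F = (\<integral>x. f x \<partial>M)"
  have F: "0 < F" using integral_in_interval[of f m K, OF _ m f] m by (auto simp: F_def)
  have c0: "0 < c" using c m by auto
  note int = integrable_in_interval[of f m K, OF _ m f] integrable_mult_ln[of f f m K, OF _ _ m f f]
  have "(\<integral>x. kl (f x) (u x) \<partial>M) = (\<integral>x. f x * ln (f x) - f x * ln c - f x + c \<partial>M)"
  proof (intro Bochner_Integration.integral_cong refl)
    fix x assume x: "x \<in> space M"
    have "0 < f x" using f[OF x] m by linarith
    thus "kl (f x) (u x) = f x * ln (f x) - f x * ln c - f x + c"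
      using u[OF x] c0 by (simp add: kl_def ln_div algebra_simps)
  qed
  also have "\<dots> = (\<integral>x. f x * ln (f x) \<partial>M) - F * ln c - F + c"
    using int by (simp add: F_def prob_space)
  finally have *: "(\<integral>x. kl (f x) (u x) \<partial>M) = (\<integral>x. f x * ln (f x) \<partial>M) - F * ln c - F + c" .
  have "F - c \<le> F * ln (F / c)" by (rule mult_ln_div_ge[OF F c0])
  also have "\<dots> = F * ln F - F * ln c" using F c0 by (simp add: ln_div algebra_simps)
  finally show ?thesis unfolding * by (simp add: F_def)
qed

section \<open>Tensorization on product spaces\<close>

lemma integrable_integral_PiM_insert:
  fixes P :: "'a measure" and g :: "('i \<Rightarrow> 'a) \<Rightarrow> real"
  assumes P: "prob_space P" and I: "finite I" "k \<notin> I"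
    and g: "integrable (PiM (insert k I) (\<lambda>_. P)) g"
  shows "integrable (PiM I (\<lambda>_. P)) (\<lambda>x. \<integral>y. g (x(k := y)) \<partial>P)"
proof -
  interpret P1: prob_space P by fact
  interpret Q: prob_space "PiM I (\<lambda>_. P)" by (rule prob_space_PiM) (rule P)
  interpret pq: pair_sigma_finite P "PiM I (\<lambda>_. P)" ..
  let ?h = "\<lambda>(y, x). x(k := y)"
  have "distr (P \<Otimes>\<^sub>M PiM I (\<lambda>_. P)) (PiM (insert k I) (\<lambda>_. P)) ?h = PiM (insert k I) (\<lambda>_. P)"
    by (rule distr_pair_PiM_eq_PiM) (rule P)+
  hence *: "integrable (distr (P \<Otimes>\<^sub>M PiM I (\<lambda>_. P)) (PiM (insert k I) (\<lambda>_. P)) ?h) g"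
    using g by simp
  have "integrable (P \<Otimes>\<^sub>M PiM I (\<lambda>_. P)) (\<lambda>p. g (?h p))"
    by (rule integrable_distr[OF _ *]) measurable
  hence "integrable (P \<Otimes>\<^sub>M PiM I (\<lambda>_. P)) (\<lambda>(y, x). g (x(k := y)))"
    by (simp add: case_prod_beta')
  from pq.integrable_snd[OF this] show ?thesis by simp
qed

text \<open>Tensorization merged with the variational formula, the reference \<open>u j\<close>
  being free of coordinate j. The chain rule splits off coordinate k; its conditional entropy is
  bounded by means of \<open>u k\<close>, and the rest by the induction hypothesis for
  \<open>f\<close> and \<open>u j\<close> averaged over coordinate k. Joint convexity of
  \<open>kl\<close> then undoes the averaging.\<close>

lemma entropy_subadditive:
  fixes P :: "'a measure" and I :: "'i set"
  assumes P: "prob_space P" and "finite I"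
    and "f \<in> borel_measurable (PiM I (\<lambda>_. P))"
    and "0 < m" and "\<And>x. x \<in> space (PiM I (\<lambda>_. P)) \<Longrightarrow> m \<le> f x \<and> f x \<le> K"
    and "\<And>j. j \<in> I \<Longrightarrow> u j \<in> borel_measurable (PiM I (\<lambda>_. P))"
    and "\<And>j x. j \<in> I \<Longrightarrow> x \<in> space (PiM I (\<lambda>_. P)) \<Longrightarrow> m \<le> u j x \<and> u j x \<le> K"
    and "\<And>j x y. j \<in> I \<Longrightarrow> x \<in> space (PiM I (\<lambda>_. P)) \<Longrightarrow> y \<in> space P \<Longrightarrow> u j (x(j := y)) = u j x"
  shows "(\<integral>x. f x * ln (f x) \<partial>PiM I (\<lambda>_. P)) - (\<integral>x. f x \<partial>PiM I (\<lambda>_. P)) * ln (\<integral>x. f x \<partial>PiM I (\<lambda>_. P))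
    \<le> (\<Sum>j\<in>I. \<integral>x. kl (f x) (u j x) \<partial>PiM I (\<lambda>_. P))"
  using assms(2-)
proof (induction I arbitrary: f u rule: finite_induct)
  case empty
  interpret product_prob_space "\<lambda>_::'i. P" using P by (intro product_prob_spaceI)
  show ?case by (simp add: PiM_empty lebesgue_integral_count_space_finite)
next
  case (insert k I)
  interpret P1: prob_space P by fact
  interpret product_prob_space "\<lambda>_::'i. P" by (intro product_prob_spaceI P)
  interpret Q: prob_space "PiM I (\<lambda>_. P)" by (rule prob_space_PiM) (rule P1.prob_space_axioms)
  interpret R: prob_space "PiM (insert k I) (\<lambda>_. P)" by (rule prob_space_PiM) (rule P1.prob_space_axioms)
  let ?Q = "PiM I (\<lambda>_. P)" and ?R = "PiM (insert k I) (\<lambda>_. P)"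
  note [measurable] = insert.prems(1)
  have uk[measurable]: "u j \<in> borel_measurable ?R" if "j \<in> insert k I" for j using insert.prems(4) that by simp
  have upd: "x(k := y) \<in> space ?R" if "x \<in> space ?Q" "y \<in> space P" for x y
    using that by (auto simp: space_PiM PiE_def extensional_def Pi_def)
  have m2[measurable]: "(\<lambda>(x, y). x(k := y)) \<in> measurable (?Q \<Otimes>\<^sub>M P) ?R" by measurable
  have m1[measurable]: "(\<lambda>y. x(k := y)) \<in> measurable P ?R" if "x \<in> space ?Q" for x
    using that by measurable
  have bar: "(\<lambda>x. \<integral>y. g (x(k := y)) \<partial>P) \<in> borel_measurable ?Q" if [measurable]: "g \<in> borel_measurable ?R" for g :: "_ \<Rightarrow> real"
  proof -
    have "(\<lambda>(x, y). g (x(k := y))) \<in> borel_measurable (?Q \<Otimes>\<^sub>M P)" by measurable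
    thus ?thesis by (rule P1.borel_measurable_lebesgue_integral)
  qed
  define f' where "f' = (\<lambda>x. \<integral>y. f (x(k := y)) \<partial>P)"
  define u' where "u' = (\<lambda>j x. \<integral>y. u j (x(k := y)) \<partial>P)"
  have f'_m[measurable]: "f' \<in> borel_measurable ?Q" unfolding f'_def by (rule bar) measurable
  have fb: "m \<le> f (x(k := y)) \<and> f (x(k := y)) \<le> K" if "x \<in> space ?Q" "y \<in> space P" for x y
    using insert.prems(3)[OF upd[OF that]] .
  have ub: "m \<le> u j (x(k := y)) \<and> u j (x(k := y)) \<le> K" if "j \<in> insert k I" "x \<in> space ?Q" "y \<in> space P" for j x y
    using insert.prems(5)[OF that(1) upd[OF that(2,3)]] .
  have f'_b: "m \<le> f' x \<and> f' x \<le> K" if "x \<in> space ?Q" for x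
    unfolding f'_def using that fb by (intro P1.integral_in_interval \<open>0 < m\<close>) auto
  have u'_m: "u' j \<in> borel_measurable ?Q" if "j \<in> I" for j
    unfolding u'_def using that by (intro bar) auto
  have u'_b: "m \<le> u' j x \<and> u' j x \<le> K" if "j \<in> I" "x \<in> space ?Q" for j x
    unfolding u'_def using that ub by (intro P1.integral_in_interval \<open>0 < m\<close>) auto
  have u'_i: "u' j (x(j := y)) = u' j x" if "j \<in> I" "x \<in> space ?Q" "y \<in> space P" for j x y
    unfolding u'_def
  proof (intro Bochner_Integration.integral_cong refl)
    fix z assume z: "z \<in> space P"
    have "j \<noteq> k" using that insert.hyps by auto
    hence *: "(x(j := y))(k := z) = (x(k := z))(j := y)" by auto
    show "u j ((x(j := y))(k := z)) = u j (x(k := z))"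
      unfolding * by (rule insert.prems(6)[OF insertI2[OF that(1)] upd[OF that(2) z] that(3)])
  qed
  have IH: "(\<integral>x. f' x * ln (f' x) \<partial>?Q) - (\<integral>x. f' x \<partial>?Q) * ln (\<integral>x. f' x \<partial>?Q)
      \<le> (\<Sum>j\<in>I. \<integral>x. kl (f' x) (u' j x) \<partial>?Q)"
    by (rule insert.IH) (fact f'_m \<open>0 < m\<close> f'_b u'_m u'_b u'_i)+
  have split: "(\<integral>x. g x \<partial>?R) = (\<integral>x. (\<integral>y. g (x(k := y)) \<partial>P) \<partial>?Q)" if "integrable ?R g" for g :: "_ \<Rightarrow> real"
    using product_integral_insert[OF insert.hyps(1,2) that] .
  note int_split = integrable_integral_PiM_insert[OF P1.prob_space_axioms insert.hyps(1,2)]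
  have ikl: "integrable ?R (\<lambda>x. kl (f x) (u j x))" if "j \<in> insert k I" for j
    using that insert.prems by (intro R.integrable_kl[where m=m and K=K]) auto
  have iln: "integrable ?R (\<lambda>x. f x * ln (f x))"
    using insert.prems by (intro R.integrable_mult_ln[where m=m and K=K]) auto
  have if': "integrable ?R f" using insert.prems by (intro R.integrable_in_interval[where m=m and K=K]) auto
  have "(\<integral>x. f x * ln (f x) \<partial>?R) - (\<integral>x. f x \<partial>?R) * ln (\<integral>x. f x \<partial>?R)
     = (\<integral>x. (\<integral>y. f (x(k := y)) * ln (f (x(k := y))) \<partial>P) \<partial>?Q) - (\<integral>x. f' x \<partial>?Q) * ln (\<integral>x. f' x \<partial>?Q)"
    using split[OF iln] split[OF if'] by (simp add: f'_def)
  also have "\<dots> \<le> (\<integral>x. (\<integral>y. f (x(k := y)) * ln (f (x(k := y))) \<partial>P) \<partial>?Q) - (\<integral>x. f' x * ln (f' x) \<partial>?Q)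
      + (\<Sum>j\<in>I. \<integral>x. kl (f' x) (u' j x) \<partial>?Q)"
    using IH by simp
  also have "\<dots> = (\<integral>x. (\<integral>y. f (x(k := y)) * ln (f (x(k := y))) \<partial>P) - f' x * ln (f' x) \<partial>?Q)
      + (\<Sum>j\<in>I. \<integral>x. kl (f' x) (u' j x) \<partial>?Q)"
    using int_split[OF iln] Q.integrable_mult_ln[OF f'_m f'_m \<open>0 < m\<close> f'_b f'_b] by simp
  also have "\<dots> \<le> (\<integral>x. (\<integral>y. kl (f (x(k := y))) (u k (x(k := y))) \<partial>P) \<partial>?Q)
      + (\<Sum>j\<in>I. \<integral>x. (\<integral>y. kl (f (x(k := y))) (u j (x(k := y))) \<partial>P) \<partial>?Q)"
  proof (intro add_mono sum_mono integral_mono)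
    show "integrable ?Q (\<lambda>x. \<integral>y. kl (f (x(k := y))) (u k (x(k := y))) \<partial>P)"
      using int_split[OF ikl[of k]] by simp
    show "integrable ?Q (\<lambda>x. (\<integral>y. f (x(k := y)) * ln (f (x(k := y))) \<partial>P) - f' x * ln (f' x))"
      using int_split[OF iln] Q.integrable_mult_ln[OF f'_m f'_m \<open>0 < m\<close> f'_b f'_b] by simp
    fix x assume x: "x \<in> space ?Q"
    obtain y0 where y0: "y0 \<in> space P" using P1.not_empty by auto
    show "(\<integral>y. f (x(k := y)) * ln (f (x(k := y))) \<partial>P) - f' x * ln (f' x)
        \<le> (\<integral>y. kl (f (x(k := y))) (u k (x(k := y))) \<partial>P)"
      unfolding f'_def
    \<comment> \<open>Every base point \<open>y0\<close> gives the same value of \<open>u k\<close>,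
      so it can serve as the constant.\<close>
    proof (rule P1.entropy_le_kl[where m=m and K=K and c="u k (x(k := y0))"])
      fix y assume "y \<in> space P"
      thus "u k (x(k := y)) = u k (x(k := y0))"
        using insert.prems(6)[OF insertI1 upd[OF x y0], of y] by (simp only: fun_upd_upd)
    qed (use x fb ub[of k x y0] y0 \<open>0 < m\<close> in auto)
  next
    fix j assume j: "j \<in> I"
    show "integrable ?Q (\<lambda>x. kl (f' x) (u' j x))"
      by (rule Q.integrable_kl[OF f'_m u'_m[OF j] \<open>0 < m\<close> f'_b u'_b[OF j]])
    show "integrable ?Q (\<lambda>x. \<integral>y. kl (f (x(k := y))) (u j (x(k := y))) \<partial>P)"
      using int_split[OF ikl[of j]] j by simp
    fix x assume x: "x \<in> space ?Q"
    show "kl (f' x) (u' j x) \<le> (\<integral>y. kl (f (x(k := y))) (u j (x(k := y))) \<partial>P)"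
      unfolding f'_def u'_def
      by (rule P1.kl_integral_le[where m=m and K=K]) (use x fb ub j \<open>0 < m\<close> in auto)
  qed
  also have "\<dots> = (\<Sum>j\<in>insert k I. \<integral>x. kl (f x) (u j x) \<partial>?R)"
    using insert.hyps split[OF ikl] by simp
  finally show ?case .
qed

section \<open>Exponential moments from entropy bounds\<close>

text \<open>Equivalent to \<open>0 \<le> (1 - t) * (exp t - (1 + t))\<close>. The left-hand side of
  the claim is \<open>kl (exp t) 1\<close>.\<close>

lemma mult_exp_minus_exp_le:
  assumes "t \<le> (1::real)"
  shows "t * exp t - exp t + 1 \<le> t\<^sup>2"
proof -
  have "0 \<le> (1 - t) * (exp t - (1 + t))"
    using assms exp_ge_add_one_self[of t] by (intro mult_nonneg_nonneg) auto
  thus ?thesis by (simp add: algebra_simps power2_eq_square)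
qed

text \<open>\<open>Y\<close> is the increment of the supremum due to one coordinate,
  \<open>h\<close> the value there of the leave-one-out maximizer. The right-hand side carries the
  weight \<open>exp (l * Y y)\<close> so that, multiplied by the leave-one-out exponential, it
  becomes an integral against \<open>exp (l * Z)\<close> and can be summed over coordinates.\<close>

lemma (in prob_space) one_step_bound:
  fixes Y h :: "'a \<Rightarrow> real"
  assumes Ym[measurable]: "Y \<in> borel_measurable M" and hm[measurable]: "h \<in> borel_measurable M"
    and b: "\<And>y. y \<in> space M \<Longrightarrow> -1 \<le> h y \<and> h y \<le> Y y \<and> Y y \<le> 1"
    and h0: "(\<integral>y. h y \<partial>M) = 0" and v: "(\<integral>y. (h y)\<^sup>2 \<partial>M) \<le> v"
    and l: "0 \<le> l" "l \<le> 1"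
  shows "(\<integral>y. l * Y y * exp (l * Y y) - exp (l * Y y) + 1 \<partial>M)
    \<le> l\<^sup>2 * (4 * (\<integral>y. Y y * exp (l * Y y) \<partial>M) + 2 * v * (\<integral>y. exp (l * Y y) \<partial>M))"
proof -
  have bY: "\<bar>Y y\<bar> \<le> 1" "\<bar>h y\<bar> \<le> 1" if "y \<in> space M" for y using b[OF that] by auto
  have lY: "\<bar>l * Y y\<bar> \<le> 1" if "y \<in> space M" for y
    using bY[OF that] l mult_mono[of "\<bar>l\<bar>" 1 "\<bar>Y y\<bar>" 1] by (simp add: abs_mult)
  have iY: "integrable M Y" and ih: "integrable M h"
    using bY by (auto intro!: integrable_bounded[where K=1])
  have ih2: "integrable M (\<lambda>y. (h y)\<^sup>2)"
    using bY by (intro integrable_bounded[where K=1]) (auto simp: abs_square_le_1)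
  have ie: "integrable M (\<lambda>y. exp (l * Y y))"
    using lY by (intro integrable_bounded[where K="exp 1"]) (auto dest: abs_le_D1)
  have iYe: "integrable M (\<lambda>y. Y y * exp (l * Y y))"
  proof (rule integrable_bounded[where K="1 * exp 1"])
    fix y assume y: "y \<in> space M"
    show "\<bar>Y y * exp (l * Y y)\<bar> \<le> 1 * exp 1"
      unfolding abs_mult using bY[OF y] lY[OF y] by (intro mult_mono) (auto dest: abs_le_D1)
  qed measurable
  have v0: "0 \<le> v" by (rule order_trans[OF Bochner_Integration.integral_nonneg v]) simp
  \<comment> \<open>The centred minorant \<open>h\<close> contributes a linear term that integrates
    to zero. The bound allows \<open>v\<close> to be multiplied by the exponential weight.\<close>
  have 1: "1 \<le> (\<integral>y. exp (l * Y y) \<partial>M)"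
  proof -
    have "(\<integral>y. 1 + l * h y \<partial>M) \<le> (\<integral>y. exp (l * Y y) \<partial>M)"
    proof (rule integral_mono)
      fix y assume y: "y \<in> space M"
      have "1 + l * h y \<le> 1 + l * Y y" using b[OF y] l by (simp add: mult_left_mono)
      also have "\<dots> \<le> exp (l * Y y)" by (rule exp_ge_add_one_self)
      finally show "1 + l * h y \<le> exp (l * Y y)" .
    qed (use ih ie in auto)
    thus ?thesis using ih h0 by (simp add: prob_space)
  qed
  \<comment> \<open>The weight is at least 1 where \<open>Y\<close> is nonnegative and at most 1
    elsewhere, so it can only raise the integral.\<close>
  have 2: "(\<integral>y. Y y \<partial>M) \<le> (\<integral>y. Y y * exp (l * Y y) \<partial>M)"
  proof (rule integral_mono[OF iY iYe])
    fix y assume y: "y \<in> space M"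
    show "Y y \<le> Y y * exp (l * Y y)"
    proof (cases "0 \<le> Y y")
      case True
      thus ?thesis using l mult_left_mono[of 1 "exp (l * Y y)" "Y y"] by simp
    next
      case False
      hence "l * Y y \<le> 0" using l by (simp add: mult_nonneg_nonpos)
      thus ?thesis using False mult_left_mono_neg[of "exp (l * Y y)" 1 "Y y"] by simp
    qed
  qed
  have "(\<integral>y. l * Y y * exp (l * Y y) - exp (l * Y y) + 1 \<partial>M)
      \<le> (\<integral>y. l\<^sup>2 * (4 * (Y y - h y) + 2 * (h y)\<^sup>2) \<partial>M)"
  proof (rule integral_mono)
    show "integrable M (\<lambda>y. l * Y y * exp (l * Y y) - exp (l * Y y) + 1)"
      using iYe ie by (simp add: mult.assoc)
    show "integrable M (\<lambda>y. l\<^sup>2 * (4 * (Y y - h y) + 2 * (h y)\<^sup>2))" using iY ih ih2 by simp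
    fix y assume y: "y \<in> space M"
    have "l * Y y * exp (l * Y y) - exp (l * Y y) + 1 \<le> (l * Y y)\<^sup>2"
      by (rule mult_exp_minus_exp_le) (use lY[OF y] in auto)
    also have "\<dots> = l\<^sup>2 * (Y y)\<^sup>2" by (simp add: power_mult_distrib)
    also have "\<dots> \<le> l\<^sup>2 * (4 * (Y y - h y) + 2 * (h y)\<^sup>2)"
    proof (rule mult_left_mono)
      \<comment> \<open>The gap \<open>d\<close> lies in [0, 2], so the square of
        \<open>d + h y\<close> is at most \<open>2 * d * d + 2 * (h y)\<^sup>2\<close>, hence linear
        in \<open>d\<close>. Linearity matters because \<open>d\<close> has the same integral as
        \<open>Y\<close>.\<close>
      define d where "d = Y y - h y"
      have d: "0 \<le> d" "d \<le> 2" using b[OF y] by (auto simp: d_def)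
      have "(Y y)\<^sup>2 + (d - h y)\<^sup>2 = 2 * (d * d) + 2 * (h y)\<^sup>2"
        by (simp add: d_def power2_eq_square algebra_simps)
      moreover have "d * d \<le> 2 * d" using d by (intro mult_right_mono) auto
      ultimately have "(Y y)\<^sup>2 \<le> 4 * d + 2 * (h y)\<^sup>2" using zero_le_power2[of "d - h y"] by linarith
      thus "(Y y)\<^sup>2 \<le> 4 * (Y y - h y) + 2 * (h y)\<^sup>2" by (simp add: d_def)
    qed simp
    finally show "l * Y y * exp (l * Y y) - exp (l * Y y) + 1 \<le> l\<^sup>2 * (4 * (Y y - h y) + 2 * (h y)\<^sup>2)" .
  qed
  also have "\<dots> = l\<^sup>2 * (4 * (\<integral>y. Y y \<partial>M) + 2 * (\<integral>y. (h y)\<^sup>2 \<partial>M))"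
    using iY ih ih2 h0 by simp
  also have "\<dots> \<le> l\<^sup>2 * (4 * (\<integral>y. Y y * exp (l * Y y) \<partial>M) + 2 * v * (\<integral>y. exp (l * Y y) \<partial>M))"
  proof -
    have "v \<le> v * (\<integral>y. exp (l * Y y) \<partial>M)" using 1 v0 mult_left_mono[of 1 _ v] by simp
    hence "2 * (\<integral>y. (h y)\<^sup>2 \<partial>M) \<le> 2 * v * (\<integral>y. exp (l * Y y) \<partial>M)" using v by simp
    thus ?thesis using 2 by (intro mult_left_mono add_mono) auto
  qed
  finally show ?thesis .
qed

section \<open>Differentiation under the integral and Herbst's argument\<close>

lemma abs_exp_minus_affine_le:
  assumes "t \<le> (1/2::real)"
  shows "\<bar>exp t - 1 - t\<bar> \<le> 2 * t\<^sup>2"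
proof -
  have "exp t * (1 - t) \<le> exp t * exp (- t)"
    using exp_ge_add_one_self[of "- t"] by (intro mult_left_mono) auto
  also have "\<dots> = 1" by (simp add: exp_minus)
  also have "1 \<le> 1 + t\<^sup>2 * (1 - 2 * t)" using assms by simp
  also have "\<dots> = (1 + t + 2 * t\<^sup>2) * (1 - t)" by (simp add: algebra_simps power2_eq_square)
  finally have "exp t \<le> 1 + t + 2 * t\<^sup>2" using assms by (simp add: mult_le_cancel_right)
  moreover have "1 + t \<le> exp t" by (rule exp_ge_add_one_self)
  moreover have "0 \<le> t\<^sup>2" by simp
  ultimately show ?thesis unfolding abs_le_iff by linarith
qed

text \<open>Boundedness of \<open>Z\<close> makes the remainder quadratic in \<open>s - l\<close>,
  uniformly over the space, so the difference quotient is within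
  \<open>C * \<bar>s - l\<bar>\<close> of the derivative and no limit is taken under the
  integral.\<close>

lemma (in prob_space) DERIV_mgf:
  fixes Z :: "'a \<Rightarrow> real"
  assumes [measurable]: "Z \<in> borel_measurable M" and Z: "\<And>x. x \<in> space M \<Longrightarrow> \<bar>Z x\<bar> \<le> K"
  shows "DERIV (\<lambda>l. \<integral>x. exp (l * Z x) \<partial>M) l :> (\<integral>x. Z x * exp (l * Z x) \<partial>M)"
proof -
  obtain x0 where "x0 \<in> space M" using not_empty by auto
  hence K: "0 \<le> K" using Z[of x0] by auto
  have lZ: "\<bar>s * Z x\<bar> \<le> \<bar>s\<bar> * K" if "x \<in> space M" for x s
    using Z[OF that] by (simp add: abs_mult mult_left_mono)
  have ie: "integrable M (\<lambda>x. exp (s * Z x))" for s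
    using lZ[of _ s] by (intro integrable_bounded[where K="exp (\<bar>s\<bar> * K)"]) (auto dest: abs_le_D1)
  have iZe: "integrable M (\<lambda>x. Z x * exp (s * Z x))" for s
  proof (rule integrable_bounded[where K="K * exp (\<bar>s\<bar> * K)"])
    fix x assume x: "x \<in> space M"
    show "\<bar>Z x * exp (s * Z x)\<bar> \<le> K * exp (\<bar>s\<bar> * K)"
      unfolding abs_mult using Z[OF x] lZ[OF x, of s] K by (intro mult_mono) (auto dest: abs_le_D1)
  qed measurable
  define F where "F = (\<lambda>l. \<integral>x. exp (l * Z x) \<partial>M)"
  define D where "D = (\<integral>x. Z x * exp (l * Z x) \<partial>M)"
  define C where "C = 2 * K\<^sup>2 * exp (\<bar>l\<bar> * K)"
  have main: "\<bar>F s - F l - (s - l) * D\<bar> \<le> C * (s - l)\<^sup>2" if s: "\<bar>s - l\<bar> * K \<le> 1/2" for s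
  proof -
    have "\<bar>F s - F l - (s - l) * D\<bar> = \<bar>\<integral>x. exp (s * Z x) - exp (l * Z x) - (s - l) * (Z x * exp (l * Z x)) \<partial>M\<bar>"
      using ie iZe by (simp add: F_def D_def)
    also have "\<dots> \<le> (\<integral>x. \<bar>exp (s * Z x) - exp (l * Z x) - (s - l) * (Z x * exp (l * Z x))\<bar> \<partial>M)"
      by (rule integral_abs_bound)
    also have "\<dots> \<le> (\<integral>x. C * (s - l)\<^sup>2 \<partial>M)"
    proof (rule integral_mono)
      fix x assume x: "x \<in> space M"
      define t where "t = (s - l) * Z x"
      have t: "\<bar>t\<bar> \<le> 1/2" using lZ[OF x, of "s - l"] s by (simp add: t_def)
      have "(Z x)\<^sup>2 \<le> K\<^sup>2" using Z[OF x] by (rule power2_le_iff_abs_le[OF K, THEN iffD2])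
      hence t2: "t\<^sup>2 \<le> (s - l)\<^sup>2 * K\<^sup>2" by (simp add: t_def power_mult_distrib mult_left_mono)
      have "exp (s * Z x) - exp (l * Z x) - (s - l) * (Z x * exp (l * Z x)) = exp (l * Z x) * (exp t - 1 - t)"
        by (simp add: t_def algebra_simps flip: exp_add)
      hence "\<bar>exp (s * Z x) - exp (l * Z x) - (s - l) * (Z x * exp (l * Z x))\<bar> = exp (l * Z x) * \<bar>exp t - 1 - t\<bar>"
        by (simp add: abs_mult)
      also have "\<dots> \<le> exp (\<bar>l\<bar> * K) * (2 * t\<^sup>2)"
        using lZ[OF x, of l] abs_exp_minus_affine_le[of t] t by (intro mult_mono) (auto dest: abs_le_D1)
      also have "\<dots> \<le> exp (\<bar>l\<bar> * K) * (2 * ((s - l)\<^sup>2 * K\<^sup>2))" using t2 by simp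
      also have "\<dots> = C * (s - l)\<^sup>2" by (simp add: C_def)
      finally show "\<bar>exp (s * Z x) - exp (l * Z x) - (s - l) * (Z x * exp (l * Z x))\<bar> \<le> C * (s - l)\<^sup>2" .
    qed (use ie iZe in auto)
    finally show ?thesis by (simp add: prob_space)
  qed
  have "(\<lambda>s. (F s - F l) / (s - l)) \<midarrow>l\<rightarrow> D"
  proof (rule LIM_zero_cancel, rule Lim_null_comparison)
    show "(\<lambda>s. C * \<bar>s - l\<bar>) \<midarrow>l\<rightarrow> 0" by (auto intro!: tendsto_eq_intros)
    have "((\<lambda>s. \<bar>s - l\<bar> * K) \<longlongrightarrow> 0) (at l)" by (auto intro!: tendsto_eq_intros)
    hence "\<forall>\<^sub>F s in at l. \<bar>s - l\<bar> * K < 1/2" by (rule order_tendstoD) simp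
    moreover have "\<forall>\<^sub>F s in at l. s \<noteq> l" by (simp add: eventually_at_filter)
    ultimately show "\<forall>\<^sub>F s in at l. norm ((F s - F l) / (s - l) - D) \<le> C * \<bar>s - l\<bar>"
    proof eventually_elim
      case (elim s)
      have "(F s - F l) / (s - l) - D = (F s - F l - (s - l) * D) / (s - l)"
        using elim by (simp add: field_simps)
      hence "\<bar>(F s - F l) / (s - l) - D\<bar> = \<bar>F s - F l - (s - l) * D\<bar> / \<bar>s - l\<bar>" by (simp add: abs_divide)
      also have "\<dots> \<le> C * (s - l)\<^sup>2 / \<bar>s - l\<bar>" using main[of s] elim by (intro divide_right_mono) auto
      also have "\<dots> = C * \<bar>s - l\<bar>" 
      proof -
        define a where "a = \<bar>s - l\<bar>"
        have "(s - l)\<^sup>2 = a * a" by (simp add: power2_eq_square a_def)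
        moreover have "a \<noteq> 0" using elim by (simp add: a_def)
        ultimately show ?thesis by (simp flip: a_def)
      qed
      finally show ?case by simp
    qed
  qed
  thus ?thesis by (simp add: DERIV_def F_def D_def has_field_derivative_iff)
qed

text \<open>Herbst's argument: the hypothesis bounds the derivative of \<open>ln (E exp (l * Z)) / l\<close>.\<close>

lemma (in prob_space) mgf_from_entropy:
  fixes Z :: "'a \<Rightarrow> real"
  assumes Zm[measurable]: "Z \<in> borel_measurable M" and Z: "\<And>x. x \<in> space M \<Longrightarrow> \<bar>Z x\<bar> \<le> K"
    and ent: "\<And>l. 0 < l \<Longrightarrow> l \<le> 1 \<Longrightarrow>
      l * (\<integral>x. Z x * exp (l * Z x) \<partial>M) - (\<integral>x. exp (l * Z x) \<partial>M) * ln (\<integral>x. exp (l * Z x) \<partial>M)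
      \<le> l\<^sup>2 * (4 * (\<integral>x. Z x * exp (l * Z x) \<partial>M) + A * (\<integral>x. exp (l * Z x) \<partial>M))"
  shows "(\<integral>x. exp (Z x / 8) \<partial>M) \<le> exp ((\<integral>x. Z x \<partial>M) / 4 + A / 32)"
proof -
  define F where "F = (\<lambda>l. \<integral>x. exp (l * Z x) \<partial>M)"
  define D where "D = (\<lambda>l. \<integral>x. Z x * exp (l * Z x) \<partial>M)"
  define L where "L = (\<lambda>l. ln (F l))"
  \<comment> \<open>The entropy hypothesis divided by \<open>l\<^sup>2 * F l\<close> says that this
    function is nonincreasing: \<open>4 * L l\<close> and \<open>A * l\<close> are antiderivatives
    of the two terms on its right-hand side.\<close>
  define \<Phi> where "\<Phi> = (\<lambda>l. L l / l - 4 * L l - A * l)"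
  have F': "DERIV F l :> D l" for l unfolding F_def D_def by (rule DERIV_mgf[OF Zm Z])
  have Fpos: "0 < F l" for l
  proof -
    have "exp (- (\<bar>l\<bar> * K)) \<le> exp (l * Z x) \<and> exp (l * Z x) \<le> exp (\<bar>l\<bar> * K)" if "x \<in> space M" for x
    proof -
      have "\<bar>l * Z x\<bar> \<le> \<bar>l\<bar> * K" using Z[OF that] by (simp add: abs_mult mult_left_mono)
      thus ?thesis by auto
    qed
    from integral_in_interval[OF _ _ this] have "exp (- (\<bar>l\<bar> * K)) \<le> F l" by (simp add: F_def)
    thus ?thesis using exp_gt_zero order.strict_trans2 by blast
  qed
  have L': "DERIV L l :> D l / F l" for l
    unfolding L_def by (rule derivative_eq_intros F' Fpos refl)+ (simp add: divide_inverse)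
  have L0: "L 0 = 0" "D 0 / F 0 = (\<integral>x. Z x \<partial>M)" by (simp_all add: L_def F_def D_def prob_space)
  have \<Phi>': "DERIV \<Phi> l :> (D l / F l * l - L l) / l\<^sup>2 - 4 * (D l / F l) - A" if "0 < l" for l
    unfolding \<Phi>_def using that
    by (auto intro!: derivative_eq_intros L' simp: power2_eq_square)
  have \<Phi>'_neg: "(D l / F l * l - L l) / l\<^sup>2 - 4 * (D l / F l) - A \<le> 0" if "0 < l" "l \<le> 1" for l
  proof -
    have "l * D l - F l * L l \<le> l\<^sup>2 * (4 * D l + A * F l)"
      using ent[OF that] by (simp add: D_def F_def L_def)
    hence "(l * D l - F l * L l) / F l \<le> l\<^sup>2 * (4 * D l + A * F l) / F l"
      using Fpos[of l] by (intro divide_right_mono) auto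
    moreover have "(l * D l - F l * L l) / F l = D l / F l * l - L l"
      using Fpos[of l] by (simp add: field_simps)
    moreover have "l\<^sup>2 * (4 * D l + A * F l) / F l = l\<^sup>2 * (4 * (D l / F l) + A)"
      using Fpos[of l] by (simp add: field_simps)
    ultimately have "D l / F l * l - L l \<le> (4 * (D l / F l) + A) * l\<^sup>2" by (simp add: mult.commute)
    hence "(D l / F l * l - L l) / l\<^sup>2 \<le> 4 * (D l / F l) + A" using that by (simp add: pos_divide_le_eq)
    thus ?thesis by simp
  qed
  \<comment> \<open>At \<open>l = 1/8\<close> the factor \<open>1 / l - 4\<close> in front of
    \<open>L\<close> is 4, so the mean enters with weight 1/4. Scaled back by 8, this is the factor
    2 lost in front of the expectation.\<close>
  have mono: "\<Phi> (1/8) \<le> \<Phi> s" if "0 < s" "s \<le> 1/8" for s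
  proof (rule DERIV_nonpos_imp_nonincreasing[OF that(2)])
    fix l assume "s \<le> l" "l \<le> 1/8"
    hence "0 < l" "l \<le> 1" using that by auto
    thus "\<exists>y. DERIV \<Phi> l :> y \<and> y \<le> 0" using \<Phi>' \<Phi>'_neg by blast
  qed
  have "((\<lambda>l. L l / l) \<longlongrightarrow> (\<integral>x. Z x \<partial>M)) (at 0)"
    using L'[of 0] L0 by (simp add: has_field_derivative_iff)
  moreover have "(L \<longlongrightarrow> 0) (at 0)" using DERIV_isCont[OF L'[of 0]] L0 by (simp add: isCont_def)
  ultimately have "(\<Phi> \<longlongrightarrow> (\<integral>x. Z x \<partial>M) - 4 * 0 - A * 0) (at 0)"
    unfolding \<Phi>_def by (intro tendsto_intros)
  hence lim: "(\<Phi> \<longlongrightarrow> (\<integral>x. Z x \<partial>M)) (at_right 0)" by (auto intro: tendsto_mono at_le)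
  have "\<forall>\<^sub>F s in at_right 0. s < (1/8::real)" by (rule eventually_at_right_less[of 0, THEN eventually_mono] eventually_at_rightI[of 0 "1/8"]) auto
  hence "\<forall>\<^sub>F s in at_right 0. \<Phi> (1/8) \<le> \<Phi> s"
    using eventually_at_right_less[of "0::real"] by eventually_elim (use mono in auto)
  hence "\<Phi> (1/8) \<le> (\<integral>x. Z x \<partial>M)" by (intro tendsto_lowerbound[OF lim]) auto
  hence "L (1/8) \<le> (\<integral>x. Z x \<partial>M) / 4 + A / 32" by (simp add: \<Phi>_def)
  hence "exp (L (1/8)) \<le> exp ((\<integral>x. Z x \<partial>M) / 4 + A / 32)" by simp
  moreover have "exp (L (1/8)) = (\<integral>x. exp (Z x / 8) \<partial>M)" using Fpos[of "1/8"] by (simp add: L_def F_def)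
  ultimately show ?thesis by simp
qed

section \<open>Suprema of empirical processes over finite classes\<close>

lemma emp_sum_measurable [measurable]:
  assumes "finite I" "J \<subseteq> I" and [measurable]: "h \<in> borel_measurable P"
  shows "(\<lambda>x. \<Sum>i\<in>J. h (x i) :: real) \<in> borel_measurable (PiM I (\<lambda>_. P))"
proof (rule borel_measurable_sum)
  fix i assume "i \<in> J"
  hence [measurable]: "(\<lambda>x. x i) \<in> measurable (PiM I (\<lambda>_. P)) P" using assms by (intro measurable_component_singleton) auto
  show "(\<lambda>x. h (x i)) \<in> borel_measurable (PiM I (\<lambda>_. P))" by measurable
qed

text \<open>One-sided: absolute values are recovered later by putting the negatives into the class.
  The index set \<open>J\<close> is separate in order to allow leave-one-out sums.\<close>

definition sup_sum :: "('a \<Rightarrow> real) set \<Rightarrow> 'i set \<Rightarrow> ('i \<Rightarrow> 'a) \<Rightarrow> real" where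
  "sup_sum H J x = (MAX h\<in>H. \<Sum>i\<in>J. h (x i))"

lemma sup_sum_measurable:
  assumes "finite I" "J \<subseteq> I" "finite H" "H \<noteq> {}" "\<And>h. h \<in> H \<Longrightarrow> h \<in> borel_measurable P"
  shows "sup_sum H J \<in> borel_measurable (PiM I (\<lambda>_. P))"
  unfolding sup_sum_def using assms by (intro borel_measurable_Max emp_sum_measurable) auto

lemma sup_sum_ge: "finite H \<Longrightarrow> h \<in> H \<Longrightarrow> (\<Sum>i\<in>J. h (x i)) \<le> sup_sum H J x"
  unfolding sup_sum_def by (intro Max_ge) auto

lemma sup_sum_attained:
  assumes "finite H" "H \<noteq> {}"
  obtains h where "h \<in> H" "sup_sum H J x = (\<Sum>i\<in>J. h (x i))"
proof -
  have "sup_sum H J x \<in> (\<lambda>h. \<Sum>i\<in>J. h (x i)) ` H"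
    unfolding sup_sum_def using assms by (intro Max_in) auto
  thus ?thesis using that by auto
qed

lemma sup_sum_bound:
  assumes "finite H" "H \<noteq> {}" "\<And>h i. h \<in> H \<Longrightarrow> i \<in> J \<Longrightarrow> \<bar>h (x i)\<bar> \<le> c"
  shows "\<bar>sup_sum H J x\<bar> \<le> real (card J) * c"
proof -
  obtain h where h: "h \<in> H" "sup_sum H J x = (\<Sum>i\<in>J. h (x i))" using sup_sum_attained[OF assms(1,2)] .
  have "\<bar>\<Sum>i\<in>J. h (x i)\<bar> \<le> (\<Sum>i\<in>J. \<bar>h (x i)\<bar>)" by (rule sum_abs)
  also have "\<dots> \<le> real (card J) * c" using assms(3)[OF h(1)] by (intro sum_bounded_above) auto
  finally show ?thesis using h by simp
qed

text \<open>A maximizer of the full sum stays admissible when a coordinate is left out, so each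
  increment is at most its value at that coordinate, and these values add up to the supremum. This
  self-bounding property closes the entropy estimate.\<close>

lemma sup_sum_leave_one_out:
  assumes H: "finite H" "H \<noteq> {}" and "finite I"
  shows "(\<Sum>k\<in>I. sup_sum H I x - sup_sum H (I - {k}) x) \<le> sup_sum H I x"
proof -
  obtain h where h: "h \<in> H" "sup_sum H I x = (\<Sum>i\<in>I. h (x i))" using sup_sum_attained[OF H] .
  have "(\<Sum>k\<in>I. sup_sum H I x - sup_sum H (I - {k}) x) \<le> (\<Sum>k\<in>I. h (x k))"
  proof (rule sum_mono)
    fix k assume k: "k \<in> I"
    have "(\<Sum>i\<in>I. h (x i)) = h (x k) + (\<Sum>i\<in>I - {k}. h (x i))" using k \<open>finite I\<close> by (simp add: sum.remove)
    thus "sup_sum H I x - sup_sum H (I - {k}) x \<le> h (x k)"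
      using sup_sum_ge[OF H(1) h(1), of x "I - {k}"] h by simp
  qed
  thus ?thesis using h by simp
qed

text \<open>With the other coordinates frozen at \<open>x\<close>, both exponentials share the
  factor \<open>exp (l * z)\<close>; taking it out leaves the situation of
  \<open>one_step_bound\<close>.\<close>

lemma one_coordinate_entropy:
  fixes P :: "'a measure" and H :: "('a \<Rightarrow> real) set" and I :: "'i set"
  assumes P: "prob_space P" and I: "finite I" "k \<in> I" and H: "finite H" "H \<noteq> {}"
    and Hm: "\<And>h. h \<in> H \<Longrightarrow> h \<in> borel_measurable P"
    and Hb: "\<And>h y. h \<in> H \<Longrightarrow> y \<in> space P \<Longrightarrow> \<bar>h y\<bar> \<le> 1"
    and H0: "\<And>h. h \<in> H \<Longrightarrow> (\<integral>y. h y \<partial>P) = 0"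
    and Hv: "\<And>h. h \<in> H \<Longrightarrow> (\<integral>y. (h y)\<^sup>2 \<partial>P) \<le> v"
    and l: "0 \<le> l" "l \<le> 1" and x: "x \<in> space (PiM (I - {k}) (\<lambda>_. P))"
  shows "(\<integral>y. kl (exp (l * sup_sum H I (x(k := y)))) (exp (l * sup_sum H (I - {k}) (x(k := y)))) \<partial>P)
    \<le> (\<integral>y. l\<^sup>2 * (4 * ((sup_sum H I (x(k := y)) - sup_sum H (I - {k}) (x(k := y))) * exp (l * sup_sum H I (x(k := y))))
         + 2 * v * exp (l * sup_sum H I (x(k := y)))) \<partial>P)"
proof -
  interpret prob_space P by fact
  define z where "z = sup_sum H (I - {k}) x"
  have zk: "sup_sum H (I - {k}) (x(k := y)) = z" for y
    unfolding sup_sum_def z_def by (intro arg_cong[where f=Max] image_cong refl sum.cong) auto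
  define Y where "Y = (\<lambda>y. sup_sum H I (x(k := y)) - z)"
  have Z: "sup_sum H I (x(k := y)) = z + Y y" for y by (simp add: Y_def)
  have sum_split: "(\<Sum>i\<in>I. h ((x(k := y)) i)) = h y + (\<Sum>i\<in>I - {k}. h (x i))" for h :: "'a \<Rightarrow> real" and y
    using I by (simp add: sum.remove[of I k])
  have Ym[measurable]: "Y \<in> borel_measurable P"
  proof -
    have "(\<lambda>y. x(k := y)) \<in> measurable P (PiM I (\<lambda>_. P))"
      using x I by (intro measurable_fun_upd[where J="I - {k}"]) auto
    from measurable_compose[OF this sup_sum_measurable[OF I(1) order_refl H Hm]]
    show ?thesis by (simp add: Y_def)
  qed
  obtain h where h: "h \<in> H" "z = (\<Sum>i\<in>I - {k}. h (x i))"
    unfolding z_def using sup_sum_attained[OF H] .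
  have hm[measurable]: "h \<in> borel_measurable P" by (rule Hm[OF h(1)])
  have b: "-1 \<le> h y \<and> h y \<le> Y y \<and> Y y \<le> 1" if y: "y \<in> space P" for y
  proof (intro conjI)
    show "-1 \<le> h y" using Hb[OF h(1) y] by auto
    have "(\<Sum>i\<in>I. h ((x(k := y)) i)) \<le> sup_sum H I (x(k := y))" by (rule sup_sum_ge[OF H(1) h(1)])
    thus "h y \<le> Y y" unfolding sum_split using h(2) by (simp add: Y_def)
    \<comment> \<open>The upper bound on the increment uses the maximizer of the full sum, which
      varies with \<open>y\<close>; only its size enters.\<close>
    obtain g where g: "g \<in> H" "sup_sum H I (x(k := y)) = (\<Sum>i\<in>I. g ((x(k := y)) i))"
      using sup_sum_attained[OF H] .
    have "(\<Sum>i\<in>I - {k}. g (x i)) \<le> z" unfolding z_def by (rule sup_sum_ge[OF H(1) g(1)])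
    thus "Y y \<le> 1" using g(2) Hb[OF g(1) y] unfolding sum_split by (simp add: Y_def)
  qed
  have bY: "\<bar>Y y\<bar> \<le> 1" if "y \<in> space P" for y using b[OF that] by auto
  have lY: "\<bar>l * Y y\<bar> \<le> 1" if "y \<in> space P" for y
    using bY[OF that] l mult_mono[of "\<bar>l\<bar>" 1 "\<bar>Y y\<bar>" 1] by (simp add: abs_mult)
  have ie: "integrable P (\<lambda>y. exp (l * Y y))"
    using lY by (intro integrable_bounded[where K="exp 1"]) (auto dest: abs_le_D1)
  have iYe: "integrable P (\<lambda>y. Y y * exp (l * Y y))"
  proof (rule integrable_bounded[where K="1 * exp 1"])
    fix y assume y: "y \<in> space P"
    show "\<bar>Y y * exp (l * Y y)\<bar> \<le> 1 * exp 1"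
      unfolding abs_mult using bY[OF y] lY[OF y] by (intro mult_mono) (auto dest: abs_le_D1)
  qed measurable
  have "(\<integral>y. kl (exp (l * sup_sum H I (x(k := y)))) (exp (l * sup_sum H (I - {k}) (x(k := y)))) \<partial>P)
    = (\<integral>y. exp (l * z) * (l * Y y * exp (l * Y y) - exp (l * Y y) + 1) \<partial>P)"
  proof (intro Bochner_Integration.integral_cong refl)
    fix y
    have "exp (l * (z + Y y)) / exp (l * z) = exp (l * Y y)"
      by (simp add: algebra_simps flip: exp_diff)
    thus "kl (exp (l * sup_sum H I (x(k := y)))) (exp (l * sup_sum H (I - {k}) (x(k := y))))
      = exp (l * z) * (l * Y y * exp (l * Y y) - exp (l * Y y) + 1)"
      unfolding zk Z kl_def by (simp add: algebra_simps exp_add)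
  qed
  also have "\<dots> = exp (l * z) * (\<integral>y. l * Y y * exp (l * Y y) - exp (l * Y y) + 1 \<partial>P)" by simp
  also have "\<dots> \<le> exp (l * z) * (l\<^sup>2 * (4 * (\<integral>y. Y y * exp (l * Y y) \<partial>P) + 2 * v * (\<integral>y. exp (l * Y y) \<partial>P)))"
    by (intro mult_left_mono one_step_bound[OF Ym hm b H0 Hv] h l) auto
  also have "\<dots> = (\<integral>y. exp (l * z) * (l\<^sup>2 * (4 * (Y y * exp (l * Y y)) + 2 * v * exp (l * Y y))) \<partial>P)"
    using ie iYe by simp
  also have "\<dots> = (\<integral>y. l\<^sup>2 * (4 * ((sup_sum H I (x(k := y)) - sup_sum H (I - {k}) (x(k := y))) * exp (l * sup_sum H I (x(k := y))))
         + 2 * v * exp (l * sup_sum H I (x(k := y)))) \<partial>P)"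
    unfolding zk Z by (simp add: algebra_simps exp_add)
  finally show ?thesis .
qed

text \<open>Subadditivity with the leave-one-out suprema as references verifies the hypothesis of
  Herbst's argument with \<open>A = 2 * card I * v\<close>.\<close>

lemma mgf_sup_sum:
  fixes P :: "'a measure" and H :: "('a \<Rightarrow> real) set" and I :: "'i set"
  assumes P: "prob_space P" and I: "finite I" and H: "finite H" "H \<noteq> {}"
    and Hm: "\<And>h. h \<in> H \<Longrightarrow> h \<in> borel_measurable P"
    and Hb: "\<And>h y. h \<in> H \<Longrightarrow> y \<in> space P \<Longrightarrow> \<bar>h y\<bar> \<le> 1"
    and H0: "\<And>h. h \<in> H \<Longrightarrow> (\<integral>y. h y \<partial>P) = 0"
    and Hv: "\<And>h. h \<in> H \<Longrightarrow> (\<integral>y. (h y)\<^sup>2 \<partial>P) \<le> v"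
  shows "(\<integral>x. exp (sup_sum H I x / 8) \<partial>PiM I (\<lambda>_. P))
    \<le> exp ((\<integral>x. sup_sum H I x \<partial>PiM I (\<lambda>_. P)) / 4 + 2 * real (card I) * v / 32)"
proof -
  let ?R = "PiM I (\<lambda>_. P)"
  interpret R: prob_space ?R by (rule prob_space_PiM) (rule P)
  interpret pp: product_prob_space "\<lambda>_::'i. P" using P by (intro product_prob_spaceI)
  define Z where "Z = sup_sum H I"
  define Zk where "Zk = (\<lambda>k. sup_sum H (I - {k}))"
  have Zm[measurable]: "Z \<in> borel_measurable ?R" unfolding Z_def by (rule sup_sum_measurable[OF I order_refl H Hm])
  have Zkm[measurable]: "Zk k \<in> borel_measurable ?R" for k
    unfolding Zk_def by (rule sup_sum_measurable[OF I _ H Hm]) auto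
  define K where "K = real (card I)"
  have comp: "x i \<in> space P" if "x \<in> space ?R" "i \<in> I" for x i using that by (auto simp: space_PiM)
  have Zb: "\<bar>Z x\<bar> \<le> K" if "x \<in> space ?R" for x
    unfolding Z_def K_def using sup_sum_bound[OF H, of I x 1] Hb comp[OF that] by simp
  have Zkb: "\<bar>Zk k x\<bar> \<le> K" if "x \<in> space ?R" for x k
  proof -
    have "\<bar>Zk k x\<bar> \<le> real (card (I - {k}))"
      unfolding Zk_def using sup_sum_bound[OF H, of "I - {k}" x 1] Hb comp[OF that] by simp
    also have "\<dots> \<le> K" unfolding K_def using card_Diff1_le by simp
    finally show ?thesis .
  qed
  show ?thesis
    unfolding Z_def[symmetric]
  proof (rule R.mgf_from_entropy[OF Zm Zb])
    fix l :: real assume l: "0 < l" "l \<le> 1"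
    have bnd: "exp (- (l * K)) \<le> exp (l * w) \<and> exp (l * w) \<le> exp (l * K)" if "\<bar>w\<bar> \<le> K" for w
    proof -
      have "\<bar>l * w\<bar> \<le> l * K" using that l by (simp add: abs_mult mult_left_mono)
      thus ?thesis by auto
    qed
    have ie: "integrable ?R (\<lambda>x. exp (l * Z x))"
      using bnd[OF Zb] by (intro R.integrable_in_interval[where m="exp (- (l * K))" and K="exp (l * K)"]) auto
    have iwe: "integrable ?R (\<lambda>x. w x * exp (l * Z x))"
      if [measurable]: "w \<in> borel_measurable ?R" and w: "\<And>x. x \<in> space ?R \<Longrightarrow> \<bar>w x\<bar> \<le> 2 * K" for w
    proof (rule R.integrable_bounded[where K="2 * K * exp (l * K)"])
      fix x assume x: "x \<in> space ?R"
      show "\<bar>w x * exp (l * Z x)\<bar> \<le> 2 * K * exp (l * K)"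
        unfolding abs_mult using w[OF x] bnd[OF Zb[OF x]] by (intro mult_mono) (auto simp: K_def)
    qed measurable
    have iZ: "integrable ?R (\<lambda>x. Z x * exp (l * Z x))"
      by (rule iwe) (use Zb in \<open>fastforce simp: K_def\<close>)+
    have iZk: "integrable ?R (\<lambda>x. (Z x - Zk k x) * exp (l * Z x))" for k
    proof (rule iwe)
      fix x assume "x \<in> space ?R"
      thus "\<bar>Z x - Zk k x\<bar> \<le> 2 * K" using Zb[of x] Zkb[of x k] by linarith
    qed measurable
    have "l * (\<integral>x. Z x * exp (l * Z x) \<partial>?R) - (\<integral>x. exp (l * Z x) \<partial>?R) * ln (\<integral>x. exp (l * Z x) \<partial>?R)
      = (\<integral>x. exp (l * Z x) * ln (exp (l * Z x)) \<partial>?R) - (\<integral>x. exp (l * Z x) \<partial>?R) * ln (\<integral>x. exp (l * Z x) \<partial>?R)"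
      by (simp add: ac_simps flip: Bochner_Integration.integral_mult_right_zero)
    also have "\<dots> \<le> (\<Sum>k\<in>I. \<integral>x. kl (exp (l * Z x)) (exp (l * Zk k x)) \<partial>?R)"
    proof (rule entropy_subadditive[OF P I, where m="exp (- (l * K))" and K="exp (l * K)"])
      fix k x y
      have "Zk k (x(k := y)) = Zk k x"
        unfolding sup_sum_def Zk_def by (intro arg_cong[where f=Max] image_cong refl sum.cong) auto
      thus "exp (l * Zk k (x(k := y))) = exp (l * Zk k x)" by simp
    qed (use bnd Zb Zkb in auto)
    also have "\<dots> \<le> (\<Sum>k\<in>I. \<integral>x. l\<^sup>2 * (4 * ((Z x - Zk k x) * exp (l * Z x)) + 2 * v * exp (l * Z x)) \<partial>?R)"
    proof (rule sum_mono)
      fix k assume k: "k \<in> I"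
      let ?Q = "PiM (I - {k}) (\<lambda>_. P)"
      have I': "insert k (I - {k}) = I" using k by auto
      have fin: "finite (I - {k})" "k \<notin> I - {k}" using I by auto
      have i1: "integrable ?R (\<lambda>x. kl (exp (l * Z x)) (exp (l * Zk k x)))"
        by (rule R.integrable_kl[where m="exp (- (l * K))" and K="exp (l * K)"]) (use bnd Zb Zkb in auto)
      have i2: "integrable ?R (\<lambda>x. l\<^sup>2 * (4 * ((Z x - Zk k x) * exp (l * Z x)) + 2 * v * exp (l * Z x)))"
        using iZk[of k] ie by simp
      note split = pp.product_integral_insert[OF fin, unfolded I']
        integrable_integral_PiM_insert[OF P fin, unfolded I']
      show "(\<integral>x. kl (exp (l * Z x)) (exp (l * Zk k x)) \<partial>?R)
        \<le> (\<integral>x. l\<^sup>2 * (4 * ((Z x - Zk k x) * exp (l * Z x)) + 2 * v * exp (l * Z x)) \<partial>?R)"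
        unfolding split(1)[OF i1] split(1)[OF i2]
      proof (rule integral_mono[OF split(2)[OF i1] split(2)[OF i2]])
        fix x assume x: "x \<in> space ?Q"
        show "(\<integral>y. kl (exp (l * Z (x(k := y)))) (exp (l * Zk k (x(k := y)))) \<partial>P)
          \<le> (\<integral>y. l\<^sup>2 * (4 * ((Z (x(k := y)) - Zk k (x(k := y))) * exp (l * Z (x(k := y)))) + 2 * v * exp (l * Z (x(k := y)))) \<partial>P)"
          unfolding Z_def Zk_def
          by (rule one_coordinate_entropy[OF P I k H]) (use Hm Hb H0 Hv l x in auto)
      qed
    qed
    also have "\<dots> = (\<Sum>k\<in>I. l\<^sup>2 * (4 * (\<integral>x. (Z x - Zk k x) * exp (l * Z x) \<partial>?R) + 2 * v * (\<integral>x. exp (l * Z x) \<partial>?R)))"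
      using iZk ie by simp
    also have "\<dots> = l\<^sup>2 * (4 * (\<Sum>k\<in>I. \<integral>x. (Z x - Zk k x) * exp (l * Z x) \<partial>?R) + 2 * K * v * (\<integral>x. exp (l * Z x) \<partial>?R))"
      by (simp add: sum.distrib K_def algebra_simps flip: sum_distrib_left)
    also have "\<dots> \<le> l\<^sup>2 * (4 * (\<integral>x. Z x * exp (l * Z x) \<partial>?R) + 2 * K * v * (\<integral>x. exp (l * Z x) \<partial>?R))"
    proof -
      \<comment> \<open>The weight \<open>exp (l * Z x)\<close> is positive and the same for all k,
        so the self-bounding property applies inside the integral.\<close>
      have "(\<Sum>k\<in>I. \<integral>x. (Z x - Zk k x) * exp (l * Z x) \<partial>?R) = (\<integral>x. (\<Sum>k\<in>I. (Z x - Zk k x) * exp (l * Z x)) \<partial>?R)"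
        using iZk by simp
      also have "\<dots> \<le> (\<integral>x. Z x * exp (l * Z x) \<partial>?R)"
      proof (rule integral_mono[OF _ iZ])
        fix x
        have "(\<Sum>k\<in>I. Z x - Zk k x) \<le> Z x"
          unfolding Z_def Zk_def by (rule sup_sum_leave_one_out[OF H I])
        thus "(\<Sum>k\<in>I. (Z x - Zk k x) * exp (l * Z x)) \<le> Z x * exp (l * Z x)"
          by (simp add: mult_right_mono flip: sum_distrib_right)
      qed (use iZk in auto)
      finally show ?thesis by (simp add: mult_left_mono)
    qed
    finally show "l * (\<integral>x. Z x * exp (l * Z x) \<partial>?R) - (\<integral>x. exp (l * Z x) \<partial>?R) * ln (\<integral>x. exp (l * Z x) \<partial>?R)
      \<le> l\<^sup>2 * (4 * (\<integral>x. Z x * exp (l * Z x) \<partial>?R) + 2 * real (card I) * v * (\<integral>x. exp (l * Z x) \<partial>?R))"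
      by (simp add: K_def)
  qed
qed

section \<open>Tail bounds for finite suprema\<close>

lemma (in prob_space) chernoff:
  fixes W :: "'a \<Rightarrow> real"
  assumes [measurable]: "W \<in> borel_measurable M" and "integrable M (\<lambda>x. exp (W x))"
    and "(\<integral>x. exp (W x) \<partial>M) \<le> exp a"
  shows "prob {x\<in>space M. W x > a + t} \<le> exp (- t)"
proof -
  have "prob {x\<in>space M. W x > a + t} \<le> prob {x\<in>space M. exp (a + t) \<le> exp (W x)}"
    by (intro finite_measure_mono) auto
  also have "\<dots> \<le> (\<integral>x. exp (W x) \<partial>M) / exp (a + t)"
    by (rule integral_Markov_inequality_measure[where A="space M - space M"]) (use assms in auto)
  also have "\<dots> \<le> exp a / exp (a + t)" using assms by (intro divide_right_mono) auto
  also have "\<dots> = exp (- t)" by (simp flip: exp_diff)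
  finally show ?thesis .
qed

text \<open>Dividing by \<open>\<tau>\<close> reduces to functions bounded by 1. Any
  \<open>\<tau>\<close> above the uniform bound is allowed: a larger one lowers the variance term
  and raises the linear one, a trade exploited when \<open>\<tau>\<close> is chosen.\<close>

lemma talagrand_sup_sum:
  fixes P :: "'a measure" and H :: "('a \<Rightarrow> real) set" and I :: "'i set"
  assumes P: "prob_space P" and I: "finite I" and H: "finite H" "H \<noteq> {}"
    and Hm: "\<And>h. h \<in> H \<Longrightarrow> h \<in> borel_measurable P" and \<tau>: "0 < \<tau>"
    and Hb: "\<And>h y. h \<in> H \<Longrightarrow> y \<in> space P \<Longrightarrow> \<bar>h y\<bar> \<le> \<tau>"
    and H0: "\<And>h. h \<in> H \<Longrightarrow> (\<integral>y. h y \<partial>P) = 0"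
    and Hv: "\<And>h. h \<in> H \<Longrightarrow> (\<integral>y. (h y)\<^sup>2 \<partial>P) \<le> s2"
  shows "measure (PiM I (\<lambda>_. P)) {x \<in> space (PiM I (\<lambda>_. P)).
      sup_sum H I x > 2 * (\<integral>x. sup_sum H I x \<partial>PiM I (\<lambda>_. P)) + real (card I) * s2 / (2 * \<tau>) + 8 * \<tau> * t}
    \<le> exp (- t)"
proof -
  let ?R = "PiM I (\<lambda>_. P)"
  interpret R: prob_space ?R by (rule prob_space_PiM) (rule P)
  define H' where "H' = (\<lambda>h y. h y / \<tau>) ` H"
  have H': "finite H'" "H' \<noteq> {}" using H by (auto simp: H'_def)
  have Z': "sup_sum H' I x = sup_sum H I x / \<tau>" for x
  proof (rule antisym)
    obtain h where "h \<in> H'" "sup_sum H' I x = (\<Sum>i\<in>I. h (x i))" using sup_sum_attained[OF H'] .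
    then obtain g where "g \<in> H" "sup_sum H' I x = (\<Sum>i\<in>I. g (x i) / \<tau>)" unfolding H'_def by blast
    thus "sup_sum H' I x \<le> sup_sum H I x / \<tau>"
      using sup_sum_ge[OF H(1), of g x I] \<tau> by (simp add: divide_right_mono flip: sum_divide_distrib)
    obtain g where "g \<in> H" "sup_sum H I x = (\<Sum>i\<in>I. g (x i))" using sup_sum_attained[OF H] .
    moreover from this have "(\<Sum>i\<in>I. g (x i) / \<tau>) \<le> sup_sum H' I x"
      by (intro sup_sum_ge[OF H'(1), where h="\<lambda>y. g y / \<tau>"]) (auto simp: H'_def)
    ultimately show "sup_sum H I x / \<tau> \<le> sup_sum H' I x" by (simp add: sum_divide_distrib)
  qed
  have mgf: "(\<integral>x. exp (sup_sum H' I x / 8) \<partial>?R) \<le> exp ((\<integral>x. sup_sum H' I x \<partial>?R) / 4 + 2 * real (card I) * (s2 / \<tau>\<^sup>2) / 32)"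
  proof (rule mgf_sup_sum[OF P I H'])
    fix h assume "h \<in> H'"
    then obtain g where g: "g \<in> H" and h: "h = (\<lambda>y. g y / \<tau>)" by (auto simp: H'_def)
    note [measurable] = Hm[OF g]
    show "h \<in> borel_measurable P" unfolding h by measurable
    show "\<bar>h y\<bar> \<le> 1" if "y \<in> space P" for y using Hb[OF g that] \<tau> by (simp add: h)
    show "(\<integral>y. h y \<partial>P) = 0" using H0[OF g] by (simp add: h)
    show "(\<integral>y. (h y)\<^sup>2 \<partial>P) \<le> s2 / \<tau>\<^sup>2" using Hv[OF g] by (simp add: h power_divide divide_right_mono)
  qed
  have Zm: "sup_sum H I \<in> borel_measurable ?R" by (rule sup_sum_measurable[OF I order_refl H Hm])
  have "\<bar>sup_sum H I x\<bar> \<le> real (card I) * \<tau>" if "x \<in> space ?R" for x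
    using that by (intro sup_sum_bound[OF H] Hb) (auto simp: space_PiM)
  hence "sup_sum H I x / \<tau> / 8 \<le> real (card I) / 8" if "x \<in> space ?R" for x
    using that \<tau> by (force simp: pos_divide_le_eq dest: abs_le_D1)
  hence int: "integrable ?R (\<lambda>x. exp (sup_sum H I x / \<tau> / 8))"
    using Zm by (intro R.integrable_bounded[where K="exp (real (card I) / 8)"]) auto
  define E where "E = (\<integral>x. sup_sum H I x \<partial>?R)"
  \<comment> \<open>The Chernoff bound concerns the supremum divided by \<open>8 * \<tau>\<close>;
    multiplying its threshold back gives all three terms.\<close>
  have thr: "2 * E + real (card I) * s2 / (2 * \<tau>) + 8 * \<tau> * t
      = (E / \<tau> / 4 + 2 * real (card I) * (s2 / \<tau>\<^sup>2) / 32 + t) * 8 * \<tau>"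
    using \<tau> by (simp add: field_simps power2_eq_square)
  have E: "(\<integral>x. sup_sum H I x / \<tau> \<partial>?R) = E / \<tau>" by (simp add: E_def)
  have "{x \<in> space ?R. sup_sum H I x > 2 * E + real (card I) * s2 / (2 * \<tau>) + 8 * \<tau> * t}
    = {x \<in> space ?R. sup_sum H I x / \<tau> / 8 > (E / \<tau> / 4 + 2 * real (card I) * (s2 / \<tau>\<^sup>2) / 32) + t}"
    unfolding thr using \<tau> by (simp only: pos_less_divide_eq zero_less_numeral)
  also have "measure ?R \<dots> \<le> exp (- t)"
    using mgf Zm unfolding Z' E by (intro R.chernoff int) auto
  finally show ?thesis by (simp add: E_def)
qed

section \<open>Envelopes with exponential moments\<close>

text \<open>\<open>exp_max\<close> is the exponential-norm condition on the sample maximum,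
  transported to the product space. \<open>U\<close> is real and measurable because it will be the
  envelope of a finite subclass.\<close>

locale exp_envelope =
  fixes P :: "'a measure" and I :: "'i set" and U :: "'a \<Rightarrow> real" and b :: real
  assumes P: "prob_space P" and I: "finite I" "I \<noteq> {}" and U_meas [measurable]: "U \<in> borel_measurable P"
    and U_nonneg: "\<And>y. y \<in> space P \<Longrightarrow> 0 \<le> U y" and b_pos: "0 < b"
    and exp_max: "(\<integral>\<^sup>+x. ennreal (exp ((MAX i\<in>I. U (x i)) / b)) \<partial>PiM I (\<lambda>_. P)) \<le> 2"
begin

sublocale prob_space P by (rule P)
sublocale R: prob_space "PiM I (\<lambda>_. P)" by (rule prob_space_PiM) (rule P)
sublocale pp: product_prob_space "\<lambda>_::'i. P" I using P by (intro product_prob_spaceI)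

abbreviation R where "R \<equiv> PiM I (\<lambda>_. P)"

lemma component_meas [measurable]: "i \<in> I \<Longrightarrow> (\<lambda>x. x i) \<in> measurable R P"
  by (rule measurable_component_singleton)

lemma component_space: "x \<in> space R \<Longrightarrow> i \<in> I \<Longrightarrow> x i \<in> space P"
  by (auto simp: space_PiM)

lemma
  fixes g :: "'a \<Rightarrow> real"
  assumes i: "i \<in> I" and [measurable]: "g \<in> borel_measurable P"
  shows integrable_component: "integrable R (\<lambda>x. g (x i)) \<longleftrightarrow> integrable P g"
    and integral_component: "(\<integral>x. g (x i) \<partial>R) = (\<integral>y. g y \<partial>P)"
proof -
  have d: "distr R P (\<lambda>x. x i) = P" by (rule pp.PiM_component[OF i])
  show "integrable R (\<lambda>x. g (x i)) \<longleftrightarrow> integrable P g"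
    by (subst (2) d[symmetric], subst integrable_distr_eq) (use i in auto)
  show "(\<integral>x. g (x i) \<partial>R) = (\<integral>y. g y \<partial>P)"
    by (subst (2) d[symmetric], subst integral_distr) (use i in auto)
qed

lemma max_meas [measurable]: "(\<lambda>x. MAX i\<in>I. U (x i)) \<in> borel_measurable R"
  using I by (intro borel_measurable_Max) auto

lemma max_ge: "i \<in> I \<Longrightarrow> U (x i) \<le> (MAX i\<in>I. U (x i))"
  using I by (intro Max_ge) auto

text \<open>Markov's inequality for the exponential of the maximum at level \<open>exp 2\<close>,
  which is at least 4, leaves probability at most 1/2 for exceeding \<open>2 * b\<close>;
  independence turns the complement into a power. This is the origin of the truncation level
  \<open>2 * b\<close>.\<close>

lemma prob_all_small: "1/2 \<le> measure P {y\<in>space P. U y \<le> 2 * b} ^ card I"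
proof -
  let ?A = "{x\<in>space R. \<exists>i\<in>I. U (x i) > 2 * b}"
  have "ennreal (exp 2) * emeasure R ?A = (\<integral>\<^sup>+x. ennreal (exp 2) * indicator ?A x \<partial>R)"
    using I by (subst nn_integral_cmult_indicator) (auto intro!: sets.sets_Collect_finite_Ex)
  also have "\<dots> \<le> (\<integral>\<^sup>+x. ennreal (exp ((MAX i\<in>I. U (x i)) / b)) \<partial>R)"
  proof (rule nn_integral_mono)
    fix x
    show "ennreal (exp 2) * indicator ?A x \<le> ennreal (exp ((MAX i\<in>I. U (x i)) / b))"
    proof (cases "x \<in> ?A")
      case True
      then obtain i where i: "i \<in> I" "U (x i) > 2 * b" by auto
      hence "2 * b \<le> (MAX i\<in>I. U (x i))" using max_ge[OF i(1), of x] by linarith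
      hence "2 \<le> (MAX i\<in>I. U (x i)) / b" using b_pos by (simp add: pos_le_divide_eq)
      thus ?thesis using True by simp
    qed simp
  qed
  also have "\<dots> \<le> 2" by (rule exp_max)
  finally have "ennreal (exp 2 * measure R ?A) \<le> ennreal 2" by (simp add: R.emeasure_eq_measure ennreal_mult)
  hence 1: "exp 2 * measure R ?A \<le> 2" by (subst (asm) ennreal_le_iff) auto
  have "4 \<le> exp (2::real)" using exp_lower_Taylor_quadratic[of 2] by simp
  hence "4 * measure R ?A \<le> exp 2 * measure R ?A" by (intro mult_right_mono) auto
  hence A: "measure R ?A \<le> 1/2" using 1 by linarith
  have "emeasure R {x\<in>space R. \<forall>i\<in>I. x i \<in> {y\<in>space P. U y \<le> 2 * b}} = (\<Prod>i\<in>I. emeasure P {y\<in>space P. U y \<le> 2 * b})"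
    by (rule pp.emeasure_PiM_Collect) (use I in auto)
  hence "measure R {x\<in>space R. \<forall>i\<in>I. x i \<in> {y\<in>space P. U y \<le> 2 * b}} = measure P {y\<in>space P. U y \<le> 2 * b} ^ card I"
    by (simp add: R.emeasure_eq_measure emeasure_eq_measure ennreal_power)
  also have "{x\<in>space R. \<forall>i\<in>I. x i \<in> {y\<in>space P. U y \<le> 2 * b}} = space R - ?A"
    using component_space by (auto simp: not_less)
  also have "measure R (space R - ?A) = 1 - measure R ?A"
    using I by (intro R.prob_compl) (auto intro!: sets.sets_Collect_finite_Ex)
  finally show ?thesis using A by linarith
qed

text \<open>
  The maximum exceeds \<open>2 * b\<close> with probability at most 1/2, so up to a factor 2 the
  large values of the \<open>U (x i)\<close> occur one at a time and their sum is controlled by the maximum.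
\<close>

lemma exp_tail_nn: "of_nat (card I) * (\<integral>\<^sup>+y. ennreal (exp (U y / b)) * indicator {y. U y > 2 * b} y \<partial>P) \<le> 4"
proof -
  define W where "W = (\<lambda>y. ennreal (exp (U y / b)) * indicator {y. U y > 2 * b} y)"
  define V where "V = (\<lambda>y. indicator {y\<in>space P. U y \<le> 2 * b} y :: ennreal)"
  define w where "w = (\<integral>\<^sup>+y. W y \<partial>P)"
  define q where "q = measure P {y\<in>space P. U y \<le> 2 * b}"
  \<comment> \<open>The product of \<open>f i j (x j)\<close> over j lives on the event that
    coordinate i is the only large one. These events are disjoint, so the sum over i has at most one
    nonzero term, which the exponential of the maximum dominates.\<close>
  define f where "f = (\<lambda>(i::'i) j. if j = i then W else V)"
  have [measurable]: "W \<in> borel_measurable P" "V \<in> borel_measurable P" unfolding W_def V_def by measurable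
  have V_int: "(\<integral>\<^sup>+y. V y \<partial>P) = ennreal q"
    unfolding V_def q_def by (subst nn_integral_indicator) (auto simp: emeasure_eq_measure)
  have f_meas[measurable]: "f i j \<in> borel_measurable P" for i j :: 'i by (simp add: f_def)
  have prod_i: "(\<integral>\<^sup>+x. (\<Prod>j\<in>I. f i j (x j)) \<partial>R) = w * ennreal q ^ (card I - 1)" if i: "i \<in> I" for i
  proof -
    have "(\<integral>\<^sup>+x. (\<Prod>j\<in>I. f i j (x j)) \<partial>R) = (\<Prod>j\<in>I. integral\<^sup>N P (f i j))"
      by (rule pp.product_nn_integral_prod) (use I in auto)
    also have "\<dots> = integral\<^sup>N P (f i i) * (\<Prod>j\<in>I - {i}. integral\<^sup>N P (f i j))"
      using I i by (simp add: prod.remove)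
    also have "(\<Prod>j\<in>I - {i}. integral\<^sup>N P (f i j)) = (\<Prod>j\<in>I - {i}. ennreal q)"
      by (intro prod.cong) (auto simp: f_def V_int)
    finally show ?thesis using I i by (simp add: f_def w_def)
  qed
  have "of_nat (card I) * (w * ennreal q ^ (card I - 1)) = (\<Sum>i\<in>I. \<integral>\<^sup>+x. (\<Prod>j\<in>I. f i j (x j)) \<partial>R)"
    using prod_i by simp
  also have "\<dots> = (\<integral>\<^sup>+x. (\<Sum>i\<in>I. \<Prod>j\<in>I. f i j (x j)) \<partial>R)"
    by (intro nn_integral_sum[symmetric]) measurable
  also have "\<dots> \<le> (\<integral>\<^sup>+x. ennreal (exp ((MAX i\<in>I. U (x i)) / b)) \<partial>R)"
  proof (rule nn_integral_mono)
    fix x assume x: "x \<in> space R"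
    show "(\<Sum>i\<in>I. \<Prod>j\<in>I. f i j (x j)) \<le> ennreal (exp ((MAX i\<in>I. U (x i)) / b))"
    proof (cases "\<exists>i\<in>I. (\<Prod>j\<in>I. f i j (x j)) \<noteq> 0")
      case True
      then obtain i where i: "i \<in> I" "(\<Prod>j\<in>I. f i j (x j)) \<noteq> 0" by auto
      hence nz: "f i j (x j) \<noteq> 0" if "j \<in> I" for j using I that by simp
      have ui: "U (x i) > 2 * b" using nz[OF i(1)] by (auto simp: f_def W_def indicator_def split: if_splits)
      have "(\<Prod>j\<in>I. f k j (x j)) = 0" if "k \<in> I - {i}" for k
      proof -
        have "f k i (x i) = 0" using that ui by (auto simp: f_def V_def)
        thus ?thesis using I i by (intro prod_zero) auto
      qed
      hence "(\<Sum>k\<in>I. \<Prod>j\<in>I. f k j (x j)) = (\<Prod>j\<in>I. f i j (x j))"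
        using I i by (simp add: sum.remove[of I i])
      also have "\<dots> = f i i (x i) * (\<Prod>j\<in>I - {i}. f i j (x j))" using I i by (simp add: prod.remove)
      also have "\<dots> \<le> f i i (x i) * 1"
        by (intro mult_left_mono prod_le_1) (auto simp: f_def V_def indicator_def)
      also have "\<dots> \<le> ennreal (exp (U (x i) / b))" by (auto simp: f_def W_def indicator_def)
      also have "\<dots> \<le> ennreal (exp ((MAX i\<in>I. U (x i)) / b))"
        using max_ge[OF i(1), of x] b_pos by (intro ennreal_leI) (simp add: divide_right_mono)
      finally show ?thesis .
    next
      case False
      hence "(\<Sum>i\<in>I. \<Prod>j\<in>I. f i j (x j)) = 0" by (intro sum.neutral) blast
      thus ?thesis by (simp only: zero_le)
    qed
  qed
  also have "\<dots> \<le> 2" by (rule exp_max)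
  finally have le2: "of_nat (card I) * (w * ennreal q ^ (card I - 1)) \<le> 2" .
  have q: "0 \<le> q" "q \<le> 1" by (auto simp: q_def)
  \<comment> \<open>That the other coordinates are all small has probability at least 1/2; dividing
    by it turns the bound 2 into 4.\<close>
  have "1/2 \<le> q ^ card I" using prob_all_small by (simp add: q_def)
  also have "\<dots> \<le> q ^ (card I - 1)" using q by (intro power_decreasing) auto
  finally have "ennreal (1/2) \<le> ennreal (q ^ (card I - 1))" by (rule ennreal_leI)
  hence "of_nat (card I) * (w * ennreal (1/2)) \<le> of_nat (card I) * (w * ennreal q ^ (card I - 1))"
    using q by (intro mult_left_mono) (auto simp: ennreal_power)
  hence "of_nat (card I) * w * ennreal (1/2) \<le> 2" using le2 by (simp add: mult.assoc)
  hence "of_nat (card I) * w * ennreal (1/2) * 2 \<le> 2 * 2" by (rule mult_right_mono) simp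
  moreover have "ennreal (1/2) * 2 = 1"
    using ennreal_mult[of "1/2" 2] by simp
  ultimately show ?thesis by (simp add: mult.assoc w_def W_def)
qed

section \<open>The envelope above the truncation level\<close>

definition tail :: "'a \<Rightarrow> real" where
  "tail y = (if U y > 2 * b then U y else 0)"

definition exp_tail :: "'a \<Rightarrow> real" where
  "exp_tail y = (if U y > 2 * b then exp (U y / b) else 0)"

lemma tail_meas [measurable]: "tail \<in> borel_measurable P" "exp_tail \<in> borel_measurable P"
  unfolding tail_def exp_tail_def by measurable

lemma exp_tail_integral: "integrable P exp_tail" "real (card I) * (\<integral>y. exp_tail y \<partial>P) \<le> 4"
proof -
  have eq: "(\<integral>\<^sup>+y. ennreal (exp (U y / b)) * indicator {y. U y > 2 * b} y \<partial>P) = (\<integral>\<^sup>+y. ennreal (exp_tail y) \<partial>P)"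
    by (intro nn_integral_cong) (auto simp: exp_tail_def)
  have le: "of_nat (card I) * (\<integral>\<^sup>+y. ennreal (exp_tail y) \<partial>P) \<le> 4" using exp_tail_nn by (simp add: eq)
  have "1 \<le> card I" using I by (simp add: card_gt_0_iff Suc_leI)
  hence "of_nat 1 \<le> (of_nat (card I) :: ennreal)" by (rule of_nat_mono)
  hence "1 \<le> (of_nat (card I) :: ennreal)" by simp
  hence "1 * (\<integral>\<^sup>+y. ennreal (exp_tail y) \<partial>P) \<le> of_nat (card I) * (\<integral>\<^sup>+y. ennreal (exp_tail y) \<partial>P)"
    by (rule mult_right_mono) simp
  hence "(\<integral>\<^sup>+y. ennreal (exp_tail y) \<partial>P) \<le> 4" using le by simp
  also have "\<dots> < \<infinity>" by simp
  finally have "(\<integral>\<^sup>+y. ennreal (exp_tail y) \<partial>P) < \<infinity>" .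
  thus int: "integrable P exp_tail" by (intro integrableI_nonneg) (auto simp: exp_tail_def)
  have nn: "0 \<le> (\<integral>y. exp_tail y \<partial>P)" by (rule Bochner_Integration.integral_nonneg) (simp add: exp_tail_def)
  have "(\<integral>\<^sup>+y. ennreal (exp_tail y) \<partial>P) = ennreal (\<integral>y. exp_tail y \<partial>P)"
    by (rule nn_integral_eq_integral[OF int]) (simp add: exp_tail_def)
  hence "ennreal (real (card I) * (\<integral>y. exp_tail y \<partial>P)) \<le> ennreal 4"
    using le nn by (simp add: ennreal_mult ennreal_of_nat_eq_real_of_nat)
  thus "real (card I) * (\<integral>y. exp_tail y \<partial>P) \<le> 4" by (subst (asm) ennreal_le_iff) auto
qed

lemma exp_envelope_le: "exp (U y / b) \<le> exp 2 + exp_tail y"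
proof (cases "U y > 2 * b")
  case False
  hence "U y / b \<le> 2" using b_pos by (simp add: pos_divide_le_eq)
  thus ?thesis using False by (simp add: exp_tail_def)
qed (simp add: exp_tail_def)

lemma integrable_exp_envelope: "integrable P (\<lambda>y. exp (U y / b))"
proof (rule Bochner_Integration.integrable_bound)
  show "integrable P (\<lambda>y. exp 2 + exp_tail y)" using exp_tail_integral by auto
  show "AE y in P. norm (exp (U y / b)) \<le> norm (exp 2 + exp_tail y)"
    using exp_envelope_le by (intro AE_I2) (auto intro: order_trans[OF _ abs_ge_self])
qed measurable

lemma integrable_envelope: "integrable P U" "integrable P (\<lambda>y. (U y)\<^sup>2)"
proof -
  have *: "U y \<le> b * exp (U y / b)" "(U y)\<^sup>2 \<le> 2 * b\<^sup>2 * exp (U y / b)" if y: "y \<in> space P" for y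
  proof -
    define t where "t = U y / b"
    have t: "0 \<le> t" and Ut: "U y = b * t" using U_nonneg[OF y] b_pos by (auto simp: t_def)
    have "1 + t + t\<^sup>2 / 2 \<le> exp t" by (rule exp_lower_Taylor_quadratic[OF t])
    hence "t \<le> exp t" "t\<^sup>2 \<le> 2 * exp t" using t zero_le_power2[of t] by linarith+
    thus "U y \<le> b * exp (U y / b)" "(U y)\<^sup>2 \<le> 2 * b\<^sup>2 * exp (U y / b)"
      unfolding t_def[symmetric] using b_pos by (auto simp: Ut power_mult_distrib mult_left_mono)
  qed
  show "integrable P U"
    by (rule Bochner_Integration.integrable_bound[OF integrable_mult_right[OF integrable_exp_envelope, of b]])
      (use * U_nonneg b_pos in \<open>auto intro!: AE_I2\<close>)
  show "integrable P (\<lambda>y. (U y)\<^sup>2)"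
    by (rule Bochner_Integration.integrable_bound[OF integrable_mult_right[OF integrable_exp_envelope, of "2 * b\<^sup>2"]])
      (use * U_nonneg b_pos in \<open>auto intro!: AE_I2\<close>)
qed

lemma integrable_tail: "integrable P tail"
  by (rule Bochner_Integration.integrable_bound[OF integrable_envelope(1)])
    (use U_nonneg in \<open>auto intro!: AE_I2 simp: tail_def\<close>)

text \<open>By t \<le> exp t the tail is at most \<open>b * exp_tail\<close>, and the mean of
  \<open>exp_tail\<close> is at most 4 / n for n the number of coordinates. So truncation moves the
  sum of the n means by at most \<open>4 * b\<close>, whatever n is.\<close>

lemma tail_integral_le: "real (card I) * (\<integral>y. tail y \<partial>P) \<le> 4 * b"
proof -
  have "(\<integral>y. tail y \<partial>P) \<le> (\<integral>y. b * exp_tail y \<partial>P)"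
  proof (rule integral_mono[OF integrable_tail])
    fix y
    have "U y / b \<le> exp (U y / b)" using exp_ge_add_one_self[of "U y / b"] by linarith
    hence "U y \<le> b * exp (U y / b)" using b_pos by (simp add: pos_divide_le_eq mult.commute)
    thus "tail y \<le> b * exp_tail y" by (simp add: tail_def exp_tail_def)
  qed (use exp_tail_integral in auto)
  also have "\<dots> = b * (\<integral>y. exp_tail y \<partial>P)" by simp
  finally have "real (card I) * (\<integral>y. tail y \<partial>P) \<le> real (card I) * (b * (\<integral>y. exp_tail y \<partial>P))"
    by (rule mult_left_mono) simp
  also have "\<dots> = b * (real (card I) * (\<integral>y. exp_tail y \<partial>P))" by simp
  also have "\<dots> \<le> b * 4" using exp_tail_integral(2) b_pos by (intro mult_left_mono) auto
  finally show ?thesis by simp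
qed

text \<open>The mean of \<open>exp (tail / b)\<close> is at most 1 + w, where n * w \<le> 4. By
  independence the sum of all tails has exponential moment at most \<open>exp 4\<close> at scale
  \<open>b\<close>, as a single large value would.\<close>

lemma tail_sum_deviation: "measure R {x\<in>space R. (\<Sum>i\<in>I. tail (x i)) > b * (4 + t)} \<le> exp (- t)"
proof -
  have le: "exp (tail y / b) \<le> 1 + exp_tail y" for y by (simp add: tail_def exp_tail_def)
  have int: "integrable P (\<lambda>y. exp (tail y / b))"
  proof (rule Bochner_Integration.integrable_bound)
    show "integrable P (\<lambda>y. 1 + exp_tail y)" using exp_tail_integral by auto
    show "AE y in P. norm (exp (tail y / b)) \<le> norm (1 + exp_tail y)"
      using le by (intro AE_I2) (auto intro: order_trans[OF _ abs_ge_self])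
  qed measurable
  define w where "w = (\<integral>y. exp_tail y \<partial>P)"
  have w0: "0 \<le> w" unfolding w_def by (rule Bochner_Integration.integral_nonneg) (simp add: exp_tail_def)
  have "(\<integral>y. exp (tail y / b) \<partial>P) \<le> (\<integral>y. 1 + exp_tail y \<partial>P)"
    using int exp_tail_integral le by (intro integral_mono) auto
  also have "\<dots> = 1 + w" using exp_tail_integral by (simp add: w_def prob_space)
  also have "\<dots> \<le> exp w" by (rule exp_ge_add_one_self)
  finally have 1: "(\<integral>y. exp (tail y / b) \<partial>P) \<le> exp w" .
  have exp_sum': "exp ((\<Sum>i\<in>I. tail (x i)) / b) = (\<Prod>i\<in>I. exp (tail (x i) / b))" for x
    using I by (simp add: sum_divide_distrib exp_sum)
  have "(\<integral>x. exp ((\<Sum>i\<in>I. tail (x i)) / b) \<partial>R) = (\<Prod>i\<in>I. \<integral>y. exp (tail y / b) \<partial>P)"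
    unfolding exp_sum' by (rule pp.product_integral_prod) (use I int in auto)
  also have "\<dots> = (\<integral>y. exp (tail y / b) \<partial>P) ^ card I" by simp
  also have "\<dots> \<le> exp w ^ card I" by (rule power_mono[OF 1]) (rule Bochner_Integration.integral_nonneg, simp)
  also have "\<dots> = exp (real (card I) * w)" by (simp add: exp_of_nat_mult)
  also have "\<dots> \<le> exp 4" using exp_tail_integral(2) by (simp add: w_def)
  finally have mgf: "(\<integral>x. exp ((\<Sum>i\<in>I. tail (x i)) / b) \<partial>R) \<le> exp 4" .
  have "integrable R (\<lambda>x. exp ((\<Sum>i\<in>I. tail (x i)) / b))"
    unfolding exp_sum' by (rule pp.product_integrable_prod) (use I int in auto)
  from R.chernoff[OF _ this mgf] have "measure R {x\<in>space R. (\<Sum>i\<in>I. tail (x i)) / b > 4 + t} \<le> exp (- t)"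
    by measurable
  thus ?thesis using b_pos by (simp add: pos_less_divide_eq mult.commute)
qed

end

section \<open>Deviations under an exponential envelope\<close>

text \<open>The empirical deviation multiplied by the sample size, to match \<open>sup_sum\<close>;
  real-valued, hence meant for finite nonempty \<open>H\<close>.\<close>

definition abs_dev :: "'a measure \<Rightarrow> ('a \<Rightarrow> real) set \<Rightarrow> 'i set \<Rightarrow> ('i \<Rightarrow> 'a) \<Rightarrow> real" where
  "abs_dev P H I x = (MAX g\<in>H. \<bar>\<Sum>i\<in>I. (\<integral>y. g y \<partial>P) - g (x i)\<bar>)"

section \<open>Truncation of a single function\<close>

context exp_envelope
begin

text \<open>The cutoff looks at the envelope \<open>U\<close> rather than at \<open>g\<close>, and
  \<open>g\<close> is set to zero beyond it. The removed part is thus at most \<open>tail\<close>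
  for all \<open>g\<close> at once, and second moments do not increase.\<close>

definition trunc :: "('a \<Rightarrow> real) \<Rightarrow> 'a \<Rightarrow> real" where
  "trunc g y = (if U y > 2 * b then 0 else g y)"

lemma trunc_meas [measurable (raw)]:
  assumes [measurable]: "g \<in> borel_measurable P"
  shows "trunc g \<in> borel_measurable P"
  unfolding trunc_def by measurable

text \<open>Centred, and used with \<open>s\<close> equal to 1 and -1, so that a one-sided supremum
  becomes one of absolute values.\<close>

definition signed_trunc :: "real \<Rightarrow> ('a \<Rightarrow> real) \<Rightarrow> 'a \<Rightarrow> real" where
  "signed_trunc s g y = s * ((\<integral>z. trunc g z \<partial>P) - trunc g y)"

context
  fixes g :: "'a \<Rightarrow> real"
  assumes g_meas [measurable]: "g \<in> borel_measurable P" and g_le: "\<And>y. y \<in> space P \<Longrightarrow> \<bar>g y\<bar> \<le> U y"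
begin

lemma integrable_enveloped: "integrable P g" "integrable P (\<lambda>y. (g y)\<^sup>2)"
proof -
  show "integrable P g"
    by (rule Bochner_Integration.integrable_bound[OF integrable_envelope(1)])
      (use g_le U_nonneg in \<open>auto intro!: AE_I2\<close>)
  show "integrable P (\<lambda>y. (g y)\<^sup>2)"
  proof (rule Bochner_Integration.integrable_bound[OF integrable_envelope(2)])
    show "AE y in P. norm ((g y)\<^sup>2) \<le> norm ((U y)\<^sup>2)"
    proof (rule AE_I2)
      fix y assume "y \<in> space P"
      hence "\<bar>g y\<bar>\<^sup>2 \<le> (U y)\<^sup>2" using g_le by (intro power_mono) auto
      thus "norm ((g y)\<^sup>2) \<le> norm ((U y)\<^sup>2)" by simp
    qed
  qed measurable
qed

lemma trunc_bounds:
  assumes "y \<in> space P"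
  shows "\<bar>trunc g y\<bar> \<le> 2 * b" "\<bar>g y - trunc g y\<bar> \<le> tail y"
  using g_le[OF assms] b_pos by (auto simp: trunc_def tail_def)

lemma integrable_trunc: "integrable P (trunc g)"
  using trunc_bounds by (intro integrable_bounded[where K="2 * b"]) auto

lemma trunc_mean_bound: "\<bar>\<integral>y. trunc g y \<partial>P\<bar> \<le> 2 * b"
proof -
  have "\<bar>\<integral>y. trunc g y \<partial>P\<bar> \<le> (\<integral>y. \<bar>trunc g y\<bar> \<partial>P)" by (rule integral_abs_bound)
  also have "\<dots> \<le> 2 * b"
    using trunc_bounds integrable_trunc by (intro integral_le_const AE_I2) auto
  finally show ?thesis .
qed

lemma mean_trunc_diff: "\<bar>(\<integral>y. g y \<partial>P) - (\<integral>y. trunc g y \<partial>P)\<bar> \<le> (\<integral>y. tail y \<partial>P)"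
proof -
  have "(\<integral>y. g y \<partial>P) - (\<integral>y. trunc g y \<partial>P) = (\<integral>y. g y - trunc g y \<partial>P)"
    using integrable_enveloped integrable_trunc by simp
  moreover have "\<bar>\<integral>y. g y - trunc g y \<partial>P\<bar> \<le> (\<integral>y. \<bar>g y - trunc g y\<bar> \<partial>P)" by (rule integral_abs_bound)
  moreover have "\<dots> \<le> (\<integral>y. tail y \<partial>P)"
    using integrable_enveloped integrable_trunc integrable_tail trunc_bounds by (intro integral_mono) auto
  ultimately show ?thesis by linarith
qed

text \<open>The sample contributes the sum of its tails; the means contribute n times the mean tail,
  which is at most \<open>4 * b\<close>.\<close>

lemma sum_trunc_diff:
  assumes x: "x \<in> space R"
  shows "\<bar>(\<Sum>i\<in>I. (\<integral>y. g y \<partial>P) - g (x i)) - (\<Sum>i\<in>I. (\<integral>y. trunc g y \<partial>P) - trunc g (x i))\<bar>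
    \<le> (\<Sum>i\<in>I. tail (x i)) + 4 * b"
proof -
  have "(\<Sum>i\<in>I. (\<integral>y. g y \<partial>P) - g (x i)) - (\<Sum>i\<in>I. (\<integral>y. trunc g y \<partial>P) - trunc g (x i))
    = (\<Sum>i\<in>I. ((\<integral>y. g y \<partial>P) - (\<integral>y. trunc g y \<partial>P)) - (g (x i) - trunc g (x i)))" (is "?l = ?r")
    by (simp add: sum_subtractf sum.distrib right_diff_distrib)
  hence "\<bar>?l\<bar> = \<bar>?r\<bar>" by (rule arg_cong)
  also have "\<bar>?r\<bar> \<le> (\<Sum>i\<in>I. \<bar>((\<integral>y. g y \<partial>P) - (\<integral>y. trunc g y \<partial>P)) - (g (x i) - trunc g (x i))\<bar>)"
    by (rule sum_abs)
  also have "\<dots> \<le> (\<Sum>i\<in>I. (\<integral>y. tail y \<partial>P) + tail (x i))"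
  proof (rule sum_mono)
    fix i assume "i \<in> I"
    from trunc_bounds(2)[OF component_space[OF x this]] mean_trunc_diff
    show "\<bar>((\<integral>y. g y \<partial>P) - (\<integral>y. trunc g y \<partial>P)) - (g (x i) - trunc g (x i))\<bar> \<le> (\<integral>y. tail y \<partial>P) + tail (x i)"
      by linarith
  qed
  also have "\<dots> = real (card I) * (\<integral>y. tail y \<partial>P) + (\<Sum>i\<in>I. tail (x i))" by (simp add: sum.distrib)
  finally show ?thesis using tail_integral_le by linarith
qed

lemma signed_trunc_meas: "signed_trunc s g \<in> borel_measurable P"
  unfolding signed_trunc_def by measurable

lemma signed_trunc_bound:
  assumes "\<bar>s\<bar> = 1" "y \<in> space P"
  shows "\<bar>signed_trunc s g y\<bar> \<le> 4 * b"
  unfolding signed_trunc_def abs_mult assms(1) mult_1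
  using trunc_mean_bound trunc_bounds(1)[OF assms(2)] by linarith

lemma signed_trunc_mean: "(\<integral>y. signed_trunc s g y \<partial>P) = 0"
  using integrable_trunc by (simp add: signed_trunc_def prob_space)

lemma signed_trunc_var:
  assumes "\<bar>s\<bar> = 1"
  shows "(\<integral>y. (signed_trunc s g y)\<^sup>2 \<partial>P) \<le> (\<integral>y. (g y)\<^sup>2 \<partial>P)"
proof -
  define m where "m = (\<integral>y. trunc g y \<partial>P)"
  have s2: "s\<^sup>2 = 1" using assms by (metis power2_abs power_one)
  have i2: "integrable P (\<lambda>y. (trunc g y)\<^sup>2)"
  proof (rule integrable_bounded[where K="(2 * b)\<^sup>2"])
    fix y assume "y \<in> space P"
    hence "\<bar>trunc g y\<bar>\<^sup>2 \<le> (2 * b)\<^sup>2" using trunc_bounds by (intro power_mono) auto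
    thus "\<bar>(trunc g y)\<^sup>2\<bar> \<le> (2 * b)\<^sup>2" by simp
  qed measurable
  have "(\<integral>y. (signed_trunc s g y)\<^sup>2 \<partial>P) = (\<integral>y. m\<^sup>2 - 2 * m * trunc g y + (trunc g y)\<^sup>2 \<partial>P)"
    unfolding signed_trunc_def power_mult_distrib s2 m_def[symmetric]
    by (intro Bochner_Integration.integral_cong refl) (simp add: power2_diff)
  also have "\<dots> = m\<^sup>2 - 2 * m * m + (\<integral>y. (trunc g y)\<^sup>2 \<partial>P)"
    using i2 integrable_trunc by (simp add: m_def prob_space)
  also have "\<dots> \<le> (\<integral>y. (trunc g y)\<^sup>2 \<partial>P)" using zero_le_power2[of m] unfolding power2_eq_square by linarith
  also have "\<dots> \<le> (\<integral>y. (g y)\<^sup>2 \<partial>P)"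
    using i2 integrable_enveloped by (intro integral_mono) (auto simp: trunc_def)
  finally show ?thesis .
qed

end

section \<open>Finite classes under a common envelope\<close>

context
  fixes H :: "('a \<Rightarrow> real) set"
  assumes H: "finite H" "H \<noteq> {}" and H_meas: "\<And>g. g \<in> H \<Longrightarrow> g \<in> borel_measurable P"
    and H_le: "\<And>g y. g \<in> H \<Longrightarrow> y \<in> space P \<Longrightarrow> \<bar>g y\<bar> \<le> U y"
begin

definition trunc_class :: "('a \<Rightarrow> real) set" where
  "trunc_class = (\<lambda>(s, g). signed_trunc s g) ` ({1, -1} \<times> H)"

lemma trunc_class_fin: "finite trunc_class" "trunc_class \<noteq> {}"
  unfolding trunc_class_def using H by simp_all

lemma trunc_classE:
  assumes "h \<in> trunc_class"
  obtains s g where "\<bar>s\<bar> = 1" "g \<in> H" "h = signed_trunc s g"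
proof -
  from assms obtain p where "h = (\<lambda>(s, g). signed_trunc s g) p" "p \<in> {1, -1} \<times> H"
    unfolding trunc_class_def by (rule imageE)
  thus ?thesis by (intro that[of "fst p" "snd p"]) auto
qed

lemma abs_dev_meas: "abs_dev P H I \<in> borel_measurable R"
  unfolding abs_dev_def
proof (rule borel_measurable_Max[OF H(1)])
  fix g assume "g \<in> H"
  note [measurable] = H_meas[OF this]
  show "(\<lambda>x. \<bar>\<Sum>i\<in>I. (\<integral>y. g y \<partial>P) - g (x i)\<bar>) \<in> borel_measurable R" by measurable
qed

text \<open>Both directions are needed: one carries the deviation bound from the truncated supremum
  to the original one, the other compares their expectations.\<close>

lemma sup_sum_trunc_class:
  assumes x: "x \<in> space R"
  shows "\<bar>abs_dev P H I x - sup_sum trunc_class I x\<bar> \<le> (\<Sum>i\<in>I. tail (x i)) + 4 * b"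
proof -
  let ?c = "(\<Sum>i\<in>I. tail (x i)) + 4 * b"
  note diff = sum_trunc_diff[OF H_meas H_le x]
  have st: "(\<Sum>i\<in>I. signed_trunc s g (x i)) = s * (\<Sum>i\<in>I. (\<integral>y. trunc g y \<partial>P) - trunc g (x i))" for s g
    by (simp add: signed_trunc_def sum_distrib_left)
  have "abs_dev P H I x \<in> (\<lambda>g. \<bar>\<Sum>i\<in>I. (\<integral>y. g y \<partial>P) - g (x i)\<bar>) ` H"
    unfolding abs_dev_def using H by (intro Max_in) auto
  then obtain g where g: "g \<in> H" "abs_dev P H I x = \<bar>\<Sum>i\<in>I. (\<integral>y. g y \<partial>P) - g (x i)\<bar>" by auto
  define T where "T = (\<Sum>i\<in>I. (\<integral>y. trunc g y \<partial>P) - trunc g (x i))"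
  have "(\<Sum>i\<in>I. signed_trunc s g (x i)) \<le> sup_sum trunc_class I x" if "s \<in> {1, -1}" for s
  proof -
    have "signed_trunc s g \<in> trunc_class"
      unfolding trunc_class_def using that g(1) by (intro image_eqI[of _ _ "(s, g)"]) auto
    thus ?thesis by (rule sup_sum_ge[OF trunc_class_fin(1)])
  qed
  from this[of 1] this[of "-1"] have "\<bar>T\<bar> \<le> sup_sum trunc_class I x"
    unfolding st T_def[symmetric] by simp
  moreover have "\<bar>\<Sum>i\<in>I. (\<integral>y. g y \<partial>P) - g (x i)\<bar> \<le> \<bar>T\<bar> + ?c"
    using diff[OF g(1) g(1)] unfolding T_def by linarith
  ultimately have 1: "abs_dev P H I x \<le> sup_sum trunc_class I x + ?c" using g(2) by linarith
  obtain h where h: "h \<in> trunc_class" "sup_sum trunc_class I x = (\<Sum>i\<in>I. h (x i))"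
    using sup_sum_attained[OF trunc_class_fin] .
  from h(1) obtain s g' where g': "\<bar>s\<bar> = 1" "g' \<in> H" "h = signed_trunc s g'" by (rule trunc_classE)
  define T' where "T' = (\<Sum>i\<in>I. (\<integral>y. trunc g' y \<partial>P) - trunc g' (x i))"
  have "sup_sum trunc_class I x \<le> \<bar>s * T'\<bar>" using h g' by (simp add: st T'_def)
  also have "\<dots> = \<bar>T'\<bar>" using g' by (simp add: abs_mult)
  also have "\<dots> \<le> \<bar>\<Sum>i\<in>I. (\<integral>y. g' y \<partial>P) - g' (x i)\<bar> + ?c"
    using diff[OF g'(2) g'(2)] unfolding T'_def by linarith
  also have "\<bar>\<Sum>i\<in>I. (\<integral>y. g' y \<partial>P) - g' (x i)\<bar> \<le> abs_dev P H I x"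
    unfolding abs_dev_def using H g' by (intro Max_ge) auto
  finally show ?thesis using 1 by linarith
qed

lemma sup_sum_trunc_class_meas: "sup_sum trunc_class I \<in> borel_measurable R"
proof (rule sup_sum_measurable[OF I(1) order_refl trunc_class_fin])
  fix h assume "h \<in> trunc_class"
  then obtain s g where "g \<in> H" "h = signed_trunc s g" by (rule trunc_classE)
  thus "h \<in> borel_measurable P" using signed_trunc_meas[OF H_meas H_le] by simp
qed

lemma integrable_sup_sum_trunc_class: "integrable R (sup_sum trunc_class I)"
proof (rule R.integrable_bounded[OF sup_sum_trunc_class_meas])
  fix x assume x: "x \<in> space R"
  show "\<bar>sup_sum trunc_class I x\<bar> \<le> real (card I) * (4 * b)"
  proof (rule sup_sum_bound[OF trunc_class_fin])
    fix h i assume "h \<in> trunc_class" "i \<in> I"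
    from this(1) obtain s g where "\<bar>s\<bar> = 1" "g \<in> H" "h = signed_trunc s g" by (rule trunc_classE)
    thus "\<bar>h (x i)\<bar> \<le> 4 * b"
      using signed_trunc_bound[OF H_meas H_le _ component_space[OF x \<open>i \<in> I\<close>]] by simp
  qed
qed

lemma tail_sum:
  "integrable R (\<lambda>x. \<Sum>i\<in>I. tail (x i))" "(\<integral>x. (\<Sum>i\<in>I. tail (x i)) \<partial>R) \<le> 4 * b"
proof -
  have i: "integrable R (\<lambda>x. tail (x i))" if "i \<in> I" for i
    using integrable_component[OF that, of tail] integrable_tail by simp
  thus "integrable R (\<lambda>x. \<Sum>i\<in>I. tail (x i))" by (rule Bochner_Integration.integrable_sum)
  have "(\<integral>x. (\<Sum>i\<in>I. tail (x i)) \<partial>R) = (\<Sum>i\<in>I. \<integral>x. tail (x i) \<partial>R)"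
    using i by (rule Bochner_Integration.integral_sum)
  also have "\<dots> = real (card I) * (\<integral>y. tail y \<partial>P)" by (simp add: integral_component)
  finally show "(\<integral>x. (\<Sum>i\<in>I. tail (x i)) \<partial>R) \<le> 4 * b" using tail_integral_le by simp
qed

lemma integrable_abs_dev: "integrable R (abs_dev P H I)"
proof (rule Bochner_Integration.integrable_bound)
  show "integrable R (\<lambda>x. \<bar>sup_sum trunc_class I x\<bar> + ((\<Sum>i\<in>I. tail (x i)) + 4 * b))"
    using integrable_sup_sum_trunc_class tail_sum(1) by auto
  show "AE x in R. norm (abs_dev P H I x) \<le> norm (\<bar>sup_sum trunc_class I x\<bar> + ((\<Sum>i\<in>I. tail (x i)) + 4 * b))"
  proof (rule AE_I2)
    fix x assume x: "x \<in> space R"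
    show "norm (abs_dev P H I x) \<le> norm (\<bar>sup_sum trunc_class I x\<bar> + ((\<Sum>i\<in>I. tail (x i)) + 4 * b))"
      unfolding real_norm_def using sup_sum_trunc_class[OF x] by linarith
  qed
qed (rule abs_dev_meas)

text \<open>Centred truncated functions are bounded by \<open>4 * b\<close>, whence the condition on
  \<open>\<tau>\<close>. The term \<open>24 * b\<close> collects 16 from twice the gap
  \<open>8 * b\<close> between the expectations, 4 from comparing the suprema and 4 from the tail
  sum, which also yields \<open>b * t\<close>. Two exceptional events give the factor 2.\<close>

lemma abs_dev_deviation:
  assumes var: "\<And>g. g \<in> H \<Longrightarrow> (\<integral>y. (g y)\<^sup>2 \<partial>P) \<le> s2" and \<tau>: "4 * b \<le> \<tau>"
  shows "measure R {x\<in>space R. abs_dev P H I x >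
      2 * (\<integral>x. abs_dev P H I x \<partial>R) + 24 * b + b * t + real (card I) * s2 / (2 * \<tau>) + 8 * \<tau> * t}
    \<le> 2 * exp (- t)"
proof -
  define Z where "Z = sup_sum trunc_class I"
  note Z_meas[measurable] = sup_sum_trunc_class_meas[folded Z_def]
  define A where "A = {x\<in>space R. Z x > 2 * (\<integral>x. Z x \<partial>R) + real (card I) * s2 / (2 * \<tau>) + 8 * \<tau> * t}"
  define A' where "A' = {x\<in>space R. (\<Sum>i\<in>I. tail (x i)) > b * (4 + t)}"
  have m: "A \<in> R.events" "A' \<in> R.events" unfolding A_def A'_def by measurable
  have "measure R A \<le> exp (- t)"
    unfolding A_def Z_def
  proof (rule talagrand_sup_sum[OF P I(1) trunc_class_fin])
    show "0 < \<tau>" using b_pos \<tau> by linarith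
    fix h assume "h \<in> trunc_class"
    then obtain s g where s: "\<bar>s\<bar> = 1" and g: "g \<in> H" and h: "h = signed_trunc s g" by (rule trunc_classE)
    note gH = H_meas[OF g] H_le[OF g]
    show "h \<in> borel_measurable P" "(\<integral>y. h y \<partial>P) = 0" "(\<integral>y. (h y)\<^sup>2 \<partial>P) \<le> s2"
      unfolding h using var[OF g] signed_trunc_var[OF gH s] signed_trunc_meas[OF gH] signed_trunc_mean[OF gH]
      by simp_all
    show "\<bar>h y\<bar> \<le> \<tau>" if "y \<in> space P" for y
      unfolding h using signed_trunc_bound[OF gH s that] \<tau> by linarith
  qed
  moreover have "measure R A' \<le> exp (- t)" unfolding A'_def by (rule tail_sum_deviation)
  ultimately have union: "measure R (A \<union> A') \<le> 2 * exp (- t)"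
    using measure_Un_le[OF m] by linarith
  have EZ: "(\<integral>x. Z x \<partial>R) \<le> (\<integral>x. abs_dev P H I x \<partial>R) + 8 * b"
  proof -
    have "(\<integral>x. Z x \<partial>R) \<le> (\<integral>x. abs_dev P H I x + ((\<Sum>i\<in>I. tail (x i)) + 4 * b) \<partial>R)"
    proof (rule integral_mono)
      show "integrable R Z" unfolding Z_def by (rule integrable_sup_sum_trunc_class)
      show "integrable R (\<lambda>x. abs_dev P H I x + ((\<Sum>i\<in>I. tail (x i)) + 4 * b))"
        using integrable_abs_dev tail_sum(1) by auto
      show "Z x \<le> abs_dev P H I x + ((\<Sum>i\<in>I. tail (x i)) + 4 * b)" if "x \<in> space R" for x
        using sup_sum_trunc_class[OF that] unfolding Z_def by linarith
    qed
    also have "\<dots> = (\<integral>x. abs_dev P H I x \<partial>R) + ((\<integral>x. (\<Sum>i\<in>I. tail (x i)) \<partial>R) + 4 * b)"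
      using integrable_abs_dev tail_sum(1) by (simp add: R.prob_space)
    finally show ?thesis using tail_sum(2) by linarith
  qed
  have "{x\<in>space R. abs_dev P H I x >
      2 * (\<integral>x. abs_dev P H I x \<partial>R) + 24 * b + b * t + real (card I) * s2 / (2 * \<tau>) + 8 * \<tau> * t} \<subseteq> A \<union> A'"
  proof
    fix x assume "x \<in> {x\<in>space R. abs_dev P H I x >
      2 * (\<integral>x. abs_dev P H I x \<partial>R) + 24 * b + b * t + real (card I) * s2 / (2 * \<tau>) + 8 * \<tau> * t}"
    hence x: "x \<in> space R" and gt: "abs_dev P H I x >
      2 * (\<integral>x. abs_dev P H I x \<partial>R) + 24 * b + b * t + real (card I) * s2 / (2 * \<tau>) + 8 * \<tau> * t" by auto
    have "abs_dev P H I x \<le> Z x + (\<Sum>i\<in>I. tail (x i)) + 4 * b"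
      using sup_sum_trunc_class[OF x] unfolding Z_def by linarith
    moreover have "b * (4 + t) = 4 * b + b * t" by (simp add: algebra_simps)
    ultimately show "x \<in> A \<union> A'" using gt EZ x unfolding A_def A'_def mem_Collect_eq Un_iff by linarith
  qed
  hence "measure R {x\<in>space R. abs_dev P H I x >
      2 * (\<integral>x. abs_dev P H I x \<partial>R) + 24 * b + b * t + real (card I) * s2 / (2 * \<tau>) + 8 * \<tau> * t} \<le> measure R (A \<union> A')"
    using m by (intro R.finite_measure_mono) auto
  thus ?thesis using union by linarith
qed

end

end

section \<open>Independent samples and countable classes\<close>

locale iid_data =
  fixes M :: "'w measure" and P :: "'z measure" and n :: nat and X :: "nat \<Rightarrow> 'w \<Rightarrow> 'z"
  assumes n_ge_1: "1 \<le> n" and iid: "iid_sample M P n X"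
begin

sublocale M: prob_space M using iid by (simp add: iid_sample_def)
sublocale P: prob_space P using iid by (simp add: iid_sample_def)

abbreviation D where "D \<equiv> data_space P n"

sublocale D: prob_space "data_space P n" by (rule prob_space_PiM) (rule P.prob_space_axioms)

lemma indep: "M.indep_vars (\<lambda>_. P) X {0..n}"
  using iid by (simp add: iid_sample_def)

lemma X_meas: "i \<le> n \<Longrightarrow> X i \<in> measurable M P"
  using indep by (simp add: M.indep_vars_def)

lemma distr_X: "i \<le> n \<Longrightarrow> distr M P (X i) = P"
  using iid by (simp add: iid_sample_def)

lemma data_meas [measurable]: "data n X \<in> measurable M D"
proof -
  have "(\<lambda>\<omega>. \<lambda>i\<in>{1..n}. X i \<omega>) \<in> measurable M D"
    by (rule measurable_restrict) (simp add: X_meas)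
  thus ?thesis by (simp add: data_def[abs_def])
qed

lemma data_apply: "i \<in> {1..n} \<Longrightarrow> data n X \<omega> i = X i \<omega>"
  by (simp add: data_def)

lemma data_in_space: "\<omega> \<in> space M \<Longrightarrow> data n X \<omega> \<in> space D"
  by (rule measurable_space[OF data_meas])

lemma distr_restrict:
  assumes "J \<subseteq> {0..n}" "J \<noteq> {}"
  shows "distr M (PiM J (\<lambda>_. P)) (\<lambda>\<omega>. \<lambda>i\<in>J. X i \<omega>) = PiM J (\<lambda>_. P)"
proof -
  have "M.indep_vars (\<lambda>_. P) X J" by (rule M.indep_vars_subset[OF indep assms(1)])
  moreover have "X i \<in> measurable M P" if "i \<in> J" for i using that assms(1) by (intro X_meas) auto
  ultimately have "distr M (PiM J (\<lambda>_. P)) (\<lambda>\<omega>. \<lambda>i\<in>J. X i \<omega>) = (\<Pi>\<^sub>M i\<in>J. distr M P (X i))"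
    using M.indep_vars_iff_distr_eq_PiM'[OF assms(2), where M'="\<lambda>_. P" and X=X] by simp
  also have "\<dots> = PiM J (\<lambda>_. P)"
  proof (rule PiM_cong[OF refl])
    fix i assume "i \<in> J"
    thus "distr M P (X i) = P" using assms(1) by (intro distr_X) auto
  qed
  finally show ?thesis .
qed

lemma distr_data: "distr M D (data n X) = D"
  using distr_restrict[of "{1..n}"] n_ge_1 unfolding data_def[abs_def] by simp

text \<open>The index blocks \<open>{1..n}\<close> and \<open>{0}\<close> are disjoint, hence
  independent. The test point is first treated as a family over the singleton \<open>{0}\<close>, in
  the same shape as the data, and then projected to its only coordinate.\<close>

lemma distr_data_test: "distr M (D \<Otimes>\<^sub>M P) (\<lambda>\<omega>. (data n X \<omega>, X 0 \<omega>)) = D \<Otimes>\<^sub>M P"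
proof -
  let ?Q = "PiM {0::nat} (\<lambda>_. P)" and ?r = "\<lambda>\<omega>. \<lambda>i\<in>{0::nat}. X i \<omega>"
  interpret Q: prob_space ?Q by (rule prob_space_PiM) (rule P.prob_space_axioms)
  have r_meas[measurable]: "?r \<in> measurable M ?Q"
    by (rule measurable_restrict) (simp add: X_meas)
  have comp[measurable]: "(\<lambda>y. y 0) \<in> measurable ?Q P" by (rule measurable_component_singleton) simp
  have comp_distr: "distr ?Q P (\<lambda>y. y 0) = P"
    by (rule distr_PiM_component) (simp_all add: P.prob_space_axioms)
  have "M.indep_var D (data n X) ?Q ?r"
    unfolding data_def[abs_def] by (rule M.indep_var_restrict[OF indep]) auto
  hence "distr M D (data n X) \<Otimes>\<^sub>M distr M ?Q ?r = distr M (D \<Otimes>\<^sub>M ?Q) (\<lambda>\<omega>. (data n X \<omega>, ?r \<omega>))"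
    unfolding M.indep_var_distribution_eq by blast
  moreover have "distr M ?Q ?r = ?Q" by (rule distr_restrict) auto
  ultimately have joint: "distr M (D \<Otimes>\<^sub>M ?Q) (\<lambda>\<omega>. (data n X \<omega>, ?r \<omega>)) = D \<Otimes>\<^sub>M ?Q"
    by (simp only: distr_data)
  have "distr M (D \<Otimes>\<^sub>M P) (\<lambda>\<omega>. (data n X \<omega>, X 0 \<omega>))
    = distr (distr M (D \<Otimes>\<^sub>M ?Q) (\<lambda>\<omega>. (data n X \<omega>, ?r \<omega>))) (D \<Otimes>\<^sub>M P) (\<lambda>(d, y). (d, y 0))"
    by (subst distr_distr[OF _ measurable_Pair[OF data_meas r_meas]]) (simp_all add: comp_def)
  also have "\<dots> = distr (D \<Otimes>\<^sub>M ?Q) (D \<Otimes>\<^sub>M P) (\<lambda>(d, y). (d, y 0))" by (simp only: joint)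
  also have "\<dots> = distr D D (\<lambda>d. d) \<Otimes>\<^sub>M distr ?Q P (\<lambda>y. y 0)"
    by (rule pair_measure_distr[symmetric]) (simp_all add: comp_distr P.sigma_finite_measure_axioms)
  also have "\<dots> = D \<Otimes>\<^sub>M P" by (simp only: comp_distr distr_id2)
  finally show ?thesis .
qed

lemma abs_mean_diff_le_iff:
  "\<bar>mean P g - emp_mean n d g\<bar> \<le> c \<longleftrightarrow> \<bar>\<Sum>i=1..n. (\<integral>y. g y \<partial>P) - g (d i)\<bar> \<le> real n * c"
proof -
  have "(\<Sum>i=1..n. (\<integral>y. g y \<partial>P) - g (d i)) = real n * (mean P g - emp_mean n d g)"
    using n_ge_1 by (simp add: mean_def emp_mean_def sum_subtractf right_diff_distrib)
  thus ?thesis using n_ge_1 by (simp add: abs_mult)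
qed

end

section \<open>From extended-real exponential norms to real envelopes\<close>

lemma ennreal_le_mult_exp_ennreal:
  assumes "0 < b"
  shows "u \<le> ennreal b * exp_ennreal (u / ennreal b)"
proof (cases u)
  case (real r)
  have "r / b \<le> exp (r / b)" using exp_ge_add_one_self[of "r / b"] by linarith
  hence "r \<le> b * exp (r / b)" using assms by (simp add: pos_divide_le_eq mult.commute)
  moreover have "u / ennreal b = ennreal (r / b)" using real assms by (simp add: divide_ennreal)
  ultimately show ?thesis using real assms
    by (simp add: exp_ennreal_def flip: ennreal_mult)
next
  case top
  thus ?thesis using assms by (simp add: exp_ennreal_def ennreal_top_divide ennreal_mult_top)
qed

lemma exp_le_exp_ennreal:
  assumes "0 < b" "0 \<le> m" "ennreal m \<le> u"
  shows "ennreal (exp (m / b)) \<le> exp_ennreal (u / ennreal b)"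
proof (cases u)
  case (real r)
  hence "m \<le> r" using assms by simp
  moreover have "u / ennreal b = ennreal (r / b)" using real assms by (simp add: divide_ennreal)
  ultimately show ?thesis using real assms
    by (simp add: exp_ennreal_def) (simp add: ennreal_leI divide_right_mono)
next
  case top
  thus ?thesis using assms by (simp add: exp_ennreal_def ennreal_top_divide)
qed

text \<open>\<open>b\<close> is any admissible value in the infimum defining the exponential norm
  rather than the norm itself, because that infimum may be zero or not attained.\<close>

locale enveloped_class = iid_data M P n X
  for M :: "'w measure" and P :: "'z measure" and n :: nat and X :: "nat \<Rightarrow> 'w \<Rightarrow> 'z" +
  fixes L :: "('z \<Rightarrow> real) set" and b :: real
  assumes L_meas: "\<And>g. g \<in> L \<Longrightarrow> g \<in> borel_measurable P" and b_pos: "0 < b"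
    and psi1: "(\<integral>\<^sup>+\<omega>. exp_ennreal ((MAX i\<in>{1..n}. SUP g\<in>L. ennreal \<bar>g (X i \<omega>)\<bar>) / ennreal b) \<partial>M) \<le> 2"
begin

definition env_max :: "'w \<Rightarrow> ennreal" where
  "env_max \<omega> = (MAX i\<in>{1..n}. SUP g\<in>L. ennreal \<bar>g (X i \<omega>)\<bar>)"

lemma env_max_ge: "i \<in> {1..n} \<Longrightarrow> g \<in> L \<Longrightarrow> ennreal \<bar>g (X i \<omega>)\<bar> \<le> env_max \<omega>"
  unfolding env_max_def
  by (rule order_trans[OF SUP_upper[of g L "\<lambda>g. ennreal \<bar>g (X i \<omega>)\<bar>"]]) (auto intro!: Max_ge)

lemma star_hull_meas: "h \<in> star_hull L \<Longrightarrow> h \<in> borel_measurable P"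
proof -
  assume "h \<in> star_hull L"
  then obtain \<theta> g where "g \<in> L" "h = (\<lambda>z. \<theta> * g z)" by (auto simp: star_hull_def)
  with L_meas show ?thesis by simp
qed

lemma star_hull_le_env_max:
  assumes "i \<in> {1..n}" "h \<in> star_hull L"
  shows "ennreal \<bar>h (X i \<omega>)\<bar> \<le> env_max \<omega>"
proof -
  obtain \<theta> g where \<theta>: "0 \<le> \<theta>" "\<theta> \<le> 1" and g: "g \<in> L" and h: "h = (\<lambda>z. \<theta> * g z)"
    using assms(2) by (auto simp: star_hull_def)
  have "\<bar>h (X i \<omega>)\<bar> \<le> \<bar>g (X i \<omega>)\<bar>" using \<theta> by (simp add: h abs_mult mult_left_le_one_le)
  hence "ennreal \<bar>h (X i \<omega>)\<bar> \<le> ennreal \<bar>g (X i \<omega>)\<bar>" by (rule ennreal_leI)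
  thus ?thesis using env_max_ge[OF assms(1) g] by (rule order_trans)
qed

text \<open>By t \<le> exp t the exponential moment controls the first one. The measurable minorant
  \<open>\<phi>\<close> is there because \<open>env_max\<close> may fail to be measurable; only
  monotonicity of the integral is applied to it.\<close>

lemma nn_integral_le_env:
  assumes [measurable]: "\<phi> \<in> borel_measurable P" and le: "\<And>\<omega>. \<omega> \<in> space M \<Longrightarrow> \<phi> (X 1 \<omega>) \<le> env_max \<omega>"
  shows "(\<integral>\<^sup>+y. \<phi> y \<partial>P) \<le> ennreal (2 * b)"
proof -
  have "(\<integral>\<^sup>+y. \<phi> y \<partial>P) = (\<integral>\<^sup>+y. \<phi> y \<partial>distr M P (X 1))" using distr_X[of 1] n_ge_1 by simp
  also have "\<dots> = (\<integral>\<^sup>+\<omega>. \<phi> (X 1 \<omega>) \<partial>M)"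
    by (rule nn_integral_distr) (use X_meas n_ge_1 in auto)
  finally have "(\<integral>\<^sup>+y. \<phi> y \<partial>P) / ennreal b = (\<integral>\<^sup>+\<omega>. \<phi> (X 1 \<omega>) \<partial>M) / ennreal b" by simp
  also have "\<dots> = (\<integral>\<^sup>+\<omega>. \<phi> (X 1 \<omega>) / ennreal b \<partial>M)"
  proof (rule nn_integral_divide[symmetric])
    have [measurable]: "X 1 \<in> measurable M P" using X_meas n_ge_1 by simp
    show "(\<lambda>\<omega>. \<phi> (X 1 \<omega>)) \<in> borel_measurable M" by measurable
  qed
  also have "\<dots> \<le> (\<integral>\<^sup>+\<omega>. exp_ennreal (env_max \<omega> / ennreal b) \<partial>M)"
  proof (rule nn_integral_mono)
    fix \<omega> assume "\<omega> \<in> space M"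
    from order_trans[OF le[OF this] ennreal_le_mult_exp_ennreal[OF b_pos]]
    have "\<phi> (X 1 \<omega>) \<le> ennreal b * exp_ennreal (env_max \<omega> / ennreal b)" .
    thus "\<phi> (X 1 \<omega>) / ennreal b \<le> exp_ennreal (env_max \<omega> / ennreal b)"
      using b_pos by (intro divide_le_posI_ennreal) auto
  qed
  also have "\<dots> \<le> 2" using psi1 by (simp add: env_max_def)
  finally have le2: "(\<integral>\<^sup>+y. \<phi> y \<partial>P) / ennreal b \<le> 2" .
  show ?thesis
  proof (cases "\<integral>\<^sup>+y. \<phi> y \<partial>P")
    case (real r)
    hence "ennreal (r / b) \<le> ennreal 2" using le2 b_pos by (simp add: divide_ennreal)
    hence "r / b \<le> 2" by (subst (asm) ennreal_le_iff) auto
    thus ?thesis using real b_pos by (simp add: pos_divide_le_eq)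
  next
    case top
    thus ?thesis using le2 by (simp add: ennreal_top_divide top_unique)
  qed
qed

text \<open>The maximum over a finite subclass is measurable and lies below \<open>env_max\<close>
  along the sample, so it inherits the exponential bound by monotonicity; the law of the data moves
  the bound to the product space.\<close>

lemma finite_envelope:
  assumes H: "finite H" "H \<noteq> {}" "H \<subseteq> star_hull L"
  shows "exp_envelope P {1..n} (\<lambda>y. MAX g\<in>H. \<bar>g y\<bar>) b"
proof (rule exp_envelope.intro)
  show "prob_space P" by (rule P.prob_space_axioms)
  show "finite {1..n}" "{1..n} \<noteq> {}" "0 < b" using n_ge_1 b_pos by auto
  have H_meas: "g \<in> borel_measurable P" if "g \<in> H" for g using star_hull_meas H(3) that by auto
  show U[measurable]: "(\<lambda>y. MAX g\<in>H. \<bar>g y\<bar>) \<in> borel_measurable P"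
    using H H_meas by (intro borel_measurable_Max borel_measurable_abs) auto
  show nonneg: "0 \<le> (MAX g\<in>H. \<bar>g y\<bar>)" for y
    using H by (subst Max_ge_iff) auto
  let ?m = "\<lambda>x :: nat \<Rightarrow> 'z. MAX i\<in>{1..n}. MAX g\<in>H. \<bar>g (x i)\<bar>"
  have comp: "(\<lambda>x. x i) \<in> measurable D P" if "i \<in> {1..n}" for i
    using that by (rule measurable_component_singleton)
  have m[measurable]: "?m \<in> borel_measurable D"
    using n_ge_1 by (intro borel_measurable_Max measurable_compose[OF comp U]) auto
  have "(\<integral>\<^sup>+x. ennreal (exp (?m x / b)) \<partial>D) = (\<integral>\<^sup>+x. ennreal (exp (?m x / b)) \<partial>distr M D (data n X))"
    by (simp only: distr_data)
  also have "\<dots> = (\<integral>\<^sup>+\<omega>. ennreal (exp (?m (data n X \<omega>) / b)) \<partial>M)"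
    by (rule nn_integral_distr) measurable
  also have "\<dots> \<le> (\<integral>\<^sup>+\<omega>. exp_ennreal (env_max \<omega> / ennreal b) \<partial>M)"
  proof (rule nn_integral_mono, rule exp_le_exp_ennreal[OF b_pos])
    fix \<omega>
    have "?m (data n X \<omega>) \<in> (\<lambda>i. MAX g\<in>H. \<bar>g (data n X \<omega> i)\<bar>) ` {1..n}"
      using n_ge_1 by (intro Max_in) auto
    then obtain i where i: "i \<in> {1..n}" "?m (data n X \<omega>) = (MAX g\<in>H. \<bar>g (data n X \<omega> i)\<bar>)" by (rule imageE)
    have "(MAX g\<in>H. \<bar>g (data n X \<omega> i)\<bar>) \<in> (\<lambda>g. \<bar>g (data n X \<omega> i)\<bar>) ` H"
      using H by (intro Max_in) auto
    then obtain g where g: "g \<in> H" "(MAX g\<in>H. \<bar>g (data n X \<omega> i)\<bar>) = \<bar>g (data n X \<omega> i)\<bar>" by (rule imageE)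
    have eq: "?m (data n X \<omega>) = \<bar>g (X i \<omega>)\<bar>" using i g by (simp add: data_apply)
    show "0 \<le> ?m (data n X \<omega>)" unfolding eq by simp
    show "ennreal (?m (data n X \<omega>)) \<le> env_max \<omega>"
      unfolding eq using star_hull_le_env_max[OF i(1)] g(1) H(3) by blast
  qed
  also have "\<dots> \<le> 2" using psi1 by (simp add: env_max_def)
  finally show "(\<integral>\<^sup>+x. ennreal (exp (?m x / b)) \<partial>D) \<le> 2" .
qed

lemma abs_dev_measurable:
  assumes "finite H" "H \<noteq> {}" "H \<subseteq> star_hull L"
  shows "abs_dev P H {1..n} \<in> borel_measurable D"
proof -
  interpret exp_envelope P "{1..n}" "\<lambda>y. MAX g\<in>H. \<bar>g y\<bar>" b by (rule finite_envelope[OF assms])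
  show ?thesis
  proof (rule abs_dev_meas[OF assms(1,2)])
    fix g assume g: "g \<in> H"
    thus "g \<in> borel_measurable P" using star_hull_meas assms(3) by auto
    show "\<bar>g y\<bar> \<le> (MAX g\<in>H. \<bar>g y\<bar>)" for y using assms(1) g by (intro Max_ge) auto
  qed
qed

text \<open>An upper bound \<open>T\<close> in place of the expectation makes the threshold
  independent of the subclass, as the passage to countable classes requires.\<close>

lemma finite_class_deviation:
  assumes H: "finite H" "H \<noteq> {}" "H \<subseteq> star_hull L"
    and var: "\<And>g. g \<in> H \<Longrightarrow> (\<integral>y. (g y)\<^sup>2 \<partial>P) \<le> s2" and \<tau>: "4 * b \<le> \<tau>"
    and T: "(\<integral>x. abs_dev P H {1..n} x \<partial>D) \<le> T"
  shows "measure D {x\<in>space D. abs_dev P H {1..n} x >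
      2 * T + 24 * b + b * t + real n * s2 / (2 * \<tau>) + 8 * \<tau> * t} \<le> 2 * exp (- t)"
proof -
  interpret exp_envelope P "{1..n}" "\<lambda>y. MAX g\<in>H. \<bar>g y\<bar>" b by (rule finite_envelope[OF H])
  have le: "\<bar>g y\<bar> \<le> (MAX g\<in>H. \<bar>g y\<bar>)" if "g \<in> H" for g y using H that by (intro Max_ge) auto
  have H_meas: "g \<in> borel_measurable P" if "g \<in> H" for g using star_hull_meas H(3) that by auto
  note [measurable] = abs_dev_measurable[OF H]
  let ?E = "\<integral>x. abs_dev P H {1..n} x \<partial>D"
  have "measure D {x\<in>space D. abs_dev P H {1..n} x > 2 * T + 24 * b + b * t + real n * s2 / (2 * \<tau>) + 8 * \<tau> * t}
    \<le> measure D {x\<in>space D. abs_dev P H {1..n} x > 2 * ?E + 24 * b + b * t + real n * s2 / (2 * \<tau>) + 8 * \<tau> * t}"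
  proof (rule D.finite_measure_mono)
    show "{x\<in>space D. abs_dev P H {1..n} x > 2 * T + 24 * b + b * t + real n * s2 / (2 * \<tau>) + 8 * \<tau> * t}
      \<subseteq> {x\<in>space D. abs_dev P H {1..n} x > 2 * ?E + 24 * b + b * t + real n * s2 / (2 * \<tau>) + 8 * \<tau> * t}"
    proof (intro Collect_mono impI, elim conjE, intro conjI)
      fix x assume "abs_dev P H {1..n} x > 2 * T + 24 * b + b * t + real n * s2 / (2 * \<tau>) + 8 * \<tau> * t"
      thus "abs_dev P H {1..n} x > 2 * ?E + 24 * b + b * t + real n * s2 / (2 * \<tau>) + 8 * \<tau> * t"
        using T by linarith
    qed
  qed measurable
  also have "\<dots> = measure D {x\<in>space D. abs_dev P H {1..n} x > 2 * ?E + 24 * b + b * t + real (card {1..n}) * s2 / (2 * \<tau>) + 8 * \<tau> * t}"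
    by (simp only: card_atLeastAtMost diff_Suc_1)
  also have "\<dots> \<le> 2 * exp (- t)"
  proof (rule abs_dev_deviation[OF H(1,2)])
    fix g assume g: "g \<in> H"
    show "g \<in> borel_measurable P" by (rule H_meas[OF g])
    show "\<bar>g y\<bar> \<le> (MAX g\<in>H. \<bar>g y\<bar>)" for y by (rule le[OF g])
    show "(\<integral>y. (g y)\<^sup>2 \<partial>P) \<le> s2" by (rule var[OF g])
  qed (rule \<tau>)
  finally show ?thesis .
qed

text \<open>No union bound is paid: finite subclasses increase to \<open>G\<close> under one common
  threshold, so the exceptional events increase and continuity from below preserves
  \<open>2 * exp (- t)\<close>.\<close>

lemma countable_class_deviation:
  assumes G: "countable G" "G \<subseteq> star_hull L"
    and var: "\<And>g. g \<in> G \<Longrightarrow> (\<integral>y. (g y)\<^sup>2 \<partial>P) \<le> s2" and \<tau>: "4 * b \<le> \<tau>"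
    and T: "\<And>H. finite H \<Longrightarrow> H \<noteq> {} \<Longrightarrow> H \<subseteq> G \<Longrightarrow> (\<integral>x. abs_dev P H {1..n} x \<partial>D) \<le> T"
  shows "\<exists>E\<in>sets D. measure D E \<ge> 1 - 2 * exp (- t) \<and> (\<forall>x\<in>E. \<forall>g\<in>G.
    \<bar>\<Sum>i=1..n. (\<integral>y. g y \<partial>P) - g (x i)\<bar> \<le> 2 * T + 24 * b + b * t + real n * s2 / (2 * \<tau>) + 8 * \<tau> * t)"
proof (cases "G = {}")
  case True
  thus ?thesis using D.prob_space by (intro bexI[of _ "space D"]) auto
next
  case False
  define c where "c = 2 * T + 24 * b + b * t + real n * s2 / (2 * \<tau>) + 8 * \<tau> * t"
  define H where "H = (\<lambda>m. from_nat_into G ` {..m::nat})"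
  have H: "finite (H m)" "H m \<noteq> {}" "H m \<subseteq> G" for m
    using from_nat_into[OF False] by (auto simp: H_def)
  have H': "H m \<subseteq> star_hull L" for m using H(3) G(2) by blast
  define A where "A = (\<lambda>m. {x\<in>space D. abs_dev P (H m) {1..n} x > c})"
  have A_meas: "A m \<in> sets D" for m
  proof -
    note [measurable] = abs_dev_measurable[OF H(1,2) H', of m]
    show ?thesis unfolding A_def by measurable
  qed
  have A_le: "measure D (A m) \<le> 2 * exp (- t)" for m
    unfolding A_def c_def
  proof (rule finite_class_deviation[OF H(1,2) H'])
    fix g assume "g \<in> H m"
    thus "(\<integral>y. (g y)\<^sup>2 \<partial>P) \<le> s2" using H(3) by (intro var) auto
  next
    show "(\<integral>x. abs_dev P (H m) {1..n} x \<partial>D) \<le> T" by (rule T[OF H])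
  qed (rule \<tau>)
  have "incseq A"
  proof (rule incseq_SucI)
    fix m
    have "abs_dev P (H m) {1..n} x \<le> abs_dev P (H (Suc m)) {1..n} x" for x
      unfolding abs_dev_def by (rule Max_mono) (use H in \<open>auto simp: H_def\<close>)
    thus "A m \<subseteq> A (Suc m)" unfolding A_def by (auto intro: less_le_trans)
  qed
  hence "(\<lambda>m. measure D (A m)) \<longlonglongrightarrow> measure D (\<Union>m. A m)"
    using A_meas by (intro D.finite_Lim_measure_incseq) auto
  hence le: "measure D (\<Union>m. A m) \<le> 2 * exp (- t)" by (rule LIMSEQ_le_const2) (use A_le in blast)
  show ?thesis
  proof (intro bexI[of _ "space D - (\<Union>m. A m)"] conjI ballI)
    have U: "(\<Union>m. A m) \<in> sets D" using A_meas by auto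
    thus "space D - (\<Union>m. A m) \<in> sets D" by auto
    show "1 - 2 * exp (- t) \<le> measure D (space D - (\<Union>m. A m))" using D.prob_compl[OF U] le by linarith
    fix x g assume x: "x \<in> space D - (\<Union>m. A m)" and g: "g \<in> G"
    obtain m where m: "g = from_nat_into G m" using from_nat_into_surj[OF G(1) g] by auto
    have "\<bar>\<Sum>i=1..n. (\<integral>y. g y \<partial>P) - g (x i)\<bar> \<le> abs_dev P (H m) {1..n} x"
      unfolding abs_dev_def using H(1)[of m] m by (intro Max_ge) (auto simp: H_def)
    also have "\<dots> \<le> c" using x by (auto simp: A_def not_less)
    finally show "\<bar>\<Sum>i=1..n. (\<integral>y. g y \<partial>P) - g (x i)\<bar> \<le> 2 * T + 24 * b + b * t + real n * s2 / (2 * \<tau>) + 8 * \<tau> * t"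
      by (simp add: c_def)
  qed
qed

end

section \<open>Localized classes\<close>

lemma mean_scale: "mean P (\<lambda>z. c * g z) = c * mean P g"
  by (simp add: mean_def)

lemma emp_mean_scale: "emp_mean n d (\<lambda>z. c * g z) = c * emp_mean n d g"
  by (simp add: emp_mean_def flip: sum_distrib_left)

context enveloped_class
begin

lemma integrable_star_hull:
  assumes "h \<in> star_hull L"
  shows "integrable P h" "integrable P (\<lambda>y. (h y)\<^sup>2)"
proof -
  interpret exp_envelope P "{1..n}" "\<lambda>y. MAX g\<in>{h}. \<bar>g y\<bar>" b
    by (rule finite_envelope) (use assms in auto)
  have "\<bar>h y\<bar> \<le> (MAX g\<in>{h}. \<bar>g y\<bar>)" for y by simp
  from integrable_enveloped[OF star_hull_meas[OF assms] this]
  show "integrable P h" "integrable P (\<lambda>y. (h y)\<^sup>2)" .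
qed

lemma L_subset_star_hull: "L \<subseteq> star_hull L"
proof
  fix g assume "g \<in> L"
  thus "g \<in> star_hull L" unfolding star_hull_def by (intro CollectI exI[of _ 1] exI[of _ g]) auto
qed

lemma mean_sq_le:
  assumes "g \<in> L"
  shows "(mean P g)\<^sup>2 \<le> mean P (\<lambda>y. (g y)\<^sup>2)"
proof -
  have "g \<in> star_hull L" using assms L_subset_star_hull by auto
  note int = integrable_star_hull[OF this]
  have "0 \<le> (\<integral>y. (g y - mean P g)\<^sup>2 \<partial>P)" by (rule Bochner_Integration.integral_nonneg) simp
  also have "\<dots> = mean P (\<lambda>y. (g y)\<^sup>2) - (mean P g)\<^sup>2"
    using P.variance_eq[OF int] by (simp add: mean_def)
  finally show ?thesis by simp
qed

text \<open>Pointwise limits carry over the empirical part; the means need dominated convergence.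
  The dominating function is the supremum over \<open>G0\<close>, measurable by countability and
  integrable by \<open>nn_integral_le_env\<close>.\<close>

lemma separable_sum_bound:
  assumes G: "G0 \<subseteq> G" "G \<subseteq> star_hull L" "countable G0"
    and lim: "\<And>g. g \<in> G \<Longrightarrow> \<exists>s. (\<forall>k. s k \<in> G0) \<and> (\<forall>z\<in>space P. (\<lambda>k. s k z) \<longlonglongrightarrow> g z)"
    and x: "x \<in> space D" and bnd: "\<And>g. g \<in> G0 \<Longrightarrow> \<bar>\<Sum>i=1..n. (\<integral>y. g y \<partial>P) - g (x i)\<bar> \<le> c"
    and g: "g \<in> G"
  shows "\<bar>\<Sum>i=1..n. (\<integral>y. g y \<partial>P) - g (x i)\<bar> \<le> c"
proof -
  obtain s where s: "\<And>k. s k \<in> G0" and lim_s: "\<And>z. z \<in> space P \<Longrightarrow> (\<lambda>k. s k z) \<longlonglongrightarrow> g z"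
    using lim[OF g] by auto
  define W where "W = (\<lambda>y. SUP g\<in>G0. ennreal \<bar>g y\<bar>)"
  have G0_meas: "h \<in> borel_measurable P" if "h \<in> G0" for h using star_hull_meas G that by blast
  have W_meas[measurable]: "W \<in> borel_measurable P"
    unfolding W_def using G0_meas by (intro borel_measurable_SUP G(3)) measurable
  have "(\<integral>\<^sup>+y. W y \<partial>P) \<le> ennreal (2 * b)"
  proof (rule nn_integral_le_env[OF W_meas])
    fix \<omega>
    show "W (X 1 \<omega>) \<le> env_max \<omega>"
      unfolding W_def
    proof (rule SUP_least)
      fix h assume "h \<in> G0"
      hence "h \<in> star_hull L" using G by auto
      thus "ennreal \<bar>h (X 1 \<omega>)\<bar> \<le> env_max \<omega>" using n_ge_1 by (intro star_hull_le_env_max) auto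
    qed
  qed
  hence W_fin: "(\<integral>\<^sup>+y. W y \<partial>P) < \<infinity>" by (rule le_less_trans) simp
  \<comment> \<open>\<open>W\<close> may be infinite on a null set, where \<open>enn2real\<close>
    returns 0; the domination therefore holds only almost everywhere.\<close>
  hence AE_W: "AE y in P. W y \<noteq> \<infinity>" by (intro nn_integral_noteq_infinite) auto
  have int_w: "integrable P (\<lambda>y. enn2real (W y))"
  proof (rule integrableI_nonneg)
    have "(\<integral>\<^sup>+y. ennreal (enn2real (W y)) \<partial>P) = (\<integral>\<^sup>+y. W y \<partial>P)"
      using AE_W by (intro nn_integral_cong_AE) (auto simp: less_top)
    thus "(\<integral>\<^sup>+y. ennreal (enn2real (W y)) \<partial>P) < \<infinity>" using W_fin by simp
  qed auto
  have means: "(\<lambda>k. \<integral>y. s k y \<partial>P) \<longlonglongrightarrow> (\<integral>y. g y \<partial>P)"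
  proof (rule integral_dominated_convergence[OF _ _ int_w])
    show "g \<in> borel_measurable P" using star_hull_meas G g by blast
    show "s k \<in> borel_measurable P" for k by (rule G0_meas[OF s])
    show "AE y in P. (\<lambda>k. s k y) \<longlonglongrightarrow> g y" by (rule AE_I2) (rule lim_s)
    show "AE y in P. norm (s k y) \<le> enn2real (W y)" for k
      using AE_W
    proof eventually_elim
      case (elim y)
      have "ennreal \<bar>s k y\<bar> \<le> W y" unfolding W_def by (rule SUP_upper[OF s])
      thus ?case using elim by (cases "W y") auto
    qed
  qed
  have "(\<lambda>k. \<bar>\<Sum>i=1..n. (\<integral>y. s k y \<partial>P) - s k (x i)\<bar>) \<longlonglongrightarrow> \<bar>\<Sum>i=1..n. (\<integral>y. g y \<partial>P) - g (x i)\<bar>"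
  proof (intro tendsto_intros means lim_s)
    fix i assume "i \<in> {1..n}"
    thus "x i \<in> space P" using x by (auto simp: space_PiM)
  qed
  thus ?thesis by (rule LIMSEQ_le_const2) (use bnd s in blast)
qed

text \<open>Multiplication by \<open>lam / lam0\<close> maps level \<open>lam0\<close> into level
  \<open>lam\<close> because the hull is star-shaped, and deviations scale along. The factor
  \<open>real n\<close> reflects that \<open>abs_dev\<close> is unnormalised.\<close>

lemma abs_dev_level_mean:
  assumes lam: "0 < lam" "lam \<le> lam0" and e: "0 < \<epsilon>"
    and Edev: "(\<integral>\<^sup>+\<omega>. emp_dev P n (data n X \<omega>) (star_hull_level P L lam) \<partial>M) \<le> ennreal ((\<epsilon> / 4) * lam)"
    and H: "finite H" "H \<noteq> {}" "H \<subseteq> star_hull_level P L lam0"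
  shows "(\<integral>x. abs_dev P H {1..n} x \<partial>D) \<le> real n * \<epsilon> * lam0 / 4"
proof -
  define r where "r = lam / lam0 / real n"
  have lam0: "0 < lam0" using lam by linarith
  have r: "0 < r" using lam lam0 n_ge_1 by (simp add: r_def)
  have H': "H \<subseteq> star_hull L" using H(3) by (auto simp: star_hull_level_def)
  note [measurable] = abs_dev_measurable[OF H(1,2) H']
  have "(\<integral>\<^sup>+x. ennreal (r * abs_dev P H {1..n} x) \<partial>D) = (\<integral>\<^sup>+x. ennreal (r * abs_dev P H {1..n} x) \<partial>distr M D (data n X))"
    by (simp only: distr_data)
  also have "\<dots> = (\<integral>\<^sup>+\<omega>. ennreal (r * abs_dev P H {1..n} (data n X \<omega>)) \<partial>M)"
    by (rule nn_integral_distr) measurable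
  also have "\<dots> \<le> (\<integral>\<^sup>+\<omega>. emp_dev P n (data n X \<omega>) (star_hull_level P L lam) \<partial>M)"
  proof (rule nn_integral_mono)
    fix \<omega>
    let ?d = "data n X \<omega>"
    have "abs_dev P H {1..n} ?d \<in> (\<lambda>g. \<bar>\<Sum>i=1..n. (\<integral>y. g y \<partial>P) - g (?d i)\<bar>) ` H"
      unfolding abs_dev_def using H by (intro Max_in) auto
    then obtain g where g: "g \<in> H" "abs_dev P H {1..n} ?d = \<bar>\<Sum>i=1..n. (\<integral>y. g y \<partial>P) - g (?d i)\<bar>" by (rule imageE)
    define h where "h = (\<lambda>z. lam / lam0 * g z)"
    have "g \<in> star_hull L" and mg: "mean P g \<le> lam0" using g(1) H(3) by (auto simp: star_hull_level_def)
    then obtain \<theta> f where f: "0 \<le> \<theta>" "\<theta> \<le> 1" "f \<in> L" "g = (\<lambda>z. \<theta> * f z)" by (auto simp: star_hull_def)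
    have "h \<in> star_hull L"
      unfolding star_hull_def
    proof (intro CollectI exI conjI)
      show "h = (\<lambda>z. (lam / lam0 * \<theta>) * f z)" by (simp add: h_def f mult.assoc)
      show "0 \<le> lam / lam0 * \<theta>" using lam lam0 f by simp
      show "lam / lam0 * \<theta> \<le> 1" using lam lam0 f by (intro mult_le_one) auto
      show "f \<in> L" by fact
    qed
    moreover have "mean P h \<le> lam"
    proof -
      have "mean P h = lam / lam0 * mean P g" unfolding h_def by (rule mean_scale)
      also have "\<dots> \<le> lam / lam0 * lam0" using mg lam lam0 by (intro mult_left_mono) auto
      finally show ?thesis using lam0 by simp
    qed
    ultimately have h: "h \<in> star_hull_level P L lam" by (simp add: star_hull_level_def)
    have "(\<Sum>i=1..n. (\<integral>y. g y \<partial>P) - g (?d i)) = real n * (mean P g - emp_mean n ?d g)"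
      using n_ge_1 by (simp add: mean_def emp_mean_def sum_subtractf right_diff_distrib)
    hence "abs_dev P H {1..n} ?d = real n * \<bar>mean P g - emp_mean n ?d g\<bar>"
      unfolding g(2) by (simp only: abs_mult abs_of_nat)
    hence "r * abs_dev P H {1..n} ?d = lam / lam0 * \<bar>mean P g - emp_mean n ?d g\<bar>"
      using n_ge_1 by (simp only: r_def) simp
    also have "\<dots> = \<bar>lam / lam0 * (mean P g - emp_mean n ?d g)\<bar>" using lam lam0 by (simp add: abs_mult)
    also have "\<dots> = \<bar>mean P h - emp_mean n ?d h\<bar>"
      unfolding h_def mean_scale emp_mean_scale by (simp only: right_diff_distrib)
    finally have "ennreal (r * abs_dev P H {1..n} ?d) = ennreal \<bar>mean P h - emp_mean n ?d h\<bar>" by simp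
    also have "\<dots> \<le> emp_dev P n ?d (star_hull_level P L lam)" unfolding emp_dev_def by (rule SUP_upper[OF h])
    finally show "ennreal (r * abs_dev P H {1..n} ?d) \<le> emp_dev P n ?d (star_hull_level P L lam)" .
  qed
  also have "\<dots> \<le> ennreal ((\<epsilon> / 4) * lam)" by (rule Edev)
  finally have "(\<integral>x. r * abs_dev P H {1..n} x \<partial>D) \<le> \<epsilon> / 4 * lam"
    using e lam by (intro integral_real_bounded) auto
  hence "r * (\<integral>x. abs_dev P H {1..n} x \<partial>D) \<le> \<epsilon> / 4 * lam" by simp
  also have "\<dots> = r * (real n * \<epsilon> * lam0 / 4)" using lam0 n_ge_1 by (simp add: r_def)
  finally show ?thesis using r by (simp only: mult_le_cancel_left_pos)
qed

text \<open>A bound at one level becomes relative for all losses: if the mean of \<open>g\<close>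
  exceeds \<open>lam0\<close>, shrinking \<open>g\<close> by \<open>lam0 / mean P g\<close> puts it
  on the level, and undoing this replaces \<open>lam0\<close> by \<open>mean P g\<close>. Hence the
  maximum on the right.\<close>

lemma level_deviation:
  assumes B: "0 \<le> B" and var: "\<And>g. g \<in> L \<Longrightarrow> mean P (\<lambda>z. (g z)\<^sup>2) \<le> B * mean P g + B\<^sup>2 / real n"
    and lam: "0 < lam" "lam \<le> lam0" and e: "0 < \<epsilon>" "\<epsilon> < 1 / 2"
    and Edev: "(\<integral>\<^sup>+\<omega>. emp_dev P n (data n X \<omega>) (star_hull_level P L lam) \<partial>M) \<le> ennreal ((\<epsilon> / 4) * lam)"
    and sep: "separable_class P (star_hull_level P L lam0)"
    and t: "1 \<le> t" and bt: "(b + B / \<epsilon>) * t \<le> real n * \<epsilon> * lam0 / 480"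
  shows "\<exists>E\<in>sets M. measure M E \<ge> 1 - 2 * exp (- t) \<and>
    (\<forall>\<omega>\<in>E. \<forall>g\<in>L. \<bar>mean P g - emp_mean n (data n X \<omega>) g\<bar> \<le> 3 / 4 * \<epsilon> * max (mean P g) lam0)"
proof -
  define G where "G = star_hull_level P L lam0"
  have lam0: "0 < lam0" using lam by linarith
  have G_sub: "G \<subseteq> star_hull L" by (auto simp: G_def star_hull_level_def)
  obtain G0 where G0: "G0 \<subseteq> G" "countable G0"
    and lim: "\<And>g. g \<in> G \<Longrightarrow> \<exists>s. (\<forall>k. s k \<in> G0) \<and> (\<forall>z\<in>space P. (\<lambda>k. s k z) \<longlonglongrightarrow> g z)"
    using sep unfolding separable_class_def G_def[symmetric] by blast
  \<comment> \<open>Truncation demands \<open>4 * b\<close>. The part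
    \<open>4 * B / \<epsilon>\<close> ensures \<open>B \<le> \<epsilon> * \<tau> / 4\<close>, which
    brings the main variance term down to \<open>n * \<epsilon> * lam0 / 8\<close>.\<close>
  define \<tau> where "\<tau> = 4 * (b + B / \<epsilon>)"
  define s2 where "s2 = B * lam0 + B\<^sup>2 / real n"
  define T where "T = real n * \<epsilon> * lam0 / 4"
  define c where "c = 2 * T + 24 * b + b * t + real n * s2 / (2 * \<tau>) + 8 * \<tau> * t"
  have Be: "0 \<le> B / \<epsilon>" using B e by simp
  have \<tau>: "4 * b \<le> \<tau>" "0 < \<tau>" using Be b_pos by (auto simp: \<tau>_def)
  \<comment> \<open>Shrinking by \<open>\<theta>\<close> turns
    \<open>\<theta>\<^sup>2 * B * mean P f\<close> into \<open>\<theta> * B * mean P g\<close>, so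
    the variance condition survives on the hull, with \<open>mean P g\<close> bounded by
    \<open>lam0\<close>.\<close>
  have G_var: "(\<integral>y. (g y)\<^sup>2 \<partial>P) \<le> s2" if "g \<in> G" for g
  proof -
    have "g \<in> star_hull L" and mg: "mean P g \<le> lam0" using that by (auto simp: G_def star_hull_level_def)
    then obtain \<theta> f where f: "0 \<le> \<theta>" "\<theta> \<le> 1" "f \<in> L" "g = (\<lambda>z. \<theta> * f z)" by (auto simp: star_hull_def)
    have "(\<integral>y. (g y)\<^sup>2 \<partial>P) = \<theta>\<^sup>2 * mean P (\<lambda>z. (f z)\<^sup>2)"
      unfolding mean_scale[symmetric] by (simp add: f mean_def power_mult_distrib)
    also have "\<dots> \<le> \<theta>\<^sup>2 * (B * mean P f + B\<^sup>2 / real n)" by (rule mult_left_mono[OF var[OF f(3)]]) simp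
    also have "\<dots> = \<theta> * (B * mean P g) + \<theta>\<^sup>2 * (B\<^sup>2 / real n)"
      unfolding f(4) mean_scale by (simp add: power2_eq_square algebra_simps)
    also have "\<dots> \<le> B * lam0 + 1 * (B\<^sup>2 / real n)"
    proof (rule add_mono)
      have "\<theta> * (B * mean P g) \<le> \<theta> * (B * lam0)" using mg B f by (intro mult_left_mono) auto
      also have "\<dots> \<le> 1 * (B * lam0)" using B f lam0 by (intro mult_right_mono) auto
      finally show "\<theta> * (B * mean P g) \<le> B * lam0" by simp
      have "\<theta>\<^sup>2 \<le> 1" using f by (simp add: power_le_one)
      thus "\<theta>\<^sup>2 * (B\<^sup>2 / real n) \<le> 1 * (B\<^sup>2 / real n)" by (rule mult_right_mono) simp
    qed
    finally show ?thesis by (simp add: s2_def)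
  qed
  \<comment> \<open>Once 1/2 and 1/8 of \<open>n * \<epsilon> * lam0\<close> are spent on
    expectation and variance, the other terms are at most 57 times
    \<open>(b + B / \<epsilon>) * t\<close>, and 57/480 is below the 1/8 that is left.\<close>
  have c_le: "c \<le> real n * (3 / 4 * \<epsilon> * lam0)"
  proof -
    have B\<tau>: "B \<le> \<epsilon> * \<tau> / 4" using b_pos e by (simp add: \<tau>_def field_simps)
    have "real n * s2 = B * (real n * lam0 + B)"
      using n_ge_1 by (simp add: s2_def field_simps power2_eq_square)
    also have "\<dots> \<le> \<epsilon> * \<tau> / 4 * (real n * lam0 + B)"
      using B\<tau> B lam0 by (intro mult_right_mono) auto
    finally have "real n * s2 / (2 * \<tau>) \<le> \<epsilon> * \<tau> / 4 * (real n * lam0 + B) / (2 * \<tau>)"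
      using \<tau> by (intro divide_right_mono) auto
    also have "\<dots> = \<epsilon> * (real n * lam0 + B) / 8" using \<tau> by (simp add: field_simps)
    also have "\<dots> = real n * \<epsilon> * lam0 / 8 + \<epsilon> * B / 8" by (simp add: algebra_simps)
    finally have 1: "real n * s2 / (2 * \<tau>) \<le> real n * \<epsilon> * lam0 / 8 + \<epsilon> * B / 8" .
    have "\<epsilon> * B \<le> 1 * B" using e B by (intro mult_right_mono) auto
    also have "\<dots> \<le> B / \<epsilon>" using e B mult_left_mono[of \<epsilon> 1 B] by (simp add: pos_le_divide_eq)
    finally have 2: "\<epsilon> * B \<le> B / \<epsilon>" .
    have 3: "b \<le> b * t" using t b_pos by simp
    have 4: "B / \<epsilon> \<le> B / \<epsilon> * t" using Be t mult_left_mono[of 1 t "B / \<epsilon>"] by simp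
    have 5: "b * t + B / \<epsilon> * t \<le> real n * \<epsilon> * lam0 / 480" using bt by (simp add: distrib_right)
    have 6: "8 * \<tau> * t = 32 * (b * t) + 32 * (B / \<epsilon> * t)" by (simp add: \<tau>_def algebra_simps)
    have 7: "real n * (3 / 4 * \<epsilon> * lam0) = 3 / 4 * (real n * \<epsilon> * lam0)" by simp
    have "0 \<le> b * t" using b_pos t by simp
    moreover have "0 \<le> B / \<epsilon> * t" by (rule mult_nonneg_nonneg[OF Be]) (use t in linarith)
    ultimately show ?thesis unfolding c_def T_def 6 7 using 1 2 3 4 5 by linarith
  qed
  have T_le: "(\<integral>x. abs_dev P H {1..n} x \<partial>D) \<le> T" if "finite H" "H \<noteq> {}" "H \<subseteq> G0" for H
    unfolding T_def
    by (rule abs_dev_level_mean[OF lam e(1) Edev that(1,2)]) (use that(3) G0(1) in \<open>auto simp: G_def\<close>)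
  obtain E where E: "E \<in> sets D" "measure D E \<ge> 1 - 2 * exp (- t)"
    and dev: "\<And>x g. x \<in> E \<Longrightarrow> g \<in> G0 \<Longrightarrow> \<bar>\<Sum>i=1..n. (\<integral>y. g y \<partial>P) - g (x i)\<bar> \<le> c"
  proof -
    have "\<exists>E\<in>sets D. measure D E \<ge> 1 - 2 * exp (- t) \<and> (\<forall>x\<in>E. \<forall>g\<in>G0.
      \<bar>\<Sum>i=1..n. (\<integral>y. g y \<partial>P) - g (x i)\<bar> \<le> c)"
      unfolding c_def
    proof (rule countable_class_deviation[OF G0(2) _ _ \<tau>(1)])
      show "G0 \<subseteq> star_hull L" using G0 G_sub by blast
      show "(\<integral>y. (g y)\<^sup>2 \<partial>P) \<le> s2" if "g \<in> G0" for g using G_var that G0 by blast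
    qed (rule T_le)
    thus ?thesis using that by blast
  qed
  define E' where "E' = data n X -` E \<inter> space M"
  show ?thesis
  proof (intro bexI[of _ E'] conjI ballI)
    show "E' \<in> sets M" unfolding E'_def by (rule measurable_sets[OF data_meas E(1)])
    have "measure M E' = measure (distr M D (data n X)) E"
      unfolding E'_def by (rule measure_distr[symmetric]) (use E in measurable)
    thus "1 - 2 * exp (- t) \<le> measure M E'" using E(2) by (simp only: distr_data)
    fix \<omega> g assume \<omega>: "\<omega> \<in> E'" and g: "g \<in> L"
    let ?d = "data n X \<omega>"
    have d: "?d \<in> E" "?d \<in> space D" using \<omega> data_in_space by (auto simp: E'_def)
    have G_dev: "\<bar>mean P h - emp_mean n ?d h\<bar> \<le> 3 / 4 * \<epsilon> * lam0" if "h \<in> G" for h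
      unfolding abs_mean_diff_le_iff
      using separable_sum_bound[OF G0(1) G_sub G0(2) lim d(2) dev[OF d(1)] that] c_le by (rule order_trans)
    show "\<bar>mean P g - emp_mean n ?d g\<bar> \<le> 3 / 4 * \<epsilon> * max (mean P g) lam0"
    proof (cases "mean P g \<le> lam0")
      case True
      hence "g \<in> G" using g L_subset_star_hull by (auto simp: G_def star_hull_level_def)
      from G_dev[OF this] True show ?thesis by simp
    next
      case False
      define \<theta> where "\<theta> = lam0 / mean P g"
      have \<theta>: "0 < \<theta>" "\<theta> \<le> 1" using False lam0 by (auto simp: \<theta>_def)
      define h where "h = (\<lambda>z. \<theta> * g z)"
      have "h \<in> star_hull L" unfolding star_hull_def h_def using \<theta> g by (intro CollectI exI[of _ \<theta>] exI[of _ g]) auto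
      moreover have "mean P h = lam0" unfolding h_def mean_scale using False lam0 by (simp add: \<theta>_def)
      ultimately have "h \<in> G" by (simp add: G_def star_hull_level_def)
      from G_dev[OF this] have "\<bar>\<theta> * mean P g - \<theta> * emp_mean n ?d g\<bar> \<le> 3 / 4 * \<epsilon> * lam0"
        unfolding h_def mean_scale emp_mean_scale .
      also have "\<theta> * mean P g - \<theta> * emp_mean n ?d g = \<theta> * (mean P g - emp_mean n ?d g)"
        by (simp only: right_diff_distrib)
      finally have "\<theta> * \<bar>mean P g - emp_mean n ?d g\<bar> \<le> 3 / 4 * \<epsilon> * lam0" using \<theta> by (simp add: abs_mult)
      also have "\<dots> = \<theta> * (3 / 4 * \<epsilon> * mean P g)" using False lam0 by (simp add: \<theta>_def)
      finally have "\<bar>mean P g - emp_mean n ?d g\<bar> \<le> 3 / 4 * \<epsilon> * mean P g"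
        using \<theta> by (simp only: mult_le_cancel_left_pos)
      thus ?thesis using False by simp
    qed
  qed
qed

section \<open>The conditional risk given the data\<close>

lemma nn_integral_L_le:
  assumes "g \<in> L"
  shows "(\<integral>\<^sup>+y. ennreal \<bar>g y\<bar> \<partial>P) \<le> ennreal (2 * b)"
proof (rule nn_integral_le_env)
  note [measurable] = L_meas[OF assms]
  show "(\<lambda>y. ennreal \<bar>g y\<bar>) \<in> borel_measurable P" by measurable
  show "ennreal \<bar>g (X 1 \<omega>)\<bar> \<le> env_max \<omega>" for \<omega> using n_ge_1 assms by (intro env_max_ge) auto
qed

text \<open>Data and test point have a product law, so integrating out the test point by Fubini
  meets the characterization of the conditional expectation.\<close>

lemma cond_risk_eq:
  assumes \<phi>_meas: "(\<lambda>(d, z). loss (fhat d) z) \<in> borel_measurable (D \<Otimes>\<^sub>M P)"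
    and fhat: "AE \<omega> in M. loss (fhat (data n X \<omega>)) \<in> L"
  shows "AE \<omega> in M. cond_risk M P n X loss fhat \<omega> = mean P (loss (fhat (data n X \<omega>)))"
proof -
  interpret DP: pair_sigma_finite D P ..
  define \<phi> where "\<phi> = (\<lambda>(d, z). loss (fhat d) z)"
  note \<phi>_meas'[measurable] = \<phi>_meas[folded \<phi>_def]
  define g where "g = (\<lambda>d. \<integral>z. \<phi> (d, z) \<partial>P)"
  have g_meas[measurable]: "g \<in> borel_measurable D" unfolding g_def by measurable
  have X0[measurable]: "X 0 \<in> measurable M P" by (rule X_meas) simp
  have pair[measurable]: "(\<lambda>\<omega>. (data n X \<omega>, X 0 \<omega>)) \<in> measurable M (D \<Otimes>\<^sub>M P)" by measurable
  \<comment> \<open>Integrability on the product: for almost every sample the selected loss lies in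
    \<open>L\<close>, whose members have absolute first moments at most
    \<open>2 * b\<close>.\<close>
  define h where "h = (\<lambda>d. \<integral>\<^sup>+z. ennreal \<bar>\<phi> (d, z)\<bar> \<partial>P)"
  have h_meas[measurable]: "h \<in> borel_measurable D" unfolding h_def by measurable
  have "AE \<omega> in M. h (data n X \<omega>) \<le> ennreal (2 * b)"
    using fhat by eventually_elim (simp add: h_def \<phi>_def nn_integral_L_le)
  hence "(\<integral>\<^sup>+\<omega>. h (data n X \<omega>) \<partial>M) \<le> (\<integral>\<^sup>+\<omega>. ennreal (2 * b) \<partial>M)" by (rule nn_integral_mono_AE)
  also have "\<dots> < \<infinity>" by (simp add: M.emeasure_space_1)
  finally have "(\<integral>\<^sup>+\<omega>. h (data n X \<omega>) \<partial>M) < \<infinity>" .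
  moreover have "(\<integral>\<^sup>+\<omega>. h (data n X \<omega>) \<partial>M) = (\<integral>\<^sup>+d. h d \<partial>distr M D (data n X))"
    by (rule nn_integral_distr[symmetric]) measurable
  moreover have "(\<integral>\<^sup>+d. h d \<partial>D) = (\<integral>\<^sup>+p. ennreal \<bar>\<phi> p\<bar> \<partial>(D \<Otimes>\<^sub>M P))"
    unfolding h_def by (rule P.nn_integral_fst) measurable
  ultimately have "(\<integral>\<^sup>+p. ennreal \<bar>\<phi> p\<bar> \<partial>(D \<Otimes>\<^sub>M P)) < \<infinity>" by (simp only: distr_data)
  hence int: "integrable (D \<Otimes>\<^sub>M P) \<phi>"
    by (intro integrableI_bounded[OF \<phi>_meas']) (simp only: real_norm_def)
  have int_g: "integrable D g" unfolding g_def by (rule DP.integrable_fst'[OF int])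
  define F where "F = vimage_algebra (space M) (data n X) D"
  have sub: "subalgebra M F"
    unfolding subalgebra_def F_def
    by (intro conjI sets_image_in_sets[OF refl data_meas]) simp
  interpret F: finite_measure_subalgebra M F by unfold_locales (rule sub)
  have "AE \<omega> in M. real_cond_exp M F (\<lambda>\<omega>. \<phi> (data n X \<omega>, X 0 \<omega>)) \<omega> = g (data n X \<omega>)"
  proof (rule F.real_cond_exp_charact)
    show "integrable M (\<lambda>\<omega>. \<phi> (data n X \<omega>, X 0 \<omega>))"
      by (rule integrable_distr[OF pair]) (simp only: distr_data_test int)
    show "integrable M (\<lambda>\<omega>. g (data n X \<omega>))"
      by (rule integrable_distr[OF data_meas]) (simp only: distr_data int_g)
    have "data n X \<in> measurable F D"
      unfolding F_def by (rule measurable_vimage_algebra1) (use data_in_space in auto)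
    thus "(\<lambda>\<omega>. g (data n X \<omega>)) \<in> borel_measurable F" by measurable
    fix A assume "A \<in> sets F"
    then obtain A' where A': "A' \<in> sets D" "A = data n X -` A' \<inter> space M"
      unfolding F_def by (subst (asm) sets_vimage_algebra2) (use data_in_space in auto)
    note [measurable] = A'(1)
    have ind: "indicat_real A \<omega> = indicat_real A' (data n X \<omega>)" if "\<omega> \<in> space M" for \<omega>
      using that A'(2) by (auto simp: indicator_def)
    have "(\<integral>\<omega>\<in>A. \<phi> (data n X \<omega>, X 0 \<omega>) \<partial>M)
      = (\<integral>\<omega>. indicat_real A' (fst (data n X \<omega>, X 0 \<omega>)) *\<^sub>R \<phi> (data n X \<omega>, X 0 \<omega>) \<partial>M)"
      unfolding set_lebesgue_integral_def
      by (intro Bochner_Integration.integral_cong refl) (simp add: ind)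
    also have "\<dots> = (\<integral>p. indicat_real A' (fst p) *\<^sub>R \<phi> p \<partial>distr M (D \<Otimes>\<^sub>M P) (\<lambda>\<omega>. (data n X \<omega>, X 0 \<omega>)))"
      by (rule integral_distr[symmetric]) measurable
    also have "\<dots> = (\<integral>p. indicat_real A' (fst p) *\<^sub>R \<phi> p \<partial>(D \<Otimes>\<^sub>M P))" by (simp only: distr_data_test)
    also have "\<dots> = (\<integral>d. (\<integral>z. indicat_real A' (fst (d, z)) *\<^sub>R \<phi> (d, z) \<partial>P) \<partial>D)"
    proof (rule DP.integral_fst'[symmetric])
      show "integrable (D \<Otimes>\<^sub>M P) (\<lambda>p. indicat_real A' (fst p) *\<^sub>R \<phi> p)"
      proof (rule Bochner_Integration.integrable_bound[OF int])
        show "(\<lambda>p. indicat_real A' (fst p) *\<^sub>R \<phi> p) \<in> borel_measurable (D \<Otimes>\<^sub>M P)" by measurable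
        show "AE p in D \<Otimes>\<^sub>M P. norm (indicat_real A' (fst p) *\<^sub>R \<phi> p) \<le> norm (\<phi> p)"
          by (rule AE_I2) (simp add: indicator_def)
      qed
    qed
    also have "\<dots> = (\<integral>d. indicat_real A' d *\<^sub>R g d \<partial>D)" by (simp add: g_def)
    also have "\<dots> = (\<integral>d. indicat_real A' d *\<^sub>R g d \<partial>distr M D (data n X))" by (simp only: distr_data)
    also have "\<dots> = (\<integral>\<omega>. indicat_real A' (data n X \<omega>) *\<^sub>R g (data n X \<omega>) \<partial>M)"
      by (rule integral_distr) measurable
    also have "\<dots> = (\<integral>\<omega>\<in>A. g (data n X \<omega>) \<partial>M)"
      unfolding set_lebesgue_integral_def
      by (intro Bochner_Integration.integral_cong refl) (simp add: ind)
    finally show "(\<integral>\<omega>\<in>A. \<phi> (data n X \<omega>, X 0 \<omega>) \<partial>M) = (\<integral>\<omega>\<in>A. g (data n X \<omega>) \<partial>M)" .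
  qed
  thus ?thesis by (simp add: cond_risk_def F_def g_def \<phi>_def mean_def)
qed

end

section \<open>The oracle inequality\<close>

text \<open>\<open>r\<close> and \<open>rs\<close> are the risks of the ERM and of a risk minimizer,
  \<open>e\<close> and \<open>es\<close> their empirical risks, \<open>l\<close> the residual. The
  sign of \<open>rs\<close> is distinguished because for negative \<open>rs\<close> the term
  \<open>3 * \<epsilon> * rs\<close> works against the claim, and the argument relies on
  \<open>rs\<close> being tiny compared to \<open>l\<close>.\<close>

lemma oracle_inequality_from_deviation:
  fixes r e rs es \<epsilon> l :: real
  assumes dev: "\<bar>r - e\<bar> \<le> 3 / 4 * \<epsilon> * max r l" and devs: "\<bar>rs - es\<bar> \<le> 3 / 4 * \<epsilon> * max rs l"
    and erm: "e \<le> es + l / 1000" and rs: "- l / 1920 \<le> rs" and l: "0 < l" and \<epsilon>: "0 < \<epsilon>" "\<epsilon> < 1 / 2"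
  shows "r \<le> (1 + 3 * \<epsilon>) * rs + l"
proof (rule ccontr)
  assume "\<not> ?thesis"
  hence r: "r > rs + 3 * (\<epsilon> * rs) + l" by (simp add: distrib_right)
  have \<epsilon>l: "\<epsilon> * l \<le> 1 / 2 * l" using \<epsilon> l by (intro mult_right_mono) auto
  have r_pos: "0 < r \<Longrightarrow> \<epsilon> * r \<le> 1 / 2 * r" using \<epsilon> by (intro mult_right_mono) auto
  show False
  proof (cases "0 \<le> rs")
    case True
    have \<epsilon>rs1: "0 \<le> \<epsilon> * rs" using \<epsilon> True by simp
    have "\<epsilon> * (\<epsilon> * rs) \<le> 1 / 2 * (\<epsilon> * rs)" using \<epsilon> by (intro mult_right_mono[OF _ \<epsilon>rs1]) simp
    note \<epsilon>rs = \<epsilon>rs1 this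
    \<comment> \<open>A violation of the claim puts \<open>r\<close> above \<open>l\<close>, so the
      deviation at \<open>r\<close> is a fraction of \<open>r\<close> itself.\<close>
    have rl: "l < r" using r True \<epsilon>rs by linarith
    have "\<bar>r - e\<bar> \<le> 3 / 4 * (\<epsilon> * r)" using dev rl by (simp add: max_def)
    moreover have "(1 - 3 / 4 * \<epsilon>) * r = r - 3 / 4 * (\<epsilon> * r)" by (simp add: left_diff_distrib)
    ultimately have "(1 - 3 / 4 * \<epsilon>) * r \<le> e" by linarith
    moreover have "(1 - 3 / 4 * \<epsilon>) * (rs + 3 * (\<epsilon> * rs) + l) \<le> (1 - 3 / 4 * \<epsilon>) * r"
      using r \<epsilon> by (intro mult_left_mono) auto
    moreover have "(1 - 3 / 4 * \<epsilon>) * (rs + 3 * (\<epsilon> * rs) + l)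
        = rs + 9 / 4 * (\<epsilon> * rs) - 9 / 4 * (\<epsilon> * (\<epsilon> * rs)) + l - 3 / 4 * (\<epsilon> * l)"
      by (simp add: field_simps)
    moreover have "3 / 4 * \<epsilon> * max rs l \<le> 3 / 4 * (\<epsilon> * rs) + 3 / 4 * (\<epsilon> * l)"
      using \<epsilon>rs \<epsilon> l by (auto simp: max_def)
    ultimately show False using devs erm \<epsilon>rs \<epsilon>l l by linarith
  next
    case False
    have "- (1 / 2 * - rs) \<le> \<epsilon> * rs"
      using \<epsilon> False mult_right_mono[of \<epsilon> "1 / 2" "- rs"] by simp
    \<comment> \<open>The negative risk lowers the threshold by at most
      \<open>5 / 2 * l / 1920\<close>, so \<open>max r l\<close> is still close to
      \<open>r\<close>.\<close>
    hence r_lo: "r \<ge> 99 / 100 * l" using r rs l by linarith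
    hence "max r l \<le> r + 1 / 100 * l" "0 < r" using l by (auto simp: max_def)
    hence "3 / 4 * \<epsilon> * max r l \<le> 3 / 4 * \<epsilon> * (r + 1 / 100 * l)" using \<epsilon> by (intro mult_left_mono) auto
    also have "\<dots> = 3 / 4 * (\<epsilon> * r) + 3 / 4 * 1 / 100 * (\<epsilon> * l)" by (simp add: algebra_simps)
    finally have "e \<ge> r - 3 / 4 * (\<epsilon> * r) - 3 / 4 * 1 / 100 * (\<epsilon> * l)" using dev by linarith
    moreover have "\<bar>rs - es\<bar> \<le> 3 / 4 * (\<epsilon> * l)" using devs False l by (simp add: max_def)
    hence "es \<le> 3 / 4 * (\<epsilon> * l)" using False by linarith
    ultimately show False using erm r_lo r_pos[OF \<open>0 < r\<close>] \<epsilon>l l by linarith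
  qed
qed

lemma emp_risk_le_of_ERM:
  assumes erm: "is_ERM loss F n d f" and g: "g \<in> F"
    and tol: "emp_minimizer loss F n d f \<or> 1 / real n \<le> \<delta>" and \<delta>: "0 \<le> \<delta>"
  shows "f \<in> F" "emp_risk n d loss f \<le> emp_risk n d loss g + \<delta>"
proof -
  show "f \<in> F" using erm by (auto simp: is_ERM_def emp_minimizer_def split: if_splits)
  show "emp_risk n d loss f \<le> emp_risk n d loss g + \<delta>"
  proof (cases "emp_minimizer loss F n d f")
    case True
    hence "emp_risk n d loss f \<le> emp_risk n d loss g" using g by (auto simp: emp_minimizer_def)
    thus ?thesis using \<delta> by linarith
  next
    case False
    hence "ereal (emp_risk n d loss f) \<le> (INF g\<in>F. ereal (emp_risk n d loss g)) + ereal (1 / real n)"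
      using erm by (auto simp: is_ERM_def split: if_splits)
    also have "\<dots> \<le> ereal (emp_risk n d loss g) + ereal (1 / real n)"
      by (intro add_right_mono INF_lower g)
    finally have "emp_risk n d loss f \<le> emp_risk n d loss g + 1 / real n" by simp
    thus ?thesis using False tol by linarith
  qed
qed

text \<open>A mean below \<open>- B / n\<close> would make the right-hand side of \<open>var\<close>
  nonpositive, although the second moment is at least the squared mean, which is positive. The bound
  makes a negative minimal risk negligible against the residual.\<close>

lemma (in enveloped_class) mean_lower_bound:
  assumes "0 \<le> B" "g \<in> L" and var: "mean P (\<lambda>z. (g z)\<^sup>2) \<le> B * mean P g + B\<^sup>2 / real n"
  shows "- B / real n \<le> mean P g"
proof (rule ccontr)
  assume "\<not> ?thesis"
  hence neg: "mean P g < - (B / real n)" by simp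
  have "0 \<le> B / real n" using \<open>0 \<le> B\<close> by simp
  hence "mean P g < 0" using neg by linarith
  hence "0 < (mean P g)\<^sup>2" by simp
  also have "\<dots> \<le> B * mean P g + B\<^sup>2 / real n" using mean_sq_le[OF \<open>g \<in> L\<close>] var by linarith
  also have "\<dots> \<le> B * - (B / real n) + B\<^sup>2 / real n"
    using neg \<open>0 \<le> B\<close> by (intro add_right_mono mult_left_mono) auto
  also have "\<dots> = 0" by (simp add: power2_eq_square)
  finally show False by simp
qed

theorem theoremA:
  shows "\<exists>c0::real. 0 < c0 \<and>
    (\<forall>(M :: 'w measure) (P :: 'z measure) (n :: nat) (X :: nat \<Rightarrow> 'w \<Rightarrow> 'z)
      (loss :: ('z \<Rightarrow> real) \<Rightarrow> 'z \<Rightarrow> real) (F :: ('z \<Rightarrow> real) set)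
      (fhat :: (nat \<Rightarrow> 'z) \<Rightarrow> 'z \<Rightarrow> real)
      (B :: real) (\<epsilon> :: real) (lam :: real) (\<rho> :: real \<Rightarrow> real).
      1 \<le> n \<longrightarrow>
      iid_sample M P n X \<longrightarrow>
      F \<subseteq> borel_measurable P \<longrightarrow>
      (\<forall>f\<in>F. loss f \<in> borel_measurable P) \<longrightarrow>
      (\<exists>f\<in>F. \<forall>g\<in>F. risk P loss f \<le> risk P loss g) \<longrightarrow>
      (\<forall>l>0. separable_class P (star_hull_level P (loss ` F) l)) \<longrightarrow>
      (\<lambda>(d, z). loss (fhat d) z) \<in> borel_measurable (data_space P n \<Otimes>\<^sub>M P) \<longrightarrow>
      (AE \<omega> in M. is_ERM loss F n (data n X \<omega>) (fhat (data n X \<omega>))) \<longrightarrow>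
      tolerance_ok M n X loss F fhat c0 \<rho> \<longrightarrow>
      0 \<le> B \<longrightarrow>
      (\<forall>f\<in>F. mean P (\<lambda>z. (loss f z)\<^sup>2) \<le> B * mean P (loss f) + B\<^sup>2 / real n) \<longrightarrow>
      0 < \<epsilon> \<longrightarrow> \<epsilon> < 1 / 2 \<longrightarrow>
      0 < lam \<longrightarrow>
      (\<integral>\<^sup>+\<omega>. emp_dev P n (data n X \<omega>) (star_hull_level P (loss ` F) lam) \<partial>M)
        \<le> ennreal ((\<epsilon> / 4) * lam) \<longrightarrow>
      mono_on {0<..} \<rho> \<longrightarrow>
      (\<forall>x>0. max (ennreal lam)
          (ennreal c0 * ((envelope_norm M n X (loss ` F) + ennreal (B / \<epsilon>)) * ennreal x)
             / ennreal (real n * \<epsilon>))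
        \<le> ennreal (\<rho> x)) \<longrightarrow>
      (\<forall>x>0. 
        measure M {\<omega> \<in> space M. cond_risk M P n X loss fhat \<omega>
            \<le> (1 + 3 * \<epsilon>) * (INF f\<in>F. risk P loss f) + \<rho> x}
        > 1 - 8 * exp (- x)))"
\<comment> \<open>The deviation bound asks for 480. This is doubled because the admissible
  \<open>b\<close> may exceed the exponential norm by a slack as expensive as the main term, and
  rounded up.\<close>
proof (intro exI[of _ "1000::real"] conjI allI impI)
  show "0 < (1000::real)" by simp
  fix M :: "'w measure" and P :: "'z measure" and n and X :: "nat \<Rightarrow> 'w \<Rightarrow> 'z"
    and loss :: "('z \<Rightarrow> real) \<Rightarrow> 'z \<Rightarrow> real" and F fhat and B \<epsilon> lam :: real and \<rho> :: "real \<Rightarrow> real" and x :: real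
  assume n: "1 \<le> n" and iid: "iid_sample M P n X" and F: "F \<subseteq> borel_measurable P"
    and loss_meas: "\<forall>f\<in>F. loss f \<in> borel_measurable P"
    and attained: "\<exists>f\<in>F. \<forall>g\<in>F. risk P loss f \<le> risk P loss g"
    and sep: "\<forall>l>0. separable_class P (star_hull_level P (loss ` F) l)"
    and fhat_meas: "(\<lambda>(d, z). loss (fhat d) z) \<in> borel_measurable (data_space P n \<Otimes>\<^sub>M P)"
    and erm: "AE \<omega> in M. is_ERM loss F n (data n X \<omega>) (fhat (data n X \<omega>))"
    and tol: "tolerance_ok M n X loss F fhat 1000 \<rho>" and B: "0 \<le> B"
    and var: "\<forall>f\<in>F. mean P (\<lambda>z. (loss f z)\<^sup>2) \<le> B * mean P (loss f) + B\<^sup>2 / real n"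
    and \<epsilon>: "0 < \<epsilon>" "\<epsilon> < 1 / 2" and lam: "0 < lam"
    and Edev: "(\<integral>\<^sup>+\<omega>. emp_dev P n (data n X \<omega>) (star_hull_level P (loss ` F) lam) \<partial>M)
        \<le> ennreal ((\<epsilon> / 4) * lam)"
    and "mono_on {0<..} \<rho>"
    and \<rho>: "\<forall>x>0. max (ennreal lam)
          (ennreal 1000 * ((envelope_norm M n X (loss ` F) + ennreal (B / \<epsilon>)) * ennreal x)
             / ennreal (real n * \<epsilon>)) \<le> ennreal (\<rho> x)"
    and x: "0 < x"
  define S where "S = {\<omega> \<in> space M. cond_risk M P n X loss fhat \<omega>
            \<le> (1 + 3 * \<epsilon>) * (INF f\<in>F. risk P loss f) + \<rho> x}"
  show "measure M S > 1 - 8 * exp (- x)"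
  \<comment> \<open>Below ln 8 the claim is trivial. Otherwise \<open>exp x\<close> is at least 8,
    hence above \<open>exp 1\<close>, so \<open>x\<close> is at least 1, as the deviation bound and
    the tolerance step require.\<close>
  proof (cases "1 < 8 * exp (- x)")
    case True
    thus ?thesis using measure_nonneg[of M S] by linarith
  next
    case False
    have x1: "1 \<le> x"
    proof (rule ccontr)
      assume "\<not> 1 \<le> x"
      hence "exp x \<le> exp 1" by simp
      hence "exp x \<le> 3" using exp_le by linarith
      moreover have "8 \<le> exp x" using False by (simp add: exp_minus field_simps)
      ultimately show False by linarith
    qed
    have ne: "0 < real n * \<epsilon>" using n \<epsilon> by simp
    have lam_le: "lam \<le> \<rho> x" and \<rho>_pos: "0 < \<rho> x"
    proof -
      have "ennreal lam \<le> ennreal (\<rho> x)" using \<rho> x by (auto intro: order_trans[OF max.cobounded1])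
      hence "lam \<le> \<rho> x \<or> lam \<le> 0" by (auto simp: ennreal_le_iff2)
      thus "lam \<le> \<rho> x" "0 < \<rho> x" using lam by auto
    qed
    define env where "env = envelope_norm M n X (loss ` F)"
    have \<rho>_env: "ennreal 1000 * ((env + ennreal (B / \<epsilon>)) * ennreal x) / ennreal (real n * \<epsilon>) \<le> ennreal (\<rho> x)"
      using \<rho> x unfolding env_def by (auto intro: order_trans[OF max.cobounded2])
    have Be: "0 \<le> B / \<epsilon>" using B \<epsilon> by simp
    \<comment> \<open>An infinite norm would make the lower bound on \<open>\<rho> x\<close>
      infinite.\<close>
    obtain v where v: "env = ennreal v" "0 \<le> v"
    proof (cases env)
      case top
      hence "ennreal 1000 * ((env + ennreal (B / \<epsilon>)) * ennreal x) / ennreal (real n * \<epsilon>) = \<top>"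
        using x by (simp add: ennreal_top_mult ennreal_mult_top ennreal_top_divide)
      thus ?thesis using \<rho>_env by (simp add: top_unique)
    qed
    have v_le: "1000 * ((v + B / \<epsilon>) * x) \<le> \<rho> x * (real n * \<epsilon>)"
    proof -
      have "ennreal (1000 * ((v + B / \<epsilon>) * x) / (real n * \<epsilon>)) \<le> ennreal (\<rho> x)"
        using \<rho>_env v Be x ne
        by (simp only: v divide_ennreal[symmetric] ennreal_mult ennreal_plus mult_nonneg_nonneg add_nonneg_nonneg less_imp_le
            zero_le_numeral)
      hence "1000 * ((v + B / \<epsilon>) * x) / (real n * \<epsilon>) \<le> \<rho> x" using \<rho>_pos by (subst (asm) ennreal_le_iff) auto
      thus ?thesis using ne by (simp only: pos_divide_le_eq)
    qed
    \<comment> \<open>The slack is chosen so that \<open>s * x\<close> is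
      \<open>n * \<epsilon> * \<rho> x / 1000\<close>, the bound already known for
      \<open>(v + B / \<epsilon>) * x\<close>. It provides a positive admissible \<open>b\<close>
      even when the norm is 0.\<close>
    define s where "s = \<rho> x * (real n * \<epsilon>) / (1000 * x)"
    have "env < ennreal (v + s)" using v x ne \<rho>_pos by (simp add: s_def ennreal_less_iff)
    then obtain b where b: "0 < b" "b < v + s"
      and psi1: "(\<integral>\<^sup>+\<omega>. exp_ennreal ((MAX i\<in>{1..n}. SUP g\<in>loss ` F. ennreal \<bar>g (X i \<omega>)\<bar>) / ennreal b) \<partial>M) \<le> 2"
      unfolding env_def envelope_norm_def psi1_norm_def INF_less_iff by (auto simp: ennreal_less_iff)
    interpret enveloped_class M P n X "loss ` F" b
      by unfold_locales (use n iid loss_meas b psi1 in auto)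
    have bt: "(b + B / \<epsilon>) * x \<le> real n * \<epsilon> * \<rho> x / 480"
    proof -
      have "(b + B / \<epsilon>) * x \<le> (v + B / \<epsilon>) * x + s * x"
        using b x by (simp add: distrib_right[symmetric])
      moreover have "s * x = \<rho> x * (real n * \<epsilon>) / 1000" using x by (simp add: s_def)
      moreover have "0 \<le> \<rho> x * (real n * \<epsilon>)" using \<rho>_pos ne by simp
      ultimately have "(b + B / \<epsilon>) * x \<le> \<rho> x * (real n * \<epsilon>) / 480" using v_le by linarith
      thus ?thesis by (simp add: mult.commute)
    qed
    \<comment> \<open>The quotient is at most \<open>\<epsilon>\<^sup>2 * \<rho> x / 480\<close>,
      and \<open>\<epsilon>\<^sup>2\<close> is below 1/4.\<close>
    have Bn: "B / real n \<le> \<rho> x / 1920"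
    proof -
      have "B / \<epsilon> \<le> B / \<epsilon> * x" using Be x1 mult_left_mono[of 1 x "B / \<epsilon>"] by simp
      also have "\<dots> \<le> (b + B / \<epsilon>) * x" using b x by (intro mult_right_mono) auto
      also note bt
      finally have "B \<le> real n * \<epsilon> * \<rho> x / 480 * \<epsilon>" using \<epsilon> by (simp only: pos_divide_le_eq)
      hence "B / real n \<le> \<rho> x / 480 * (\<epsilon> * \<epsilon>)" using n by (simp add: pos_divide_le_eq mult_ac)
      also have "\<dots> \<le> \<rho> x / 480 * (1 / 2 * (1 / 2))"
        using \<epsilon> \<rho>_pos by (intro mult_left_mono mult_mono) auto
      finally show ?thesis by simp
    qed
    obtain fs where fs: "fs \<in> F" "\<And>g. g \<in> F \<Longrightarrow> risk P loss fs \<le> risk P loss g" using attained by auto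
    have INF: "(INF f\<in>F. risk P loss f) = risk P loss fs"
      by (rule cInf_eq_minimum) (use fs in auto)
    have fs_lower: "- \<rho> x / 1920 \<le> mean P (loss fs)"
      using mean_lower_bound[OF B, of "loss fs"] fs(1) var Bn by auto
    have emp_le: "AE \<omega> in M. fhat (data n X \<omega>) \<in> F \<and>
      emp_risk n (data n X \<omega>) loss (fhat (data n X \<omega>)) \<le> emp_risk n (data n X \<omega>) loss fs + \<rho> x / 1000"
    proof -
      have "AE \<omega> in M. emp_minimizer loss F n (data n X \<omega>) (fhat (data n X \<omega>)) \<or> 1 / real n \<le> \<rho> x / 1000"
        using tol unfolding tolerance_ok_def
      proof
        \<comment> \<open>Since \<open>x\<close> is at least 1, the minimum is 1 and the excess 1 /
          n allowed to an ERM is absorbed by \<open>\<rho> x / 1000\<close>.\<close>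
        assume "\<forall>x>0. 1000 * min 1 x / real n \<le> \<rho> x"
        hence "1000 * min 1 x / real n \<le> \<rho> x" using x by blast
        hence "1 / real n \<le> \<rho> x / 1000" using x1 by (simp add: min_def)
        thus ?thesis by simp
      qed auto
      with erm show ?thesis
      proof eventually_elim
        case (elim \<omega>)
        show ?case using emp_risk_le_of_ERM[OF elim(1) fs(1) elim(2)] \<rho>_pos by simp
      qed
    qed
    have "AE \<omega> in M. loss (fhat (data n X \<omega>)) \<in> loss ` F"
      using emp_le by eventually_elim auto
    hence cond: "AE \<omega> in M. cond_risk M P n X loss fhat \<omega> = mean P (loss (fhat (data n X \<omega>)))"
      by (rule cond_risk_eq[where loss=loss and fhat=fhat, OF fhat_meas])
    have sep_\<rho>: "separable_class P (star_hull_level P (loss ` F) (\<rho> x))" using sep \<rho>_pos by blast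
    have var': "mean P (\<lambda>z. (g z)\<^sup>2) \<le> B * mean P g + B\<^sup>2 / real n" if "g \<in> loss ` F" for g
      using that var by auto
    obtain E where E: "E \<in> sets M" "measure M E \<ge> 1 - 2 * exp (- x)"
      and dev: "\<And>\<omega> g. \<omega> \<in> E \<Longrightarrow> g \<in> loss ` F \<Longrightarrow>
        \<bar>mean P g - emp_mean n (data n X \<omega>) g\<bar> \<le> 3 / 4 * \<epsilon> * max (mean P g) (\<rho> x)"
      using level_deviation[OF B var' lam lam_le \<epsilon> Edev sep_\<rho> x1 bt] by blast
    have "AE \<omega> in M. \<omega> \<in> E \<longrightarrow> \<omega> \<in> S"
      using emp_le cond AE_space
    proof eventually_elim
      case (elim \<omega>)
      show ?case
      proof
        assume \<omega>: "\<omega> \<in> E"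
        have "mean P (loss (fhat (data n X \<omega>))) \<le> (1 + 3 * \<epsilon>) * mean P (loss fs) + \<rho> x"
        proof (rule oracle_inequality_from_deviation)
          show "\<bar>mean P (loss (fhat (data n X \<omega>))) - emp_mean n (data n X \<omega>) (loss (fhat (data n X \<omega>)))\<bar>
            \<le> 3 / 4 * \<epsilon> * max (mean P (loss (fhat (data n X \<omega>)))) (\<rho> x)"
            by (rule dev[OF \<omega>]) (use elim in auto)
          show "\<bar>mean P (loss fs) - emp_mean n (data n X \<omega>) (loss fs)\<bar>
            \<le> 3 / 4 * \<epsilon> * max (mean P (loss fs)) (\<rho> x)"
            by (rule dev[OF \<omega>]) (use fs in auto)
          show "emp_mean n (data n X \<omega>) (loss (fhat (data n X \<omega>))) \<le> emp_mean n (data n X \<omega>) (loss fs) + \<rho> x / 1000"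
            using elim by (simp add: emp_risk_def)
        qed (use \<epsilon> \<rho>_pos fs_lower in auto)
        thus "\<omega> \<in> S" using elim(2,3) unfolding S_def INF mem_Collect_eq by (simp add: risk_def)
      qed
    qed
    moreover have "S \<in> sets M"
    proof -
      have [measurable]: "cond_risk M P n X loss fhat \<in> borel_measurable M"
        unfolding cond_risk_def by (rule borel_measurable_cond_exp2)
      show ?thesis unfolding S_def by measurable
    qed
    ultimately have "measure M E \<le> measure M S" by (rule M.finite_measure_mono_AE)
    moreover have "0 < exp (- x)" by simp
    ultimately show ?thesis using E(2) by linarith
  qed
qed

end
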